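(* Let $\Gamma$ be a rhombic lattice in $\mathbb{R}^2$. Then there exists a fundamental domain $F$ for $\Gamma$ such that $P(\Gamma)$ is a subgroup of $\operatorname{Sym}(F)$ with $[\operatorname{Sym}(F):P(\Gamma)]=2$; in particular, $\operatorname{Sym}(F)$ is isomorphic to the dihedral group $D_4$ of order $8$.
   Context: A lattice $\Gamma\subseteq\mathbb{R}^2$ is the $\mathbb{Z}$-span of two linearly independent vectors. A rhombic lattice is a planar lattice having a basis of two vectors of equal length whose angle is not $\frac{\pi}{2}$, $\frac{\pi}{3}$ or $\frac{2\pi}{3}$ (i.e. it is neither a square nor a hexagonal lattice). The point group $P(\Gamma)$ is the group of Euclidean isometries of $\mathbb{R}^2$ fixing the origin and mapping $\Gamma$ onto itself; for a rhombic lattice it is isomorphic to the dihedral group $D_2$ of order $4$. For $X\subseteq\mathbb{R}^2$, $\operatorname{Sym}(X)$ denotes the group of Euclidean isometries of $\mathbb{R}^2$ leaving $X$ invariant. A fundamental domain for $\Gamma$ is a compact set $F\subseteq\mathbb{R}^2$ such that (i) $F+\Gamma=\{p+v: p\in F, v\in\Gamma\}=\mathbb{R}^2$ and (ii) for every nonzero $v\in\Gamma$, $\operatorname{int}(F)\cap\operatorname{int}(F+v)=\varnothing$. *)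

theory Defs
  imports "HOL-Analysis.Analysis" "HOL-Algebra.Algebra"
begin

definition vec_angle :: "real^2 \<Rightarrow> real^2 \<Rightarrow> real" where
  "vec_angle a b = arccos ((a \<bullet> b) / (norm a * norm b))"

definition lattice_span :: "real^2 \<Rightarrow> real^2 \<Rightarrow> (real^2) set" where
  "lattice_span a b = {of_int m *\<^sub>R a + of_int n *\<^sub>R b | m n. True}"

definition is_lattice :: "(real^2) set \<Rightarrow> bool" where
  "is_lattice L \<longleftrightarrow> (\<exists>a b. a \<noteq> b \<and> independent {a, b} \<and> L = lattice_span a b)"

definition rhombic_lattice :: "(real^2) set \<Rightarrow> bool" where
  "rhombic_lattice L \<longleftrightarrow>
     (\<exists>a b. a \<noteq> b \<and> independent {a, b} \<and> L = lattice_span a b \<and> norm a = norm b \<and>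
            vec_angle a b \<noteq> pi / 2 \<and> vec_angle a b \<noteq> pi / 3 \<and> vec_angle a b \<noteq> 2 * pi / 3)"

definition plane_isometry :: "(real^2 \<Rightarrow> real^2) \<Rightarrow> bool" where
  "plane_isometry f \<longleftrightarrow> (\<forall>x y. dist (f x) (f y) = dist x y) \<and> surj f"

definition Symm :: "(real^2) set \<Rightarrow> (real^2 \<Rightarrow> real^2) set" where
  "Symm Y = {f. plane_isometry f \<and> image f Y = Y}"

definition Sym_group :: "(real^2) set \<Rightarrow> (real^2 \<Rightarrow> real^2) monoid" where
  "Sym_group Y = \<lparr>carrier = Symm Y, mult = (\<circ>), one = id\<rparr>"

definition point_group :: "(real^2) set \<Rightarrow> (real^2 \<Rightarrow> real^2) set" where
  "point_group L = {f. plane_isometry f \<and> f 0 = 0 \<and> image f L = L}"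

definition fundamental_domain :: "(real^2) set \<Rightarrow> (real^2) set \<Rightarrow> bool" where
  "fundamental_domain L F \<longleftrightarrow> compact F \<and>
     {p + v | p v. p \<in> F \<and> v \<in> L} = UNIV \<and>
     (\<forall>v\<in>L. v \<noteq> 0 \<longrightarrow> interior F \<inter> interior ((\<lambda>p. p + v) ` F) = {})"

text \<open>The dihedral group of order 8, realised as Z/4 semidirect Z/2:
  (a,b)(c,d) = (a + (-1)^b c mod 4, b + d mod 2).\<close>
definition D4 :: "(int \<times> int) monoid" where
  "D4 = \<lparr>carrier = {0..3} \<times> {0..1},
         mult = (\<lambda>(a, b) (c, d). ((a + (-1) ^ nat b * c) mod 4, (b + d) mod 2)),
         one = (0, 0)\<rparr>"

end

theory Submission
  imports Defs
begin

text \<open>In orthonormal coordinates along the diagonals of a rhombus with half diagonals \<open>A\<close>, \<open>B\<close> the lattice becomes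
  \<open>L = {(i A, j B) | i + j even}\<close>. The core of the proof is a fundamental domain of \<open>L\<close> that is invariant under all
  eight symmetries of the square. Adding the four points \<open>(\<plusminus>r, 0)\<close>, \<open>(0, \<plusminus>r)\<close> with \<open>r\<close> large does not affect the
  covering and packing conditions, and these are then the only points with a partner at distance \<open>2 r\<close>. So a symmetry
  of the domain permutes them, fixes the origin, and is one of the eight maps; the shortest vectors of \<open>L\<close> show that
  only four of these preserve \<open>L\<close>.

  A domain with square symmetry is one for \<open>L\<close> and for its mirror image \<open>L'\<close> in the diagonal at the same time. If \<open>A / B\<close>
  is rational, then \<open>L\<close> and \<open>L'\<close> have a common transversal in a square grid and a union of triangles suffices. If \<open>A / B\<close>
  is irrational, a domain amounts to perfect matchings between \<open>z + L'\<close> (red points) and \<open>L\<close> (blue points) that have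
  bounded displacement, are equivariant under translations and the symmetries of the square, and are locally constant in
  generic \<open>z\<close>. They are found by cutting the plane into boxes with equally many red and blue points and matching points of
  equal rank. The boundaries of the boxes are governed by an integral cocycle; it is made equivariant
  with bounded error by a hierarchy of nested, well separated tiles constructed by a Baire category argument.\<close>

section \<open>Motions and tiles\<close>

text \<open>The crux is rounding. Along a red row the boundary half way between two blue lines sits
  at a real offset; it must become an integer in such a way that every box has equal counts. This
  follows if the rounded offsets are increments of one function on the places. Over the reals such a
  function, \<open>H0\<close>, exists because both lattices have the same covolume, but it is
  equivariant only up to a sign, integers and a constant. Rounding it therefore needs a viewpoint, a
  motion through which the plane is looked at. The motions have dense orbits of configurations, so
  no open set of configurations meets each orbit just once and singles out a viewpoint. Instead
  every copy of a tile brings its own. Viewpoints are compared only between a copy and a larger one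
  around it: places within \<open>R\<close> of each other see at most two smallest copies, so the
  corrections stay additive and no error accumulates along the hierarchy. \<open>R\<close> is
  therefore at least the size of a box. Genericity costs nothing: a bounded transversal of the
  generic points with locally constant membership has a domain as its closure.\<close>

type_synonym conf = "real \<times> real"
type_synonym place = "int \<times> int"
text \<open>A motion acts on configurations (\<open>ph\<close>) and on places (\<open>pl\<close>), and carries an orientation sign (\<open>ep\<close>).\<close>
datatype mot = Mot (ph: "conf \<Rightarrow> conf") (pl: "place \<Rightarrow> place") (ep: real)

text \<open>A tile is a set of places that is laid out at all configurations of a ball. The copy of \<open>t\<close> displaced by
  \<open>w\<close> is present at \<open>y\<close> if \<open>cp t w y\<close>, and then occupies the places \<open>St t w\<close>.\<close>
datatype tile = Tile (ctr: conf) (rad: real) (cells: "place set")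

definition mot_mul :: "mot \<Rightarrow> mot \<Rightarrow> mot" where
  "mot_mul w v = Mot (ph w \<circ> ph v) (pl w \<circ> pl v) (ep w * ep v)"

definition mot_one :: mot where "mot_one = Mot id id 1"

lemma mul_sel [simp]: "ph (mot_mul w v) = ph w \<circ> ph v" "pl (mot_mul w v) = pl w \<circ> pl v"
  "ep (mot_mul w v) = ep w * ep v"
  by (simp_all add: mot_mul_def)

lemma mot_one_sel [simp]: "ph mot_one = id" "pl mot_one = id" "ep mot_one = 1"
  by (simp_all add: mot_one_def)

lemma mul_assoc: "mot_mul (mot_mul u v) w = mot_mul u (mot_mul v w)"
  by (simp add: mot_mul_def comp_assoc)

lemma mul_one [simp]: "mot_mul w mot_one = w" "mot_mul mot_one w = w"
  by (simp_all add: mot_mul_def mot_one_def mot.expand)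

definition cheb :: "place \<Rightarrow> place \<Rightarrow> int" where
  "cheb p p' = max \<bar>fst p - fst p'\<bar> \<bar>snd p - snd p'\<bar>"

lemma cheb_commute: "cheb p p' = cheb p' p"
  by (simp add: cheb_def abs_minus_commute)

lemma cheb_triangle: "cheb p r \<le> cheb p q + cheb q r"
  unfolding cheb_def by linarith

lemma cheb_self [simp]: "cheb p p = 0"
  by (simp add: cheb_def)

lemma finite_cheb_ball: "finite {p. cheb p q \<le> K}"
proof -
  have "{p. cheb p q \<le> K} \<subseteq> {fst q - K..fst q + K} \<times> {snd q - K..snd q + K}"
    by (auto simp: cheb_def)
  then show ?thesis by (rule finite_subset) auto
qed

definition nbd :: "int \<Rightarrow> place set \<Rightarrow> place set" where
  "nbd R S = {p. \<exists>s\<in>S. cheb p s \<le> R}"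

lemma finite_nbd: "finite S \<Longrightarrow> finite (nbd R S)"
proof -
  assume "finite S"
  moreover have "nbd R S = (\<Union>s\<in>S. {p. cheb p s \<le> R})" by (auto simp: nbd_def)
  ultimately show ?thesis using finite_cheb_ball by auto
qed

lemma nbd_mono: "S \<subseteq> T \<Longrightarrow> R \<le> R' \<Longrightarrow> nbd R S \<subseteq> nbd R' T"
  unfolding nbd_def using order_trans by blast

lemma nbd_nbd: "nbd R (nbd R' S) \<subseteq> nbd (R + R') S"
proof
  fix p assume "p \<in> nbd R (nbd R' S)"
  then obtain q s where "cheb p q \<le> R" "s \<in> S" "cheb q s \<le> R'" unfolding nbd_def by blast
  moreover from this have "cheb p s \<le> R + R'" using cheb_triangle[of p s q] by linarith
  ultimately show "p \<in> nbd (R + R') S" unfolding nbd_def by blast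
qed

lemma nbd_self: "0 \<le> R \<Longrightarrow> S \<subseteq> nbd R S"
  unfolding nbd_def using cheb_self by (smt (verit) mem_Collect_eq subsetI)

definition cp :: "tile \<Rightarrow> mot \<Rightarrow> conf \<Rightarrow> bool" where
  "cp t w y \<longleftrightarrow> dist (ph w y) (ctr t) < rad t"

definition St :: "tile \<Rightarrow> mot \<Rightarrow> place set" where
  "St t w = {p. pl w p \<in> cells t}"

lemma negligible_interior_empty: "negligible S \<Longrightarrow> interior (S :: 'a::euclidean_space set) = {}"
  by (meson interior_subset negligible_subset open_interior open_not_negligible)

text \<open>In the application neither action alone is locally finite: infinitely many motions fix
  all places, and infinitely many keep a configuration in a bounded set. \<open>loc_fin\<close>
  controls both at once, so that at each stage finitely many spheres and displacements decide how
  small a ball has to be.\<close>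

locale motions =
  fixes W :: "mot set"
  assumes one_W: "mot_one \<in> W"
    and mul_W: "w \<in> W \<Longrightarrow> v \<in> W \<Longrightarrow> mot_mul w v \<in> W"
    and inv_W: "w \<in> W \<Longrightarrow> \<exists>v\<in>W. mot_mul v w = mot_one \<and> mot_mul w v = mot_one"
    and iso_ph: "w \<in> W \<Longrightarrow> dist (ph w x) (ph w y) = dist x y"
    and iso_pl: "w \<in> W \<Longrightarrow> cheb (pl w p) (pl w q) = cheb p q"
    and countable_W: "countable W"
    and loc_fin: "finite {w \<in> W. norm (ph w x) \<le> M \<and> pl w p = q}"
    and free: "w \<in> W \<Longrightarrow> w \<noteq> mot_one \<Longrightarrow> interior {y. ph w y = y} = {}"
begin

definition winv :: "mot \<Rightarrow> mot" where
  "winv w = (SOME v. v \<in> W \<and> mot_mul v w = mot_one \<and> mot_mul w v = mot_one)"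

lemma winv: assumes "w \<in> W" shows "winv w \<in> W" "mot_mul (winv w) w = mot_one" "mot_mul w (winv w) = mot_one"
proof -
  have "winv w \<in> W \<and> mot_mul (winv w) w = mot_one \<and> mot_mul w (winv w) = mot_one"
    unfolding winv_def by (rule someI_ex) (use inv_W[OF assms] in blast)
  then show "winv w \<in> W" "mot_mul (winv w) w = mot_one" "mot_mul w (winv w) = mot_one" by auto
qed

lemma winv_ph: assumes "w \<in> W"
  shows "ph (winv w) (ph w y) = y" "ph w (ph (winv w) y) = y"
    "pl (winv w) (pl w p) = p" "pl w (pl (winv w) p) = p" "ep (winv w) * ep w = 1"
proof -
  note i = winv[OF assms]
  show "ph (winv w) (ph w y) = y" using fun_cong[OF arg_cong[OF i(2), of ph], of y] by (simp only: mul_sel mot_one_sel o_apply id_apply)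
  show "ph w (ph (winv w) y) = y" using fun_cong[OF arg_cong[OF i(3), of ph], of y] by (simp only: mul_sel mot_one_sel o_apply id_apply)
  show "pl (winv w) (pl w p) = p" using fun_cong[OF arg_cong[OF i(2), of pl], of p] by (simp only: mul_sel mot_one_sel o_apply id_apply)
  show "pl w (pl (winv w) p) = p" using fun_cong[OF arg_cong[OF i(3), of pl], of p] by (simp only: mul_sel mot_one_sel o_apply id_apply)
  show "ep (winv w) * ep w = 1" using arg_cong[OF i(2), of ep] by (simp only: mul_sel mot_one_sel)
qed

lemma cont_ph: assumes "w \<in> W" shows "continuous_on A (ph w)"
  unfolding continuous_on_iff using iso_ph[OF assms] by metis

lemma nbd_pl: assumes "w \<in> W" shows "p \<in> nbd R {p. pl w p \<in> V} \<longleftrightarrow> pl w p \<in> nbd R V"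
proof
  assume "p \<in> nbd R {p. pl w p \<in> V}"
  then obtain s where s: "pl w s \<in> V" "cheb p s \<le> R" unfolding nbd_def by blast
  then have "cheb (pl w p) (pl w s) \<le> R" by (simp only: iso_pl[OF assms])
  then show "pl w p \<in> nbd R V" unfolding nbd_def using s(1) by blast
next
  assume "pl w p \<in> nbd R V"
  then obtain v where v: "v \<in> V" "cheb (pl w p) v \<le> R" unfolding nbd_def by blast
  have "cheb p (pl (winv w) v) = cheb (pl w p) v"
    using iso_pl[OF assms, of p "pl (winv w) v"] winv_ph[OF assms] by simp
  then have "cheb p (pl (winv w) v) \<le> R" "pl w (pl (winv w) v) \<in> V" using v winv_ph[OF assms] by simp_all
  then show "p \<in> nbd R {p. pl w p \<in> V}" unfolding nbd_def by blast
qed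

lemma St_mul: "St t (mot_mul v w) = {p. pl w p \<in> St t v}"
  by (simp add: St_def)

lemma cp_mul: "cp t (mot_mul v w) y = cp t v (ph w y)"
  by (simp add: cp_def)

text \<open>The form in which local finiteness is applied: few motions bring a finite tile into
  contact with a finite set of places while the configuration stays bounded.\<close>

lemma fin_rel:
  assumes "finite P" "finite Q"
  shows "finite {w \<in> W. norm (ph w x) \<le> M \<and> (\<exists>p\<in>P. pl w p \<in> Q)}"
proof -
  have "{w \<in> W. norm (ph w x) \<le> M \<and> (\<exists>p\<in>P. pl w p \<in> Q)}
      = (\<Union>p\<in>P. \<Union>q\<in>Q. {w \<in> W. norm (ph w x) \<le> M \<and> pl w p = q})" by blast
  then show ?thesis using assms loc_fin by simp
qed

lemma generic_dense:
  fixes U :: "conf set" and C :: "conf set set"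
  assumes "open U" "U \<noteq> {}" "countable C" "\<And>S. S \<in> C \<Longrightarrow> closed S \<and> interior S = {}"
  obtains x where "x \<in> U" "\<And>S. S \<in> C \<Longrightarrow> x \<notin> S"
proof -
  have "UNIV \<subseteq> closure (\<Inter>(uminus ` C) :: conf set)"
  proof (rule Baire)
    fix T assume "T \<in> uminus ` C"
    then obtain S where S: "S \<in> C" "T = - S" by auto
    then have "closure T = UNIV" using assms(4) by (simp add: closure_complement)
    then show "openin (top_of_set UNIV) T \<and> UNIV \<subseteq> closure T"
      using S assms(4) by (auto simp: open_Compl)
  qed (use assms(3) in auto)
  then have "U \<inter> \<Inter>(uminus ` C) \<noteq> {}" using assms(1,2)
    by (metis closure_UNIV open_Int_closure_eq_empty Int_UNIV_right top.extremum_uniqueI)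
  then show ?thesis using that by auto
qed

lemma closed_fix: "w \<in> W \<Longrightarrow> closed {y. ph w y = y}"
  by (intro closed_Collect_eq cont_ph continuous_on_id)

lemma sphere_nowhere: assumes "w \<in> W"
  shows "closed {y. dist (ph w y) c = r} \<and> interior {y. dist (ph w y) (c::conf) = r} = {}"
proof
  show cl: "closed {y. dist (ph w y) c = r}"
    by (intro closed_Collect_eq continuous_intros cont_ph assms)
  have eq: "{y. dist (ph w y) c = r} = sphere (ph (winv w) c) r"
  proof -
    have d: "dist (ph w y) c = dist (ph (winv w) c) y" for y
      using iso_ph[OF assms, of y "ph (winv w) c"] winv_ph[OF assms] by (simp add: dist_commute)
    show ?thesis unfolding sphere_def by (simp only: d)
  qed
  show "interior {y. dist (ph w y) c = r} = {}" unfolding eq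
    by (rule negligible_interior_empty[OF negligible_sphere])
qed

end

context motions
begin

section \<open>Hierarchies of separated tiles\<close>

definition separated :: "int \<Rightarrow> tile list \<Rightarrow> bool" where
  "separated R ts \<longleftrightarrow> (\<forall>y k k' w w'. k \<le> k' \<and> k' < length ts \<and> w \<in> W \<and> w' \<in> W \<and>
     cp (ts ! k) w y \<and> cp (ts ! k') w' y \<and> (k, w) \<noteq> (k', w') \<longrightarrow>
     (k < k' \<and> nbd R (St (ts ! k) w) \<subseteq> St (ts ! k') w') \<or> nbd R (St (ts ! k) w) \<inter> St (ts ! k') w' = {})"

definition closed_up :: "int \<Rightarrow> tile list \<Rightarrow> conf \<Rightarrow> place set \<Rightarrow> bool" where
  "closed_up R ts y V \<longleftrightarrow> (\<forall>k w. k < length ts \<and> w \<in> W \<and> cp (ts ! k) w y \<longrightarrow>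
     nbd R (St (ts ! k) w) \<subseteq> V \<or> nbd R (St (ts ! k) w) \<inter> V = {})"

text \<open>The induction invariant that allows a further tile around any place. \<open>K\<close> is
  uniform in \<open>y\<close> and \<open>V\<close> because the margin \<open>K + 2 * R\<close>
  between copies of the next tile is fixed in terms of it.\<close>

definition closable :: "int \<Rightarrow> tile list \<Rightarrow> int \<Rightarrow> bool" where
  "closable R ts K \<longleftrightarrow> 0 \<le> K \<and> (\<forall>y V. finite V \<longrightarrow>
     (\<exists>V'. finite V' \<and> V \<subseteq> V' \<and> V' \<subseteq> nbd K V \<and> closed_up R ts y V'))"

definition good :: "int \<Rightarrow> tile list \<Rightarrow> bool" where
  "good R ts \<longleftrightarrow> separated R ts \<and> (\<exists>K. closable R ts K) \<and> (\<forall>t\<in>set ts. finite (cells t))"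

definition hit :: "tile list \<Rightarrow> conf set" where
  "hit ts = {y. \<exists>k<length ts. \<exists>w\<in>W. cp (ts ! k) w y \<and> (0, 0) \<in> St (ts ! k) w}"

lemma good_Nil: "good R []"
proof -
  have "closable R [] 0" unfolding closable_def closed_up_def
    using nbd_self[of 0] by (metis less_nat_zero_code list.size(3) order_refl)
  then show ?thesis unfolding good_def separated_def by auto
qed

text \<open>If \<open>V\<close> is closed up at \<open>x\<close>, no old copy near \<open>V\<close> appears inside the ball of radius \<open>r\<close> around \<open>x\<close>,
  and the motions carrying a point of this ball into it move \<open>V\<close> far from itself, then \<open>V\<close> over this ball may be
  added as a tile.\<close>
lemma good_append:
  assumes gs: "separated R ts" and K: "closable R ts K" and R: "0 \<le> R" and fV: "finite V"
    and fin: "\<forall>t\<in>set ts. finite (cells t)"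
    and cl: "closed_up R ts x V" and r: "0 < r"
    and old: "\<And>k w y. k < length ts \<Longrightarrow> w \<in> W \<Longrightarrow> dist y x < r \<Longrightarrow> cp (ts ! k) w y \<Longrightarrow>
        nbd R (St (ts ! k) w) \<inter> V \<noteq> {} \<Longrightarrow> cp (ts ! k) w x"
    and new: "\<And>v y. v \<in> W \<Longrightarrow> v \<noteq> mot_one \<Longrightarrow> dist y x < r \<Longrightarrow> dist (ph v y) x < r \<Longrightarrow>
        nbd (K + 2 * R) {p. pl v p \<in> V} \<inter> V = {}"
  shows "good R (ts @ [Tile x r V])"
proof -
  let ?n = "length ts" and ?t = "Tile x r V" and ?ts = "ts @ [Tile x r V]"
  have K0: "0 \<le> K" using K by (simp add: closable_def)
  have cpt: "cp ?t w y \<longleftrightarrow> dist (ph w y) x < r" for w y by (simp add: cp_def)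
  have Stt: "St ?t w = {p. pl w p \<in> V}" for w by (simp add: St_def)
  have sep_new: "nbd (K + 2 * R) (St ?t w) \<inter> St ?t w' = {}"
    if "w \<in> W" "w' \<in> W" "w \<noteq> w'" "cp ?t w y" "cp ?t w' y" for w w' y
  proof -
    \<comment> \<open>Two copies over \<open>y\<close> are compared at the configuration
      \<open>ph w' y\<close>, from which the second copy is the undisplaced tile and the first is
      displaced by \<open>v\<close>.\<close>
    define v where "v = mot_mul w (winv w')"
    have v: "v \<in> W" "mot_mul v w' = w" unfolding v_def
      using that mul_W winv by (auto simp: mul_assoc)
    have "v \<noteq> mot_one" using v(2) that(3) by auto
    then have e: "nbd (K + 2 * R) {p. pl v p \<in> V} \<inter> V = {}"
      using new[of v "ph w' y"] v that cpt by (metis cp_mul cpt)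
    have S: "St ?t w = {p. pl w' p \<in> {p. pl v p \<in> V}}"
      using v(2) Stt by (metis St_mul)
    show ?thesis
    proof (rule equals0I)
      fix p assume "p \<in> nbd (K + 2 * R) (St ?t w) \<inter> St ?t w'"
      then have "p \<in> nbd (K + 2 * R) {p. pl w' p \<in> {p. pl v p \<in> V}} \<inter> {p. pl w' p \<in> V}"
        using S Stt[of w'] by simp
      then have "pl w' p \<in> nbd (K + 2 * R) {p. pl v p \<in> V} \<inter> V"
        using nbd_pl[OF that(2)] by blast
      then show False using e by blast
    qed
  qed
  have sep_old: "nbd R (St (ts ! k) w) \<subseteq> St ?t w' \<or> nbd R (St (ts ! k) w) \<inter> St ?t w' = {}"
    if "k < ?n" "w \<in> W" "w' \<in> W" "cp (ts ! k) w y" "cp ?t w' y" for k w w' y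
  proof -
    define v where "v = mot_mul w (winv w')"
    have v: "v \<in> W" "mot_mul v w' = w" unfolding v_def
      using that mul_W winv by (auto simp: mul_assoc)
    have cv: "cp (ts ! k) v (ph w' y)" using that(4) v(2) by (metis cp_mul)
    have yx: "dist (ph w' y) x < r" using that(5) cpt by simp
    have S: "St (ts ! k) w = {p. pl w' p \<in> St (ts ! k) v}"
      using v(2) by (metis St_mul)
    have nb: "p \<in> nbd R (St (ts ! k) w) \<longleftrightarrow> pl w' p \<in> nbd R (St (ts ! k) v)" for p
      unfolding S by (rule nbd_pl[OF that(3)])
    show ?thesis
    proof (cases "nbd R (St (ts ! k) v) \<inter> V = {}")
      case True
      then show ?thesis using nb unfolding Stt by blast
    next
      case False
      then have "cp (ts ! k) v x" using old that v cv yx by blast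
      then have "nbd R (St (ts ! k) v) \<subseteq> V" using cl False that(1) v(1) unfolding closed_up_def by blast
      then show ?thesis using nb unfolding Stt by blast
    qed
  qed
  have sub: "nbd R S \<inter> T = {}" if "nbd (K + 2 * R) S \<inter> T = {}" for S T
    using that nbd_mono[of S S R "K + 2 * R"] K0 R by auto
  have "separated R ?ts" unfolding separated_def
  proof (intro allI impI, elim conjE)
    fix y k k' w w'
    assume a: "k \<le> k'" "k' < length ?ts" "w \<in> W" "w' \<in> W" "cp (?ts ! k) w y" "cp (?ts ! k') w' y"
      "(k, w) \<noteq> (k', w')"
    show "(k < k' \<and> nbd R (St (?ts ! k) w) \<subseteq> St (?ts ! k') w') \<or> nbd R (St (?ts ! k) w) \<inter> St (?ts ! k') w' = {}"
    proof (cases "k' < ?n")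
      case True
      then have "?ts ! k = ts ! k" "?ts ! k' = ts ! k'" using a(1) by (simp_all add: nth_append)
      then show ?thesis using gs a True unfolding separated_def by metis
    next
      case False
      then have k': "k' = ?n" using a(2) by simp
      then have k't: "?ts ! k' = ?t" by simp
      show ?thesis
      proof (cases "k < ?n")
        case True
        then have "?ts ! k = ts ! k" by (simp add: nth_append)
        then show ?thesis using sep_old[OF True a(3,4), of y] a(5,6) k' k't True by simp
      next
        case False
        then have k: "k = ?n" using a(1) k' by simp
        then have kt: "?ts ! k = ?t" by simp
        have "w \<noteq> w'" using a(7) k k' by simp
        then show ?thesis using sep_new[OF a(3,4), of y] a(5,6) kt k't sub by simp
      qed
    qed
  qed
  moreover have "\<exists>K'. closable R ?ts K'"
  proof -
    obtain s where s: "\<And>p q. p \<in> V \<Longrightarrow> q \<in> V \<Longrightarrow> cheb p q \<le> s" "0 \<le> s"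
    proof -
      have f: "finite ((\<lambda>(p, q). cheb p q) ` (V \<times> V))" using fV by simp
      define s where "s = Max (insert 0 ((\<lambda>(p, q). cheb p q) ` (V \<times> V)))"
      have "cheb p q \<le> s" if "p \<in> V" "q \<in> V" for p q
        unfolding s_def using f that by (intro Max_ge) auto
      moreover have "0 \<le> s" unfolding s_def using f by simp
      ultimately show ?thesis using that by blast
    qed
    \<comment> \<open>Read from the right: \<open>K + R\<close> is the reach within which new copies
      are absorbed, \<open>s\<close> bounds the diameter of a copy, \<open>R\<close> is its margin,
      and the last \<open>K\<close> pays for closing up under the old tiles.\<close>
    define K' where "K' = K + (R + (s + (K + R)))"
    have "closable R ?ts K'" unfolding closable_def
    proof (intro conjI allI impI)
      show "0 \<le> K'" using K0 R s(2) by (simp add: K'_def)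
      fix y V0 assume V0: "finite (V0 :: place set)"
      \<comment> \<open>All new copies that the later enlargement by \<open>K\<close> could touch
        are absorbed beforehand, so that this enlargement meets no further one.\<close>
      define T where "T = {w \<in> W. cp ?t w y \<and> nbd (K + R) V0 \<inter> St ?t w \<noteq> {}}"
      define V2 where "V2 = V0 \<union> (\<Union>w\<in>T. nbd R (St ?t w))"
      have V2: "V2 \<subseteq> nbd (R + (s + (K + R))) V0"
      proof -
        have "St ?t w \<subseteq> nbd (s + (K + R)) V0" if wT: "w \<in> T" for w
        proof
          fix p assume p: "p \<in> St ?t w"
          obtain q where q: "q \<in> nbd (K + R) V0" "q \<in> St ?t w" and w: "w \<in> W" using wT unfolding T_def by blast
          have "cheb p q = cheb (pl w p) (pl w q)" using iso_pl[OF w] by simp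
          also have "\<dots> \<le> s" using s p q unfolding Stt by simp
          finally have "p \<in> nbd s (nbd (K + R) V0)" using q(1) unfolding nbd_def by blast
          then show "p \<in> nbd (s + (K + R)) V0" using nbd_nbd by blast
        qed
        then have "nbd R (St ?t w) \<subseteq> nbd (R + (s + (K + R))) V0" if "w \<in> T" for w
          using that nbd_nbd nbd_mono[of _ _ R R] by (meson order_refl order_trans)
        moreover have "V0 \<subseteq> nbd (R + (s + (K + R))) V0" by (rule nbd_self) (use K0 R s in auto)
        ultimately show ?thesis unfolding V2_def by blast
      qed
      then have fV2: "finite V2" using finite_nbd[OF V0] finite_subset by blast
      obtain V3 where V3: "finite V3" "V2 \<subseteq> V3" "V3 \<subseteq> nbd K V2" "closed_up R ts y V3"
        using K fV2 unfolding closable_def by blast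
      have "closed_up R ?ts y V3" unfolding closed_up_def
      proof (intro allI impI, elim conjE)
        fix k w assume a: "k < length ?ts" "w \<in> W" "cp (?ts ! k) w y"
        show "nbd R (St (?ts ! k) w) \<subseteq> V3 \<or> nbd R (St (?ts ! k) w) \<inter> V3 = {}"
        proof (cases "k < ?n")
          case True
          then have "?ts ! k = ts ! k" by (simp add: nth_append)
          then show ?thesis using V3(4) a True unfolding closed_up_def by metis
        next
          case False
          then have k: "?ts ! k = ?t" using a(1) by (simp add: nth_append)
          show ?thesis
          proof (rule disjCI)
            assume "nbd R (St (?ts ! k) w) \<inter> V3 \<noteq> {}"
            then obtain p where p: "p \<in> nbd R (St ?t w)" "p \<in> V3" using k by auto
            then obtain q where q: "q \<in> V2" "cheb p q \<le> K" using V3(3) unfolding nbd_def by blast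
            obtain u where u: "u \<in> St ?t w" "cheb p u \<le> R" using p(1) unfolding nbd_def by blast
            have uq: "cheb u q \<le> K + R" using u(2) q(2) cheb_triangle[of u q p] by (simp add: cheb_commute)
            have "w \<in> T"
            proof (cases "q \<in> V0")
              case True
              then have "u \<in> nbd (K + R) V0" using uq unfolding nbd_def by blast
              then show ?thesis unfolding T_def using u(1) a(2,3) k by auto
            next
              case False
              then obtain w2 where w2: "w2 \<in> T" "q \<in> nbd R (St ?t w2)" using q(1) unfolding V2_def by blast
              then obtain u2 where u2: "u2 \<in> St ?t w2" "cheb q u2 \<le> R" unfolding nbd_def by blast
              \<comment> \<open>A new copy reached only through an absorbed one would be within
                \<open>K + 2 * R\<close> of it; this is the origin of that margin.\<close>
              have "cheb u u2 \<le> K + 2 * R" using uq u2(2) cheb_triangle[of u u2 q] by linarith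
              then have "nbd (K + 2 * R) (St ?t w2) \<inter> St ?t w \<noteq> {}"
                using u(1) u2(1) unfolding nbd_def by blast
              then have "w2 = w" using sep_new[of w2 w y] w2(1) a(2,3) k unfolding T_def by auto
              then show ?thesis using w2 by simp
            qed
            then show "nbd R (St (?ts ! k) w) \<subseteq> V3" using V3(2) k unfolding V2_def by auto
          qed
        qed
      qed
      moreover have "V3 \<subseteq> nbd K' V0"
        using V3(3) nbd_mono[OF V2, of K K] nbd_nbd unfolding K'_def by (meson order_refl order_trans)
      moreover have "V0 \<subseteq> V3" using V3(2) V2_def by blast
      ultimately show "\<exists>V'. finite V' \<and> V0 \<subseteq> V' \<and> V' \<subseteq> nbd K' V0 \<and> closed_up R ?ts y V'"
        using V3(1) by blast
    qed
    then show ?thesis by blast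
  qed
  ultimately show ?thesis unfolding good_def using fin fV by auto
qed

text \<open>A generic \<open>x\<close> has trivial stabiliser and avoids the boundary spheres of the earlier tiles, so a small ball around
  it meets the conditions of \<open>good_append\<close>.\<close>
lemma good_step:
  assumes g: "good R ts" and R: "0 \<le> R" and U: "open U" "U \<noteq> {}"
  shows "\<exists>t. good R (ts @ [t]) \<and> U \<inter> hit (ts @ [t]) \<noteq> {}"
proof -
  obtain K where K: "closable R ts K" and K0: "0 \<le> K" using g unfolding good_def closable_def by blast
  define C where "C = (\<lambda>w. {y. ph w y = y}) ` (W - {mot_one}) \<union>
     (\<Union>k\<in>{..<length ts}. (\<lambda>w. {y. dist (ph w y) (ctr (ts ! k)) = rad (ts ! k)}) ` W)"
  have cC: "countable C" unfolding C_def using countable_W by auto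
  have C: "closed S \<and> interior S = {}" if "S \<in> C" for S
    using that sphere_nowhere closed_fix free unfolding C_def by blast
  obtain x where x: "x \<in> U" "\<And>S. S \<in> C \<Longrightarrow> x \<notin> S"
    using generic_dense[OF U cC C] by blast
  have x1: "ph w x \<noteq> x" if "w \<in> W" "w \<noteq> mot_one" for w
    using x(2)[of "{y. ph w y = y}"] that unfolding C_def by auto
  have x2: "dist (ph w x) (ctr (ts ! k)) \<noteq> rad (ts ! k)" if "w \<in> W" "k < length ts" for w k
    using x(2)[of "{y. dist (ph w y) (ctr (ts ! k)) = rad (ts ! k)}"] that unfolding C_def by auto
  obtain V where V: "finite V" "(0, 0) \<in> V" "closed_up R ts x V"
    using K unfolding closable_def by (metis finite.emptyI finite.insertI insert_subset)
  \<comment> \<open>Distances from \<open>x\<close> to the boundary spheres of those old copies that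
    can meet the neighbourhood of \<open>V\<close>. The slack 1 in the norm bound is there because
    \<open>r\<close> will be at most 1.\<close>
  define F1 where "F1 = (\<Union>k\<in>{..<length ts}. (\<lambda>w. \<bar>dist (ph w x) (ctr (ts ! k)) - rad (ts ! k)\<bar>) `
     {w \<in> W. norm (ph w x) \<le> norm (ctr (ts ! k)) + rad (ts ! k) + 1 \<and> (\<exists>p\<in>nbd R V. pl w p \<in> cells (ts ! k))})"
  \<comment> \<open>Halved because \<open>x\<close> is moved by less than \<open>2 * r\<close> once
    \<open>y\<close> and \<open>ph v y\<close> both lie within \<open>r\<close> of
    \<open>x\<close>.\<close>
  define F2 where "F2 = (\<lambda>w. dist (ph w x) x / 2) `
     ({w \<in> W. norm (ph w x) \<le> norm x + 2 \<and> (\<exists>p\<in>nbd (K + 2 * R) V. pl w p \<in> V)} - {mot_one})"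
  have fF1: "finite F1" unfolding F1_def
    by (intro finite_UN_I finite_imageI fin_rel finite_nbd V) (use g in \<open>auto simp: good_def\<close>)
  have fF2: "finite F2" unfolding F2_def
    by (intro finite_imageI finite_Diff fin_rel finite_nbd V)
  define r where "r = Min (insert 1 (F1 \<union> F2))"
  have "0 < a" if a: "a \<in> insert 1 (F1 \<union> F2)" for a
  proof -
    consider "a = 1" | "a \<in> F1" | "a \<in> F2" using a by blast
    then show ?thesis
    proof cases
      case 2
      then obtain k w where "k < length ts" "w \<in> W" "a = \<bar>dist (ph w x) (ctr (ts ! k)) - rad (ts ! k)\<bar>"
        unfolding F1_def by blast
      then show ?thesis using x2[of w k] by simp
    next
      case 3
      then obtain w where "w \<in> W" "w \<noteq> mot_one" "a = dist (ph w x) x / 2" unfolding F2_def by blast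
      then show ?thesis using x1[of w] by (metis half_gt_zero zero_less_dist_iff)
    qed simp
  qed
  then have r0: "0 < r" unfolding r_def using fF1 fF2 by (subst Min_gr_iff) auto
  have rle: "r \<le> a" if "a \<in> insert 1 (F1 \<union> F2)" for a
    unfolding r_def using fF1 fF2 that by (intro Min_le) auto
  have r1: "r \<le> 1" using rle by auto
  have sym: "nbd L S \<inter> T \<noteq> {} \<Longrightarrow> \<exists>p\<in>nbd L T. p \<in> S" for L S T
    unfolding nbd_def by (auto simp: cheb_commute)
  have "good R (ts @ [Tile x r V])"
  proof (rule good_append[OF _ K R V(1) _ V(3) r0])
    show "separated R ts" "\<forall>t\<in>set ts. finite (cells t)" using g by (auto simp: good_def)
  next
    fix k w y assume a: "k < length ts" "w \<in> W" "dist y x < r" "cp (ts ! k) w y"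
      "nbd R (St (ts ! k) w) \<inter> V \<noteq> {}"
    have d: "\<bar>dist (ph w y) (ctr (ts ! k)) - dist (ph w x) (ctr (ts ! k))\<bar> \<le> dist y x"
      using iso_ph[OF a(2), of y x] abs_dist_diff_le[of "ph w y" "ctr (ts ! k)" "ph w x"]
      by (simp add: dist_commute[of "ctr (ts ! k)"])
    have lt: "dist (ph w y) (ctr (ts ! k)) < rad (ts ! k)" using a(4) by (simp add: cp_def)
    have "norm (ph w x) \<le> norm (ctr (ts ! k)) + dist (ph w x) (ctr (ts ! k))"
      by (metis dist_norm norm_triangle_sub)
    then have "norm (ph w x) \<le> norm (ctr (ts ! k)) + rad (ts ! k) + 1" using d lt a(3) r1 by linarith
    moreover have "\<exists>p\<in>nbd R V. pl w p \<in> cells (ts ! k)" using sym[OF a(5)] unfolding St_def by blast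
    ultimately have "\<bar>dist (ph w x) (ctr (ts ! k)) - rad (ts ! k)\<bar> \<in> F1"
      unfolding F1_def using a(1,2) by blast
    then have "r \<le> \<bar>dist (ph w x) (ctr (ts ! k)) - rad (ts ! k)\<bar>" using rle by blast
    then show "cp (ts ! k) w x" unfolding cp_def using d lt a(3) by linarith
  next
    fix v y assume a: "v \<in> W" "v \<noteq> mot_one" "dist y x < r" "dist (ph v y) x < r"
    show "nbd (K + 2 * R) {p. pl v p \<in> V} \<inter> V = {}"
    proof (rule ccontr)
      assume ne: "nbd (K + 2 * R) {p. pl v p \<in> V} \<inter> V \<noteq> {}"
      have d: "dist (ph v x) x < 2 * r"
        using iso_ph[OF a(1), of x y] a(3,4) dist_triangle[of "ph v x" x "ph v y"] by (simp add: dist_commute)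
      have "norm (ph v x) \<le> norm x + dist (ph v x) x" by (metis dist_norm norm_triangle_sub)
      then have "norm (ph v x) \<le> norm x + 2" using d r1 by linarith
      then have "dist (ph v x) x / 2 \<in> F2" unfolding F2_def using sym[OF ne] a by auto
      then have "r \<le> dist (ph v x) x / 2" using rle by blast
      then show False using d by simp
    qed
  qed
  moreover have "x \<in> hit (ts @ [Tile x r V])"
    unfolding hit_def cp_def St_def using one_W r0 V(2)
    by (auto intro!: exI[of _ "length ts"] bexI[of _ mot_one])
  ultimately show ?thesis using x(1) by blast
qed

definition copyof :: "(nat \<Rightarrow> tile) \<Rightarrow> conf \<Rightarrow> place \<Rightarrow> nat \<Rightarrow> mot \<Rightarrow> bool" where
  "copyof T y p k w \<longleftrightarrow> w \<in> W \<and> cp (T k) w y \<and> p \<in> St (T k) w"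

text \<open>Step \<open>n\<close> serves the \<open>n\<close>-th set of a countable base, so the
  origin is covered over a dense set of configurations. Each list extends its predecessor, and
  separation concerns only two tiles at a time, so it passes to the limit although the closing
  constants are not bounded along the way.\<close>

lemma toast_exists:
  assumes R: "0 \<le> R"
  obtains T :: "nat \<Rightarrow> tile" where
    "\<And>k. finite (cells (T k))"
    "\<And>y k k' w w'. k \<le> k' \<Longrightarrow> w \<in> W \<Longrightarrow> w' \<in> W \<Longrightarrow> cp (T k) w y \<Longrightarrow> cp (T k') w' y \<Longrightarrow> (k, w) \<noteq> (k', w') \<Longrightarrow>
      (k < k' \<and> nbd R (St (T k) w) \<subseteq> St (T k') w') \<or> nbd R (St (T k) w) \<inter> St (T k') w' = {}"
    "\<And>U. open U \<Longrightarrow> U \<noteq> {} \<Longrightarrow> \<exists>y\<in>U. \<exists>k w. copyof T y (0, 0) k w"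
proof -
  obtain \<B> :: "conf set set" where B: "countable \<B>" "\<And>S. S \<in> \<B> \<Longrightarrow> open S"
      "\<And>S. open S \<Longrightarrow> \<exists>U. U \<subseteq> \<B> \<and> S = \<Union>U"
    using univ_second_countable by blast
  define \<C> where "\<C> = \<B> - {{}}"
  have "\<C> \<noteq> {}"
  proof
    assume "\<C> = {}"
    moreover obtain U where "U \<subseteq> \<B>" "(UNIV :: conf set) = \<Union>U" using B(3)[of UNIV] by auto
    ultimately have "\<Union>U \<subseteq> {}" "(UNIV :: conf set) = \<Union>U" unfolding \<C>_def by blast+
    then show False by blast
  qed
  moreover have "countable \<C>" using B(1) unfolding \<C>_def by auto
  ultimately obtain b :: "nat \<Rightarrow> conf set" where b: "range b = \<C>" by (metis uncountable_def)
  have bC: "b n \<in> \<C>" for n using b by blast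
  then have ob: "open (b n)" "b n \<noteq> {}" for n using B(2) unfolding \<C>_def by blast+
  have "\<exists>f. \<forall>n. good R (f n) \<and> (\<exists>t. f (Suc n) = f n @ [t] \<and> b n \<inter> hit (f (Suc n)) \<noteq> {})"
  proof -
    have "\<exists>f. \<forall>n. (good R (f n) \<and> length (f n) = n) \<and> (\<exists>t. f (Suc n) = f n @ [t] \<and> b n \<inter> hit (f (Suc n)) \<noteq> {})"
    proof (rule dependent_nat_choice)
      show "\<exists>ts. good R ts \<and> length ts = 0" using good_Nil by blast
      fix ts n assume "good R ts \<and> length ts = n"
      then show "\<exists>ts'. (good R ts' \<and> length ts' = Suc n) \<and> (\<exists>t. ts' = ts @ [t] \<and> b n \<inter> hit ts' \<noteq> {})"
        using good_step[OF _ R ob(1)[of n] ob(2)[of n], of ts] by auto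
    qed
    then show ?thesis by blast
  qed
  then obtain f where f: "\<And>n. good R (f n)" "\<And>n. \<exists>t. f (Suc n) = f n @ [t]" "\<And>n. b n \<inter> hit (f (Suc n)) \<noteq> {}"
    by metis
  have pre: "\<exists>us. f (n + m) = f n @ us \<and> length us = m" for n m
  proof (induction m)
    case (Suc m)
    then obtain us where us: "f (n + m) = f n @ us" "length us = m" by blast
    obtain t where "f (Suc (n + m)) = f (n + m) @ [t]" using f(2) by blast
    then have "f (n + Suc m) = f n @ (us @ [t])" using us by simp
    then show ?case using us(2) by (intro exI[of _ "us @ [t]"]) simp
  qed simp
  define c where "c = length (f 0)"
  have len: "length (f n) = c + n" for n using pre[of 0 n] unfolding c_def by auto
  define T where "T k = f (Suc k) ! k" for k
  have T: "f n ! k = T k" if "k < length (f n)" for n k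
  proof (cases "n \<le> Suc k")
    case True
    then obtain us where "f (Suc k) = f n @ us" using pre[of n "Suc k - n"] by auto
    then show ?thesis unfolding T_def using that by (simp add: nth_append)
  next
    case False
    then obtain us where "f n = f (Suc k) @ us" using pre[of "Suc k" "n - Suc k"] by auto
    then show ?thesis unfolding T_def using len[of "Suc k"] by (simp add: nth_append)
  qed
  show ?thesis
  proof (rule that[of T])
    fix k
    have "T k \<in> set (f (Suc k))" unfolding T_def using len[of "Suc k"] by simp
    then show "finite (cells (T k))" using f(1)[of "Suc k"] unfolding good_def by blast
  next
    fix y k k' w w'
    assume a: "k \<le> (k'::nat)" "w \<in> W" "w' \<in> W" "cp (T k) w y" "cp (T k') w' y" "(k, w) \<noteq> (k', w')"
    have l: "k' < length (f (Suc k'))" "k < length (f (Suc k'))" using len[of "Suc k'"] a(1) by auto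
    have "separated R (f (Suc k'))" using f(1) unfolding good_def by blast
    then show "(k < k' \<and> nbd R (St (T k) w) \<subseteq> St (T k') w') \<or> nbd R (St (T k) w) \<inter> St (T k') w' = {}"
      unfolding separated_def using a l T by metis
  next
    fix U :: "conf set" assume U: "open U" "U \<noteq> {}"
    obtain \<U> where "\<U> \<subseteq> \<B>" "U = \<Union>\<U>" using B(3)[OF U(1)] by blast
    then obtain S where S: "S \<in> \<B>" "S \<noteq> {}" "S \<subseteq> U" using U(2) by blast
    then have "S \<in> range b" using b unfolding \<C>_def by blast
    then obtain n where n: "b n = S" by blast
    obtain y where y: "y \<in> S" "y \<in> hit (f (Suc n))" using f(3)[of n] n by blast
    then obtain k w where "k < length (f (Suc n))" "w \<in> W" "cp (f (Suc n) ! k) w y" "(0, 0) \<in> St (f (Suc n) ! k) w"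
      unfolding hit_def by blast
    then have "copyof T y (0, 0) k w" using T unfolding copyof_def by simp
    then show "\<exists>y\<in>U. \<exists>k w. copyof T y (0, 0) k w" using S(3) y(1) by blast
  qed
qed

end

section \<open>The group of the two lattices\<close>

text \<open>A configuration \<open>y\<close> describes two point sets: the blue points \<open>(i A, (i + 2 m) B)\<close> of the lattice
  and the red points \<open>y + ((q + 2 m) B, q A)\<close> of a translate of the lattice reflected in the diagonal. The place
  \<open>(i, q)\<close> sits between the lines \<open>i\<close>, \<open>i + 1\<close> of blue points and the rows \<open>q\<close>, \<open>q + 1\<close> of red points.\<close>
definition trn :: "real \<Rightarrow> real \<Rightarrow> int \<Rightarrow> int \<Rightarrow> mot" where
  "trn A B i j = Mot (\<lambda>y. (fst y + of_int i * A, snd y + of_int j * B)) (\<lambda>p. (fst p + i, snd p)) 1"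

text \<open>The gap between the lines \<open>i\<close> and \<open>i + 1\<close> becomes the one
  between \<open>- i - 1\<close> and \<open>- i\<close>, whence \<open>- 1 - i\<close>. Counting
  points from the left turns into counting from the right, whence the sign.\<close>

definition mir :: mot where
  "mir = Mot (\<lambda>y. (- fst y, snd y)) (\<lambda>p. (- 1 - fst p, snd p)) (- 1)"

text \<open>Reflection in the diagonal exchanges the colours; bringing the new blue lattice back to
  the origin is done by composing with a point reflection, which negates all indices of lines and
  rows.\<close>

definition swp :: mot where
  "swp = Mot (\<lambda>y. (snd y, fst y)) (\<lambda>p. (- 1 - snd p, - 1 - fst p)) 1"

locale irrational_ratio =
  fixes A B :: real
  assumes A0: "0 < A" and B0: "0 < B" and irr: "A / B \<notin> \<rat>"
begin

inductive_set W :: "mot set" where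
  W_one: "mot_one \<in> W"
| W_trn: "w \<in> W \<Longrightarrow> even (i + j) \<Longrightarrow> mot_mul (trn A B i j) w \<in> W"
| W_mir: "w \<in> W \<Longrightarrow> mot_mul mir w \<in> W"
| W_swp: "w \<in> W \<Longrightarrow> mot_mul swp w \<in> W"

definition sg :: "bool \<Rightarrow> real" where "sg s = (if s then 1 else - 1)"
definition gi :: "bool \<Rightarrow> int \<Rightarrow> int" where "gi s x = (if s then x else - 1 - x)"

text \<open>Normal form of the motions: a possible swap, two signs and a translation of each
  coordinate. Only \<open>i\<close> and \<open>q\<close> shift places; \<open>p\<close> and
  \<open>j\<close> are visible in the configuration alone.\<close>

definition mk :: "bool \<Rightarrow> bool \<Rightarrow> bool \<Rightarrow> int \<Rightarrow> int \<Rightarrow> int \<Rightarrow> int \<Rightarrow> mot" where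
  "mk b s1 s2 i j p q = Mot
     (\<lambda>y. (sg s1 * (if b then snd y else fst y) + (of_int i * A + of_int p * B),
           sg s2 * (if b then fst y else snd y) + (of_int q * A + of_int j * B)))
     (\<lambda>c. if b then (gi (\<not> s1) (snd c) + i, gi (\<not> s2) (fst c) - q)
           else (gi s1 (fst c) + i, gi s2 (snd c) - q))
     (sg s1 * sg s2)"

lemma mk_one: "mk False True True 0 0 0 0 = mot_one"
  by (simp add: mk_def mot_one_def sg_def gi_def fun_eq_iff)

lemma mk_trn: "mot_mul (trn A B i' j') (mk b s1 s2 i j p q) = mk b s1 s2 (i' + i) (j' + j) p q"
  by (auto simp: mk_def mot_mul_def trn_def fun_eq_iff algebra_simps)

lemma mk_mir: "mot_mul mir (mk b s1 s2 i j p q) = mk b (\<not> s1) s2 (- i) j (- p) q"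
  by (auto simp: mk_def mot_mul_def mir_def fun_eq_iff algebra_simps sg_def gi_def)

lemma mk_swp: "mot_mul swp (mk b s1 s2 i j p q) = mk (\<not> b) s2 s1 q p j i"
  by (auto simp: mk_def mot_mul_def swp_def fun_eq_iff algebra_simps sg_def gi_def)

lemma W_form: "w \<in> W \<Longrightarrow> \<exists>b s1 s2 i j p q. w = mk b s1 s2 i j p q \<and> even (i + j) \<and> even (p + q)"
proof (induction rule: W.induct)
  case W_one
  then show ?case using mk_one by (metis add.right_neutral even_zero)
next
  case (W_trn w i' j')
  then obtain b s1 s2 i j p q where "w = mk b s1 s2 i j p q" "even (i + j)" "even (p + q)" by blast
  then have "mot_mul (trn A B i' j') w = mk b s1 s2 (i' + i) (j' + j) p q" "even (i' + i + (j' + j))"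
    using mk_trn W_trn(2) by simp_all
  then show ?case using \<open>even (p + q)\<close> by blast
next
  case (W_mir w)
  then obtain b s1 s2 i j p q where "w = mk b s1 s2 i j p q" "even (i + j)" "even (p + q)" by blast
  then have "mot_mul mir w = mk b (\<not> s1) s2 (- i) j (- p) q" "even (- i + j)" "even (- p + q)"
    using mk_mir by simp_all
  then show ?case by blast
next
  case (W_swp w)
  then obtain b s1 s2 i j p q where "w = mk b s1 s2 i j p q" "even (i + j)" "even (p + q)" by blast
  then have "mot_mul swp w = mk (\<not> b) s2 s1 q p j i" "even (q + p)" "even (j + i)"
    using mk_swp by (simp_all add: add.commute)
  then show ?case by blast
qed

lemma mul_W: "w \<in> W \<Longrightarrow> v \<in> W \<Longrightarrow> mot_mul w v \<in> W"
  by (induction rule: W.induct) (auto simp: mul_assoc intro: W.intros)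

lemma trn_W: "even (i + j) \<Longrightarrow> trn A B i j \<in> W" and mir_W: "mir \<in> W" and swp_W: "swp \<in> W"
  using W_trn[OF W_one] W_mir[OF W_one] W_swp[OF W_one] by simp_all

lemma gen_inv: "mot_mul (trn A B (- i) (- j)) (trn A B i j) = mot_one" "mot_mul (trn A B i j) (trn A B (- i) (- j)) = mot_one"
  "mot_mul mir mir = mot_one" "mot_mul swp swp = mot_one"
  by (simp_all add: mot_mul_def mot_one_def trn_def mir_def swp_def fun_eq_iff)

lemma inv_step:
  assumes "mot_mul h g = mot_one" "mot_mul g h = mot_one" "mot_mul v w = mot_one" "mot_mul w v = mot_one"
  shows "mot_mul (mot_mul v h) (mot_mul g w) = mot_one" "mot_mul (mot_mul g w) (mot_mul v h) = mot_one"
  using assms by (metis mul_assoc mul_one(2))+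

lemma inv_W: "w \<in> W \<Longrightarrow> \<exists>v\<in>W. mot_mul v w = mot_one \<and> mot_mul w v = mot_one"
proof (induction rule: W.induct)
  case W_one
  then show ?case using W.W_one mul_one by metis
next
  case (W_trn w i j)
  then obtain v where v: "v \<in> W" "mot_mul v w = mot_one" "mot_mul w v = mot_one" by blast
  have "trn A B (- i) (- j) \<in> W" using W_trn(2) by (intro trn_W) simp
  then show ?case using inv_step[OF gen_inv(1,2) v(2,3)] mul_W[OF v(1)] by blast
next
  case (W_mir w)
  then obtain v where v: "v \<in> W" "mot_mul v w = mot_one" "mot_mul w v = mot_one" by blast
  then show ?case using inv_step[OF gen_inv(3,3) v(2,3)] mul_W[OF v(1) mir_W] by blast
next
  case (W_swp w)
  then obtain v where v: "v \<in> W" "mot_mul v w = mot_one" "mot_mul w v = mot_one" by blast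
  then show ?case using inv_step[OF gen_inv(4,4) v(2,3)] mul_W[OF v(1) swp_W] by blast
qed

lemma lin_indep: assumes "of_int i * A + of_int p * B = 0" shows "i = 0" "p = 0"
proof -
  show "i = 0"
  proof (rule ccontr)
    assume "i \<noteq> 0"
    then have "A / B = of_int (- p) / of_int i" using assms B0 by (simp add: field_simps)
    then show False using irr by (metis Rats_divide Rats_of_int)
  qed
  then show "p = 0" using assms B0 by simp
qed

lemma countable_W: "countable W"
proof -
  have "W \<subseteq> range (\<lambda>(b, s1, s2, i, j, p, q). mk b s1 s2 i j p q)"
    using W_form by (fastforce simp: image_iff)
  then show ?thesis by (rule countable_subset) simp
qed

lemma iso_ph_mk: "dist (ph (mk b s1 s2 i j p q) x) (ph (mk b s1 s2 i j p q) y) = dist x y"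
  by (auto simp: mk_def dist_prod_def dist_real_def sg_def power2_commute algebra_simps add.commute)

lemma iso_pl_mk: "cheb (pl (mk b s1 s2 i j p q) x) (pl (mk b s1 s2 i j p q) y) = cheb x y"
  by (auto simp: mk_def cheb_def gi_def)

text \<open>The image of one place bounds \<open>i\<close> and \<open>q\<close>; given these, the
  bound on the configuration bounds \<open>p\<close> and \<open>j\<close>.\<close>

lemma loc_fin: "finite {w \<in> W. norm (ph w x) \<le> M \<and> pl w c = c'}"
proof -
  define N0 :: int where "N0 = \<bar>fst c\<bar> + \<bar>snd c\<bar> + \<bar>fst c'\<bar> + \<bar>snd c'\<bar> + 1"
  define N :: int where "N = N0 + \<lceil>(M + norm x + of_int N0 * A) / B\<rceil>"
  define S where "S = (\<lambda>(b, s1, s2, i, j, p, q). mk b s1 s2 i j p q) `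
     (UNIV \<times> UNIV \<times> UNIV \<times> {- N0..N0} \<times> {- N..N} \<times> {- N..N} \<times> {- N0..N0})"
  have "w \<in> S" if w: "w \<in> W" "norm (ph w x) \<le> M" "pl w c = c'" for w
  proof -
    obtain b s1 s2 i j p q where mk: "w = mk b s1 s2 i j p q" using W_form[OF w(1)] by blast
    have iq: "i \<in> {- N0..N0}" "q \<in> {- N0..N0}"
      using w(3) unfolding mk mk_def N0_def by (auto simp: gi_def split: if_splits)
    have bnd: "k \<in> {- N..N}" if k: "\<bar>sg s * u + (of_int l * A + of_int k * B)\<bar> \<le> M" "l \<in> {- N0..N0}" "\<bar>u\<bar> \<le> norm x" for s u k l
    proof -
      have "\<bar>of_int l * A\<bar> \<le> of_int N0 * A" using k(2) A0 by (auto simp: abs_mult intro!: mult_right_mono)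
      moreover have "\<bar>sg s * u\<bar> = \<bar>u\<bar>" by (simp add: sg_def)
      ultimately have "\<bar>of_int k * B\<bar> \<le> M + norm x + of_int N0 * A" using k(1,3) by linarith
      then have "\<bar>of_int k\<bar> \<le> (M + norm x + of_int N0 * A) / B" using B0 by (simp add: abs_mult field_simps)
      then have "\<bar>of_int k\<bar> \<le> (of_int \<lceil>(M + norm x + of_int N0 * A) / B\<rceil> :: real)" by linarith
      then have "\<bar>k\<bar> \<le> \<lceil>(M + norm x + of_int N0 * A) / B\<rceil>" by (metis of_int_abs of_int_le_iff)
      moreover have "0 \<le> N0" by (simp add: N0_def)
      ultimately show ?thesis unfolding N_def atLeastAtMost_iff by linarith
    qed
    have f: "\<bar>fst z\<bar> \<le> norm z" "\<bar>snd z\<bar> \<le> norm z" for z :: conf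
      using norm_fst_le[of "fst z" "snd z"] norm_snd_le[of "snd z" "fst z"] by simp_all
    have "\<bar>fst (ph w x)\<bar> \<le> M" "\<bar>snd (ph w x)\<bar> \<le> M" using f[of "ph w x"] w(2) by linarith+
    then have "p \<in> {- N..N}" "j \<in> {- N..N}"
      using bnd[of s1 "if b then snd x else fst x" i p] bnd[of s2 "if b then fst x else snd x" q j] iq f[of x]
      unfolding mk mk_def by (auto split: if_splits)
    then show ?thesis unfolding S_def mk using iq by force
  qed
  then have "{w \<in> W. norm (ph w x) \<le> M \<and> pl w c = c'} \<subseteq> S" by blast
  moreover have "finite S" unfolding S_def by simp
  ultimately show ?thesis using finite_subset by blast
qed

text \<open>A swap or a sign change has its fixed points on a line, and a nontrivial translation has
  none because \<open>A\<close> and \<open>B\<close> are linearly independent over the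
  rationals.\<close>

lemma free:
  assumes w: "w \<in> W" "w \<noteq> mot_one"
  shows "interior {y. ph w y = y} = {}"
proof -
  obtain b s1 s2 i j p q where mk: "w = mk b s1 s2 i j p q" using W_form[OF w(1)] by blast
  have "negligible {y. ph w y = y}"
  proof (cases "b \<or> \<not> s1")
    case True
    define a where "a = (if b then (1, - sg s1) else (2, 0) :: conf)"
    have "{y. ph w y = y} \<subseteq> {y. a \<bullet> y = of_int i * A + of_int p * B}"
      using True unfolding mk mk_def a_def by (auto simp: inner_prod_def sg_def algebra_simps prod_eq_iff)
    moreover have "a \<noteq> 0" unfolding a_def by (auto simp: zero_prod_def)
    ultimately show ?thesis using negligible_hyperplane negligible_subset by blast
  next
    case False
    show ?thesis
    proof (cases s2)
      case True
      have "of_int i * A + of_int p * B \<noteq> 0 \<or> of_int q * A + of_int j * B \<noteq> 0"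
      proof (rule ccontr)
        assume "\<not> ?thesis"
        then have "i = 0" "p = 0" "q = 0" "j = 0" using lin_indep by blast+
        then show False using w(2) mk False True mk_one by simp
      qed
      then have "{y. ph w y = y} = {}" using False True unfolding mk mk_def by (auto simp: sg_def prod_eq_iff)
      then show ?thesis by (simp only: negligible_empty)
    next
      case s2: False
      have "{y. ph w y = y} \<subseteq> {y. (0, 2) \<bullet> y = of_int q * A + of_int j * B}"
        using False s2 unfolding mk mk_def by (auto simp: inner_prod_def sg_def algebra_simps prod_eq_iff)
      moreover have "(0, 2 :: real) \<noteq> (0 :: conf)" by (simp add: zero_prod_def)
      ultimately show ?thesis using negligible_hyperplane negligible_subset by blast
    qed
  qed
  then show ?thesis by (rule negligible_interior_empty)
qed

sublocale motions W
proof
  show "mot_one \<in> W" by (rule W_one)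
  show "\<And>w v. w \<in> W \<Longrightarrow> v \<in> W \<Longrightarrow> mot_mul w v \<in> W" by (rule mul_W)
  show "\<And>w. w \<in> W \<Longrightarrow> \<exists>v\<in>W. mot_mul v w = mot_one \<and> mot_mul w v = mot_one" by (rule inv_W)
  show "dist (ph w x) (ph w y) = dist x y" if "w \<in> W" for w x y using W_form[OF that] iso_ph_mk by blast
  show "cheb (pl w x) (pl w y) = cheb x y" if "w \<in> W" for w x y using W_form[OF that] iso_pl_mk by blast
qed (use countable_W loc_fin free in auto)

section \<open>The real potential of the boundary offsets and its behaviour under motions\<close>

lemma even_succ: "even (n * (n + 1))" for n :: int by simp

text \<open>The increments of \<open>H0\<close> across a row or a line are, up to integers, the offsets at which the boundary half way
  between two lines (two rows) crosses that row (line); this determines \<open>H0\<close> up to constants and integers.\<close>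
definition H0 :: "conf \<Rightarrow> place \<Rightarrow> real" where
  "H0 y p = A / (2 * B) * (of_int (fst p) + 1/2) * (of_int (snd p) + 1/2)
     - of_int (snd p) * fst y / (2 * B) + of_int (fst p) * snd y / (2 * B)
     - of_int (snd p * (snd p + 1)) / 4 - of_int (fst p * (fst p + 1)) / 4
     - of_int (fst p + snd p) / 2"

text \<open>The parity condition of the lattice enters here: with \<open>j = i + 2 * k\<close> the
  part that depends on the place is the integer \<open>fst p * k\<close>.\<close>

lemma H0_trn: assumes "even (i + j)"
  shows "H0 (ph (trn A B i j) y) (pl (trn A B i j) p) - H0 y p
    - (A / (2 * B) * of_int i / 2 + of_int i * (snd y + of_int j * B) / (2 * B) - of_int (i * (i + 1)) / 4 - of_int i / 2) \<in> \<int>"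
proof -
  obtain k where k: "j = i + 2 * k" using assms by (metis add.commute add_diff_cancel_left' dvdE even_diff diff_add_cancel)
  have "H0 (ph (trn A B i j) y) (pl (trn A B i j) p) - H0 y p
    - (A / (2 * B) * of_int i / 2 + of_int i * (snd y + of_int j * B) / (2 * B) - of_int (i * (i + 1)) / 4 - of_int i / 2)
    = of_int (fst p * k)"
    using B0 unfolding H0_def trn_def k by (simp add: field_simps)
  then show ?thesis by simp
qed

lemma H0_mir: "H0 (ph mir y) (pl mir p) + H0 y p + snd y / (2 * B) - 1 / 2 \<in> \<int>"
proof -
  obtain a where a: "snd p * (snd p + 1) = 2 * a" using even_succ[of "snd p"] by (metis dvdE)
  obtain b where b: "fst p * (fst p + 1) = 2 * b" using even_succ[of "fst p"] by (metis dvdE)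
  have m: "(- 1 - fst p) * (- 1 - fst p + 1) = 2 * b" using b by (simp add: algebra_simps)
  have "H0 (ph mir y) (pl mir p) + H0 y p + snd y / (2 * B) - 1 / 2 = of_int (- a - b - snd p)"
    using B0 unfolding H0_def mir_def mot.sel fst_conv snd_conv a b m by (simp add: field_simps)
  then show ?thesis by simp
qed

lemma H0_swp: "H0 (ph swp y) (pl swp p) - H0 y p - (snd y - fst y) / (2 * B) \<in> \<int>"
proof -
  have "H0 (ph swp y) (pl swp p) - H0 y p - (snd y - fst y) / (2 * B) = of_int (1 + fst p + snd p)"
    using B0 unfolding H0_def swp_def by (simp add: field_simps)
  then show ?thesis by simp
qed

lemma ep_W: "w \<in> W \<Longrightarrow> ep w = 1 \<or> ep w = - 1"
proof -
  assume "w \<in> W"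
  then obtain b s1 s2 i j p q where w: "w = mk b s1 s2 i j p q" using W_form by blast
  show ?thesis unfolding w mk_def mot.sel sg_def by simp
qed

text \<open>Hence only the increments of \<open>H0\<close> modulo integers, up to the sign
  \<open>ep\<close>, have a meaning independent of the viewpoint.\<close>

lemma H0_cov: "w \<in> W \<Longrightarrow> \<exists>c. \<forall>p. H0 (ph w y) (pl w p) - ep w * H0 y p - c \<in> \<int>"
proof (induction arbitrary: y rule: W.induct)
  case W_one
  then show ?case by (auto intro: exI[of _ 0])
next
  case (W_trn w i j)
  obtain c where c: "\<And>p. H0 (ph w y) (pl w p) - ep w * H0 y p - c \<in> \<int>" using W_trn by blast
  show ?case
  proof (intro exI allI)
    fix p
    show "H0 (ph (mot_mul (trn A B i j) w) y) (pl (mot_mul (trn A B i j) w) p) - ep (mot_mul (trn A B i j) w) * H0 y p -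
      (c + (A / (2 * B) * of_int i / 2 + of_int i * (snd (ph w y) + of_int j * B) / (2 * B) - of_int (i * (i + 1)) / 4 - of_int i / 2)) \<in> \<int>"
      using Ints_add[OF c[of p] H0_trn[OF W_trn(2), of "ph w y" "pl w p"]] by (simp add: trn_def algebra_simps)
  qed
next
  case (W_mir w)
  obtain c where c: "\<And>p. H0 (ph w y) (pl w p) - ep w * H0 y p - c \<in> \<int>" using W_mir by blast
  show ?case
  proof (intro exI allI)
    fix p
    show "H0 (ph (mot_mul mir w) y) (pl (mot_mul mir w) p) - ep (mot_mul mir w) * H0 y p -
      (- c - snd (ph w y) / (2 * B) + 1 / 2) \<in> \<int>"
      using Ints_diff[OF H0_mir[of "ph w y" "pl w p"] c[of p]] by (simp add: mir_def algebra_simps)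
  qed
next
  case (W_swp w)
  obtain c where c: "\<And>p. H0 (ph w y) (pl w p) - ep w * H0 y p - c \<in> \<int>" using W_swp by blast
  show ?case
  proof (intro exI allI)
    fix p
    show "H0 (ph (mot_mul swp w) y) (pl (mot_mul swp w) p) - ep (mot_mul swp w) * H0 y p -
      (c + (snd (ph w y) - fst (ph w y)) / (2 * B)) \<in> \<int>"
      using Ints_add[OF c[of p] H0_swp[of "ph w y" "pl w p"]] by (simp add: swp_def algebra_simps)
  qed
qed

end

section \<open>Equivariant integral cocycles\<close>

lemma frac_cong: "x - y \<in> \<int> \<Longrightarrow> frac x = frac y"
proof -
  assume "x - y \<in> \<int>"
  then obtain k where "x - y = of_int k" by (auto elim: Ints_cases)
  then have "x = y + of_int k" by simp
  then show ?thesis by (simp add: frac_def)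
qed

lemma frac_diff_Ints: "frac x - x \<in> \<int>"
  by (simp add: frac_def)

definition LC :: "(conf \<Rightarrow> 'b) \<Rightarrow> conf set" where
  "LC g = {y. \<exists>e>0. \<forall>y'. dist y' y < e \<longrightarrow> g y' = g y}"

lemma open_LC: "open (LC g)"
  unfolding open_dist
proof
  fix y assume "y \<in> LC g"
  then obtain e where e: "e > 0" "\<And>y'. dist y' y < e \<Longrightarrow> g y' = g y" unfolding LC_def by blast
  show "\<exists>e>0. \<forall>z. dist z y < e \<longrightarrow> z \<in> LC g"
  proof (intro exI conjI allI impI)
    show "e / 2 > 0" using e by simp
    fix z assume z: "dist z y < e / 2"
    have "g z' = g z" if "dist z' z < e / 2" for z'
      using e(2)[of z'] e(2)[of z] z that dist_triangle[of z' y z] e(1) by simp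
    then show "z \<in> LC g" unfolding LC_def using e(1) half_gt_zero by blast
  qed
qed

definition affine_fun :: "(conf \<Rightarrow> real) \<Rightarrow> bool" where
  "affine_fun f \<longleftrightarrow> (\<exists>a b c. \<forall>y. f y = a * fst y + b * snd y + c)"

lemma affine_fun_cont: "affine_fun f \<Longrightarrow> continuous_on UNIV f"
proof -
  assume "affine_fun f"
  then obtain a b c where "f = (\<lambda>y. a * fst y + b * snd y + c)" unfolding affine_fun_def by blast
  then show ?thesis by (auto intro!: continuous_intros)
qed

lemma affine_fun_add: "affine_fun f \<Longrightarrow> affine_fun g \<Longrightarrow> affine_fun (\<lambda>y. f y + g y)"
proof -
  assume "affine_fun f" "affine_fun g"
  then obtain a b c a' b' c' where "\<And>y. f y = a * fst y + b * snd y + c" "\<And>y. g y = a' * fst y + b' * snd y + c'"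
    unfolding affine_fun_def by blast
  then have "\<forall>y. f y + g y = (a + a') * fst y + (b + b') * snd y + (c + c')" by (simp add: algebra_simps)
  then show ?thesis unfolding affine_fun_def by blast
qed

lemma affine_fun_cmul: "affine_fun f \<Longrightarrow> affine_fun (\<lambda>y. k * f y)"
proof -
  assume "affine_fun f"
  then obtain a b c where "\<And>y. f y = a * fst y + b * snd y + c" unfolding affine_fun_def by blast
  then have "\<forall>y. k * f y = (k * a) * fst y + (k * b) * snd y + k * c" by (simp add: algebra_simps)
  then show ?thesis unfolding affine_fun_def by blast
qed

lemma floor_LC:
  fixes f :: "conf \<Rightarrow> real"
  assumes c: "continuous_on UNIV f" and n: "f y \<notin> \<int>"
  shows "y \<in> LC (\<lambda>y. \<lfloor>f y\<rfloor>)"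
proof -
  define d where "d = min (frac (f y)) (1 - frac (f y))"
  have d: "d > 0" using n frac_lt_1[of "f y"] unfolding d_def by (simp add: frac_gt_0_iff)
  have "\<exists>e>0. \<forall>y'. dist y' y < e \<longrightarrow> dist (f y') (f y) < d"
    using c d unfolding continuous_on_iff by blast
  then obtain e where e: "e > 0" "\<And>y'. dist y' y < e \<Longrightarrow> dist (f y') (f y) < d" by blast
  have "\<lfloor>f y'\<rfloor> = \<lfloor>f y\<rfloor>" if "dist y' y < e" for y'
  proof -
    have "\<bar>f y' - f y\<bar> < d" using e(2)[OF that] by (simp add: dist_real_def)
    then show ?thesis unfolding d_def frac_def by linarith
  qed
  then show ?thesis unfolding LC_def using e(1) by blast
qed

lemma affine_Ints_negligible:
  assumes "affine_fun f" "\<not> (\<exists>c. \<forall>y. f y = c)"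
  shows "negligible {y. f y \<in> \<int>}"
proof -
  obtain a b c where f: "\<And>y. f y = a * fst y + b * snd y + c" using assms(1) unfolding affine_fun_def by blast
  have ab: "(a, b) \<noteq> 0" using assms(2) f by (auto simp: zero_prod_def)
  have "{y. f y \<in> \<int>} \<subseteq> (\<Union>k::int. {y. (a, b) \<bullet> y = of_int k - c})"
  proof
    fix y assume "y \<in> {y. f y \<in> \<int>}"
    then obtain k where "f y = of_int k" by (auto elim: Ints_cases)
    then have "y \<in> {y. (a, b) \<bullet> y = of_int k - c}" using f[of y] by (simp add: inner_prod_def)
    then show "y \<in> (\<Union>k::int. {y. (a, b) \<bullet> y = of_int k - c})" by blast
  qed
  moreover have "negligible (\<Union>k::int. {y. (a, b) \<bullet> y = of_int k - c})"
    using negligible_hyperplane[of "(a, b)"] ab by (intro negligible_countable_Union) auto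
  ultimately show ?thesis using negligible_subset by blast
qed

lemma affine_Ints_nowhere:
  assumes "affine_fun f" "\<not> (\<exists>c. \<forall>y. f y = c)"
  shows "closed {y. f y \<in> \<int>}" "interior {y. f y \<in> \<int>} = {}"
proof -
  have "{y. f y \<in> \<int>} = f -` \<int>" by auto
  then show "closed {y. f y \<in> \<int>}"
    using closed_vimage[OF closed_Ints affine_fun_cont[OF assms(1)]] by (simp only:)
  show "interior {y. f y \<in> \<int>} = {}" by (rule negligible_interior_empty[OF affine_Ints_negligible[OF assms]])
qed

lemma floor_affine_LC:
  assumes "affine_fun f"
  shows "interior (- LC (\<lambda>y. \<lfloor>f y\<rfloor>)) = {}"
proof (cases "\<exists>c. \<forall>y. f y = c")
  case True
  then have "LC (\<lambda>y. \<lfloor>f y\<rfloor>) = UNIV" unfolding LC_def by (auto intro: exI[of _ 1])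
  then show ?thesis by simp
next
  case False
  have "- LC (\<lambda>y. \<lfloor>f y\<rfloor>) \<subseteq> {y. f y \<in> \<int>}" using floor_LC[OF affine_fun_cont[OF assms]] by blast
  then show ?thesis using affine_Ints_nowhere(2)[OF assms False] interior_mono by blast
qed

context irrational_ratio
begin

abbreviation orig :: place where "orig \<equiv> (0, 0)"

lemma H0_affine: assumes "w \<in> W" shows "affine_fun (\<lambda>y. H0 (ph w y) (pl w p))"
proof -
  obtain b s1 s2 i j p' q where w: "w = mk b s1 s2 i j p' q" using W_form[OF assms] by blast
  define x where "x = pl w p"
  define cA where "cA = - of_int (snd x) / (2 * B)"
  define cB where "cB = of_int (fst x) / (2 * B)"
  obtain C where H: "\<And>z. H0 z x = cA * fst z + cB * snd z + C"
  proof
    show "H0 z x = cA * fst z + cB * snd z + (A / (2 * B) * (of_int (fst x) + 1/2) * (of_int (snd x) + 1/2)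
     - of_int (snd x * (snd x + 1)) / 4 - of_int (fst x * (fst x + 1)) / 4 - of_int (fst x + snd x) / 2)" for z
      unfolding H0_def cA_def cB_def by simp
  qed
  define t1 where "t1 = of_int i * A + of_int p' * B"
  define t2 where "t2 = of_int q * A + of_int j * B"
  have p: "ph w y = (sg s1 * (if b then snd y else fst y) + t1, sg s2 * (if b then fst y else snd y) + t2)" for y
    unfolding w mk_def t1_def t2_def by simp
  show ?thesis
  proof (cases b)
    case True
    then have "\<forall>y. H0 (ph w y) (pl w p) = (cB * sg s2) * fst y + (cA * sg s1) * snd y + (cA * t1 + cB * t2 + C)"
      unfolding x_def[symmetric] H p by (simp add: algebra_simps)
    then show ?thesis unfolding affine_fun_def by blast
  next
    case False
    then have "\<forall>y. H0 (ph w y) (pl w p) = (cA * sg s1) * fst y + (cB * sg s2) * snd y + (cA * t1 + cB * t2 + C)"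
      unfolding x_def[symmetric] H p by (simp add: algebra_simps)
    then show ?thesis unfolding affine_fun_def by blast
  qed
qed

lemma ep_sq: "w \<in> W \<Longrightarrow> ep w * ep w = 1" and ep_Ints: "w \<in> W \<Longrightarrow> ep w \<in> \<int>"
  using ep_W by fastforce+

text \<open>Seen from a motion \<open>w\<close>, the function \<open>U y w\<close> is a bounded representative of \<open>- H0 y\<close> modulo integers and a
  constant; \<open>kap y w w'\<close> is a bounded choice of the constant between two motions.\<close>
definition U :: "conf \<Rightarrow> mot \<Rightarrow> place \<Rightarrow> real" where
  "U y w p = - ep w * frac (H0 (ph w y) (pl w p))"

definition kap :: "conf \<Rightarrow> mot \<Rightarrow> mot \<Rightarrow> real" where
  "kap y w w' = ep w' * frac (ep w' * ep w * H0 (ph w y) (pl w orig) - H0 (ph w' y) (pl w' orig))"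

lemma U_class: assumes "w \<in> W"
  shows "(U y w p + H0 y p) - (U y w q + H0 y q) \<in> \<int>"
proof -
  obtain c where c: "\<And>p. H0 (ph w y) (pl w p) - ep w * H0 y p - c \<in> \<int>" using H0_cov[OF assms] by blast
  have a: "U y w p + H0 y p + ep w * c \<in> \<int>" for p
  proof -
    have "U y w p + H0 y p + ep w * c = - ep w * (frac (H0 (ph w y) (pl w p)) - H0 (ph w y) (pl w p))
       - ep w * (H0 (ph w y) (pl w p) - ep w * H0 y p - c) + (1 - ep w * ep w) * H0 y p"
      unfolding U_def by (simp add: algebra_simps)
    also have "\<dots> \<in> \<int>" unfolding ep_sq[OF assms]
      by (rule Ints_add[OF Ints_diff[OF Ints_mult[OF Ints_minus[OF ep_Ints[OF assms]] frac_diff_Ints]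
        Ints_mult[OF ep_Ints[OF assms] c]]]) simp
    finally show ?thesis .
  qed
  show ?thesis using Ints_diff[OF a[of p] a[of q]] by simp
qed

lemma kap_class: assumes "w \<in> W" "w' \<in> W"
  shows "kap y w w' - (U y w' orig - U y w orig) \<in> \<int>"
proof -
  let ?Z = "H0 (ph w y) (pl w orig)" and ?Z' = "H0 (ph w' y) (pl w' orig)"
  have "kap y w w' - (U y w' orig - U y w orig) = ep w' * (frac (ep w' * ep w * ?Z - ?Z') - (ep w' * ep w * ?Z - ?Z'))
     + ep w' * (frac ?Z' - ?Z') - ep w * (frac ?Z - ?Z) + (ep w' * ep w' - 1) * ep w * ?Z"
    unfolding kap_def U_def by (simp add: algebra_simps)
  also have "\<dots> \<in> \<int>" unfolding ep_sq[OF assms(2)]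
    by (rule Ints_add[OF Ints_diff[OF Ints_add[OF Ints_mult[OF ep_Ints[OF assms(2)] frac_diff_Ints]
        Ints_mult[OF ep_Ints[OF assms(2)] frac_diff_Ints]] Ints_mult[OF ep_Ints[OF assms(1)] frac_diff_Ints]]]) simp
  finally show ?thesis .
qed

lemma kap_self: "w \<in> W \<Longrightarrow> kap y w w = 0"
  unfolding kap_def using ep_sq[of w] by (simp add: mult.assoc)

lemma U_bound: "w \<in> W \<Longrightarrow> \<bar>U y w p\<bar> < 1" and kap_bound: "w' \<in> W \<Longrightarrow> \<bar>kap y w w'\<bar> < 1"
  unfolding U_def kap_def using ep_W[of w] ep_W[of w'] frac_lt_1 frac_ge_0 by (auto simp: abs_mult)

lemma U_cov: "v \<in> W \<Longrightarrow> U (ph v y) w (pl v p) = ep v * U y (mot_mul w v) p"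
  unfolding U_def using ep_sq[of v] by (simp add: algebra_simps)

text \<open>The reference place \<open>orig\<close> is not fixed by \<open>v\<close>. Modulo
  integers, however, two viewpoints differ by a constant, so the comparison does not depend on the
  place where it is made, and \<open>frac\<close> sees only the class.\<close>

lemma kap_cov: assumes "v \<in> W" "w \<in> W" "w' \<in> W"
  shows "kap (ph v y) w w' = ep v * kap y (mot_mul w v) (mot_mul w' v)"
proof -
  let ?x = "ph v y" and ?o = "pl (winv v) orig"
  have o: "pl v ?o = orig" using winv_ph[OF assms(1)] by simp
  have wv: "mot_mul w v \<in> W" "mot_mul w' v \<in> W" using assms mul_W by auto
  have vv: "ep v * ep v = 1" using ep_sq assms(1) by blast
  let ?a = "ep w' * ep w * H0 (ph w ?x) (pl w orig) - H0 (ph w' ?x) (pl w' orig)"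
  let ?b = "ep (mot_mul w' v) * ep (mot_mul w v) * H0 (ph (mot_mul w v) y) (pl (mot_mul w v) orig) - H0 (ph (mot_mul w' v) y) (pl (mot_mul w' v) orig)"
  obtain c where c: "\<And>p. H0 (ph (mot_mul w v) y) (pl (mot_mul w v) p) - ep (mot_mul w v) * H0 y p - c \<in> \<int>" using H0_cov[OF wv(1)] by blast
  obtain c' where c': "\<And>p. H0 (ph (mot_mul w' v) y) (pl (mot_mul w' v) p) - ep (mot_mul w' v) * H0 y p - c' \<in> \<int>" using H0_cov[OF wv(2)] by blast
  have e: "ep (mot_mul w' v) * ep (mot_mul w v) = ep w' * ep w" using vv by (simp add: algebra_simps)
  have z: "ep w' * ep w * ep (mot_mul w v) = ep (mot_mul w' v)" using ep_sq[OF assms(2)] by (simp add: algebra_simps)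
  have "?a - ?b = ep w' * ep w * ((H0 (ph (mot_mul w v) y) (pl (mot_mul w v) ?o) - ep (mot_mul w v) * H0 y ?o - c) - (H0 (ph (mot_mul w v) y) (pl (mot_mul w v) orig) - ep (mot_mul w v) * H0 y orig - c))
      - ((H0 (ph (mot_mul w' v) y) (pl (mot_mul w' v) ?o) - ep (mot_mul w' v) * H0 y ?o - c') - (H0 (ph (mot_mul w' v) y) (pl (mot_mul w' v) orig) - ep (mot_mul w' v) * H0 y orig - c'))
      + (ep w' * ep w * ep (mot_mul w v) - ep (mot_mul w' v)) * (H0 y ?o - H0 y orig)"
    unfolding e using o by (simp add: algebra_simps)
  also have "\<dots> \<in> \<int>" unfolding z
    by (rule Ints_add[OF Ints_diff[OF Ints_mult[OF Ints_mult[OF ep_Ints[OF assms(3)] ep_Ints[OF assms(2)]]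
        Ints_diff[OF c c]] Ints_diff[OF c' c']]]) simp
  finally have "frac ?a = frac ?b" by (rule frac_cong)
  then show ?thesis unfolding kap_def using vv by (simp add: mult.assoc[symmetric])
qed

end

section \<open>Gluing the viewpoints along the hierarchy of tiles\<close>

locale toast = irrational_ratio +
  fixes R :: int and T :: "nat \<Rightarrow> tile"
  assumes R0: "0 \<le> R"
    and fin_T: "\<And>k. finite (cells (T k))"
    and sep_T: "\<And>y k k' w w'. k \<le> k' \<Longrightarrow> w \<in> W \<Longrightarrow> w' \<in> W \<Longrightarrow> cp (T k) w y \<Longrightarrow> cp (T k') w' y \<Longrightarrow> (k, w) \<noteq> (k', w') \<Longrightarrow>
      (k < k' \<and> nbd R (St (T k) w) \<subseteq> St (T k') w') \<or> nbd R (St (T k) w) \<inter> St (T k') w' = {}"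
    and dense_T: "\<And>U. open U \<Longrightarrow> U \<noteq> {} \<Longrightarrow> \<exists>y\<in>U. \<exists>k w. copyof T y (0, 0) k w"
begin

abbreviation cov :: "conf \<Rightarrow> bool" where "cov y \<equiv> \<forall>p. \<exists>k w. copyof T y p k w"

text \<open>Least index means smallest copy: by separation, the copies that contain a given place
  grow with their index.\<close>

definition lev :: "conf \<Rightarrow> place \<Rightarrow> nat" where "lev y p = (LEAST k. \<exists>w. copyof T y p k w)"
definition mc :: "conf \<Rightarrow> place \<Rightarrow> mot" where "mc y p = (SOME w. copyof T y p (lev y p) w)"

lemma copy_unique: assumes "copyof T y p k w" "copyof T y p k w'" shows "w = w'"
proof (rule ccontr)
  assume "w \<noteq> w'"
  then have "nbd R (St (T k) w) \<inter> St (T k) w' = {}"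
    using sep_T[of k k w w' y] assms unfolding copyof_def by auto
  moreover have "p \<in> nbd R (St (T k) w)" using assms(1) nbd_self[OF R0] unfolding copyof_def by blast
  ultimately show False using assms(2) unfolding copyof_def by blast
qed

lemma lev_le: "copyof T y p k w \<Longrightarrow> lev y p \<le> k"
  unfolding lev_def by (rule Least_le) blast

lemma mc: assumes "cov y" shows "copyof T y p (lev y p) (mc y p)"
proof -
  have "\<exists>w. copyof T y p (lev y p) w" unfolding lev_def by (rule LeastI_ex) (use assms in blast)
  then show ?thesis unfolding mc_def by (rule someI_ex)
qed

lemma mc_W: "cov y \<Longrightarrow> mc y p \<in> W" using mc unfolding copyof_def by blast

lemma mc_eqI: "cov y \<Longrightarrow> copyof T y p (lev y p) w \<Longrightarrow> mc y p = w"
  using copy_unique mc by blast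

lemma near_nbd: "cheb p p' \<le> R \<Longrightarrow> p \<in> S \<Longrightarrow> p' \<in> nbd R S"
  unfolding nbd_def using cheb_commute by auto

lemma same_lev: assumes "cov y" "cheb p p' \<le> R" "lev y p = lev y p'" shows "mc y p = mc y p'"
proof (rule ccontr)
  assume n: "mc y p \<noteq> mc y p'"
  note a = mc[OF assms(1), of p] mc[OF assms(1), of p']
  have "nbd R (St (T (lev y p)) (mc y p)) \<inter> St (T (lev y p)) (mc y p') = {}"
    using sep_T[of "lev y p" "lev y p" "mc y p" "mc y p'" y] a n assms(3) unfolding copyof_def by auto
  moreover have "p' \<in> nbd R (St (T (lev y p)) (mc y p))"
    using near_nbd[OF assms(2)] a(1) unfolding copyof_def by blast
  ultimately show False using a(2) assms(3) unfolding copyof_def by auto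
qed

lemma less_lev: assumes "cov y" "cheb p p' \<le> R" "lev y p < lev y p'"
  shows "nbd R (St (T (lev y p)) (mc y p)) \<subseteq> St (T (lev y p')) (mc y p')"
proof -
  note a = mc[OF assms(1), of p] mc[OF assms(1), of p']
  have "p' \<in> nbd R (St (T (lev y p)) (mc y p))"
    using near_nbd[OF assms(2)] a(1) unfolding copyof_def by blast
  then show ?thesis
    using sep_T[of "lev y p" "lev y p'" "mc y p" "mc y p'" y] a assms(3) unfolding copyof_def by auto
qed

text \<open>The copy chosen for \<open>p'\<close> swallows the whole \<open>R\<close>-neighbourhood
  of the smaller copy chosen for \<open>p\<close>, hence it contains \<open>p''\<close>, so the
  level of \<open>p''\<close> is not larger. The situation is symmetric in \<open>p'\<close> and
  \<open>p''\<close>.\<close>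

lemma two_levels:
  assumes "cov y" "cheb p p' \<le> R" "cheb p p'' \<le> R" "cheb p' p'' \<le> R" "lev y p < lev y p'" "lev y p < lev y p''"
  shows "lev y p' = lev y p''"
proof -
  have *: "lev y b \<le> lev y a" if "cheb p a \<le> R" "cheb p b \<le> R" "lev y p < lev y a" for a b
  proof -
    have "b \<in> nbd R (St (T (lev y p)) (mc y p))"
      using near_nbd[OF that(2)] mc[OF assms(1), of p] unfolding copyof_def by blast
    then have "b \<in> St (T (lev y a)) (mc y a)" using less_lev[OF assms(1) that(1,3)] by blast
    then have "copyof T y b (lev y a) (mc y a)" using mc[OF assms(1), of a] unfolding copyof_def by blast
    then show ?thesis by (rule lev_le)
  qed
  show ?thesis using *[OF assms(2,3,5)] *[OF assms(3,2,6)] by simp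
qed

text \<open>The increments between neighbouring places, read off the smallest tile copies containing them. Nearby places lie
  in at most two copies, a child and its parent, which makes \<open>d\<close> additive.\<close>
definition d :: "conf \<Rightarrow> place \<Rightarrow> place \<Rightarrow> real" where
  "d y p p' = (if lev y p \<le> lev y p' then U y (mc y p') p' - U y (mc y p) p - kap y (mc y p) (mc y p')
     else U y (mc y p') p' + kap y (mc y p') (mc y p) - U y (mc y p) p)"

lemma d_int: assumes "cov y" shows "d y p p' + (H0 y p' - H0 y p) \<in> \<int>"
proof -
  note w = mc_W[OF assms, of p] and w' = mc_W[OF assms, of p']
  have k: "kap y (mc y p) (mc y p') - (U y (mc y p') q - U y (mc y p) q) \<in> \<int>" if "mc y p \<in> W" "mc y p' \<in> W" for p p' q
    using Ints_add[OF kap_class[OF that, of y] Ints_diff[OF U_class[OF that(2), of y orig q] U_class[OF that(1), of y orig q]]]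
    by (simp add: algebra_simps)
  show ?thesis
  proof (cases "lev y p \<le> lev y p'")
    case True
    have "d y p p' + (H0 y p' - H0 y p) = (U y (mc y p') p' + H0 y p') - (U y (mc y p') p + H0 y p)
        - (kap y (mc y p) (mc y p') - (U y (mc y p') p - U y (mc y p) p))"
      using True by (simp add: d_def)
    then show ?thesis using Ints_diff[OF U_class[OF w', of y p' p] k[OF w w', of p]] by metis
  next
    case False
    have "d y p p' + (H0 y p' - H0 y p) = (U y (mc y p') p' + H0 y p') - (U y (mc y p') p + H0 y p)
        + (kap y (mc y p') (mc y p) - (U y (mc y p) p - U y (mc y p') p))"
      using False by (simp add: d_def)
    then show ?thesis using Ints_add[OF U_class[OF w', of y p' p] k[OF w' w, of p]] by metis
  qed
qed

lemma d_bound: assumes "cov y" shows "\<bar>d y p p'\<bar> < 3"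
  using U_bound[OF mc_W[OF assms, of p], of y p] U_bound[OF mc_W[OF assms, of p'], of y p']
    kap_bound[OF mc_W[OF assms, of p'], of y "mc y p"] kap_bound[OF mc_W[OF assms, of p], of y "mc y p'"]
  unfolding d_def by auto

lemma d_add:
  assumes "cov y" "cheb p p' \<le> R" "cheb p p'' \<le> R" "cheb p' p'' \<le> R"
  shows "d y p p' + d y p' p'' = d y p p''"
proof -
  have ks: "kap y (mc y x) (mc y x) = 0" for x using kap_self mc_W[OF assms(1)] by blast
  have c': "cheb p' p \<le> R" "cheb p'' p \<le> R" "cheb p'' p' \<le> R" using assms(2-4) by (simp_all add: cheb_commute)
  note e = same_lev[OF assms(1,2)] same_lev[OF assms(1,3)] same_lev[OF assms(1,4)]
  note t = two_levels[OF assms(1-4)] two_levels[OF assms(1) c'(1) assms(4,3)]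
     two_levels[OF assms(1) c'(2,3) assms(2)]
  \<comment> \<open>Three levels in which a strict minimum forces the other two to agree take at
    most two values, which leaves seven patterns.\<close>
  have tri: "(a = b \<and> b = c) \<or> (a < b \<and> b = c) \<or> (b < a \<and> a = c) \<or> (c < a \<and> a = b) \<or> (a = b \<and> a < c) \<or>
      (a = c \<and> a < b) \<or> (b = c \<and> b < a)"
    if "a < b \<Longrightarrow> a < c \<Longrightarrow> b = c" "b < a \<Longrightarrow> b < c \<Longrightarrow> a = c" "c < a \<Longrightarrow> c < b \<Longrightarrow> a = b" for a b c :: nat
    using that by (cases a b rule: linorder_cases; cases b c rule: linorder_cases; cases a c rule: linorder_cases) auto
  consider "lev y p = lev y p'" "lev y p' = lev y p''" | "lev y p < lev y p'" "lev y p' = lev y p''"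
    | "lev y p' < lev y p" "lev y p = lev y p''" | "lev y p'' < lev y p" "lev y p = lev y p'"
    | "lev y p = lev y p'" "lev y p < lev y p''" | "lev y p = lev y p''" "lev y p < lev y p'"
    | "lev y p' = lev y p''" "lev y p' < lev y p"
    using tri[OF t] by blast
  then show ?thesis
  proof cases
    case 1 then show ?thesis using e ks by (simp add: d_def)
  next
    case 2 then show ?thesis using e ks[of p'] by (simp add: d_def)
  next
    case 3 then show ?thesis using e ks[of p] by (simp add: d_def)
  next
    case 4 then show ?thesis using e ks[of p] by (simp add: d_def)
  next
    case 5 then show ?thesis using e ks[of p] by (simp add: d_def)
  next
    case 6 then show ?thesis using e ks[of p] by (simp add: d_def)
  next
    case 7 then show ?thesis using e ks[of p'] by (simp add: d_def)
  qed
qed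

lemma copyof_cov: assumes v: "v \<in> W"
  shows "copyof T (ph v y) (pl v p) k w \<longleftrightarrow> w \<in> W \<and> copyof T y p k (mot_mul w v)"
  unfolding copyof_def cp_mul St_mul using mul_W[OF _ v] by auto

lemma copyof_cov': assumes v: "v \<in> W"
  shows "(\<exists>w. copyof T (ph v y) (pl v p) k w) \<longleftrightarrow> (\<exists>w. copyof T y p k w)"
proof
  assume "\<exists>w. copyof T (ph v y) (pl v p) k w"
  then show "\<exists>w. copyof T y p k w" using copyof_cov[OF v] by blast
next
  assume "\<exists>w. copyof T y p k w"
  then obtain w where w: "copyof T y p k w" by blast
  have "w = mot_mul (mot_mul w (winv v)) v" using winv[OF v] by (simp add: mul_assoc)
  moreover have "mot_mul w (winv v) \<in> W" using w winv[OF v] mul_W unfolding copyof_def by blast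
  ultimately show "\<exists>w. copyof T (ph v y) (pl v p) k w" using copyof_cov[OF v] w by metis
qed

lemma cov_cov: assumes "v \<in> W" "cov y" shows "cov (ph v y)"
proof
  fix p
  obtain k w where "copyof T y (pl (winv v) p) k w" using assms(2) by blast
  then have "\<exists>w. copyof T (ph v y) (pl v (pl (winv v) p)) k w" using copyof_cov'[OF assms(1)] by blast
  then show "\<exists>k w. copyof T (ph v y) p k w" using winv_ph[OF assms(1)] by auto
qed

lemma lev_cov: "v \<in> W \<Longrightarrow> lev (ph v y) (pl v p) = lev y p"
  unfolding lev_def using copyof_cov' by simp

lemma mc_cov: assumes "v \<in> W" "cov y" shows "mot_mul (mc (ph v y) (pl v p)) v = mc y p"
proof -
  have "copyof T (ph v y) (pl v p) (lev (ph v y) (pl v p)) (mc (ph v y) (pl v p))"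
    by (rule mc[OF cov_cov[OF assms]])
  then have "copyof T y p (lev y p) (mot_mul (mc (ph v y) (pl v p)) v)"
    unfolding lev_cov[OF assms(1)] copyof_cov[OF assms(1)] by blast
  then show ?thesis using mc_eqI[OF assms(2)] by simp
qed

lemma d_cov: assumes v: "v \<in> W" and y: "cov y"
  shows "d (ph v y) (pl v p) (pl v p') = ep v * d y p p'"
proof -
  have w: "mc (ph v y) (pl v q) \<in> W" for q using mc_W[OF cov_cov[OF v y]] .
  have u: "U (ph v y) (mc (ph v y) (pl v q)) (pl v q) = ep v * U y (mc y q) q" for q
    using U_cov[OF v] mc_cov[OF v y] by simp
  have k: "kap (ph v y) (mc (ph v y) (pl v q)) (mc (ph v y) (pl v q')) = ep v * kap y (mc y q) (mc y q')" for q q'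
    using kap_cov[OF v w w] mc_cov[OF v y] by simp
  show ?thesis unfolding d_def lev_cov[OF v] u k by (simp add: algebra_simps)
qed

end

section \<open>Generic configurations\<close>

lemma LC_eventually: "y \<in> LC g \<Longrightarrow> eventually (\<lambda>z. g z = g y) (nhds y)"
  unfolding LC_def eventually_nhds_metric by blast

lemma floor_LC_eventually:
  "continuous_on UNIV (f :: conf \<Rightarrow> real) \<Longrightarrow> f y \<notin> \<int> \<Longrightarrow> eventually (\<lambda>z. \<lfloor>f z\<rfloor> = \<lfloor>f y\<rfloor>) (nhds y)"
  by (rule LC_eventually[OF floor_LC])

lemma affine_tendsto: "affine_fun f \<Longrightarrow> (f \<longlongrightarrow> f y) (at y within S)"
  using affine_fun_cont continuous_on_subset[of UNIV f] unfolding continuous_on_def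
  by (metis UNIV_I at_within_open open_UNIV tendsto_within_subset subset_UNIV)

lemma frac_tendsto:
  assumes "affine_fun f" "y \<in> LC (\<lambda>z. \<lfloor>f z\<rfloor>)"
  shows "((\<lambda>z. frac (f z)) \<longlongrightarrow> frac (f y)) (at y within S)"
proof -
  have "eventually (\<lambda>z. \<lfloor>f z\<rfloor> = \<lfloor>f y\<rfloor>) (at y within S)"
    using LC_eventually[OF assms(2)] eventually_at_filter eventually_mono by (metis (mono_tags, lifting))
  then have "eventually (\<lambda>z. f z - of_int \<lfloor>f y\<rfloor> = frac (f z)) (at y within S)"
    by (rule eventually_mono) (simp add: frac_def)
  moreover have "((\<lambda>z. f z - of_int \<lfloor>f y\<rfloor>) \<longlongrightarrow> frac (f y)) (at y within S)"
    unfolding frac_def by (intro tendsto_intros affine_tendsto assms)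
  ultimately show ?thesis by (rule Lim_transform_eventually[rotated])
qed

lemma Ints_tendsto_eventually:
  fixes g :: "conf \<Rightarrow> real"
  assumes "(g \<longlongrightarrow> g y) (at y within S)" "g y \<in> \<int>" "\<And>z. z \<in> S \<Longrightarrow> g z \<in> \<int>"
  shows "eventually (\<lambda>z. g z = g y) (at y within S)"
proof -
  have "eventually (\<lambda>z. dist (g z) (g y) < 1) (at y within S)" using tendstoD[OF assms(1), of 1] by simp
  moreover have "eventually (\<lambda>z. z \<in> S) (at y within S)" by (simp add: eventually_at_filter)
  ultimately show ?thesis
  proof eventually_elim
    case (elim z)
    then have "\<bar>g z - g y\<bar> < 1" "g z - g y \<in> \<int>" using assms by (simp_all add: dist_real_def)
    then show ?case using Ints_nonzero_abs_less1 by fastforce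
  qed
qed

text \<open>The offsets of boundaries contain \<open>lin\<close> and \<open>rw\<close> halved and
  are off by less than 3. Selected lines at least \<open>K0\<close> apart are thus at least 7 apart
  in offset, more than twice the error, and keep their order. \<open>R\<close> is both the margin of
  the hierarchy and a bound for the distance to the next selected line or row, so \<open>d\<close>
  is additive inside a cell. Two windows occur because \<open>lin\<close> decreases and
  \<open>rw\<close> increases with the index.\<close>

locale setting = toast +
  fixes e :: real and K0 :: int
  assumes e0: "0 < e" and K0: "14 * B \<le> A * of_int K0" and R1: "1 \<le> R"
    and gapA: "\<And>k l. 0 < k \<Longrightarrow> k < K0 \<Longrightarrow> 2 * e < \<bar>of_int k * (A / B) - of_int l\<bar>"
    and winA: "\<And>t. \<exists>j l. 1 \<le> j \<and> j \<le> R \<and> t + of_int j * (A / B) - e < of_int l \<and> of_int l \<le> t + of_int j * (A / B) + e"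
    and winB: "\<And>t. \<exists>j l. 1 \<le> j \<and> j \<le> R \<and> t - of_int j * (A / B) - e < of_int l \<and> of_int l \<le> t - of_int j * (A / B) + e"
begin

text \<open>Normalised offsets of line boundaries and row boundaries; an integer means an exact coincidence of
  a blue line boundary with red points, or of a red row boundary with blue points.\<close>
definition lin where "lin y i = (fst y - (of_int i + 1 / 2) * A) / B" for y :: conf and i :: int
definition rw where "rw y q = (snd y + (of_int q + 1 / 2) * A) / B" for y :: conf and q :: int

lemma affine_ln: "affine_fun (\<lambda>y. lin y i)" "affine_fun (\<lambda>y. rw y i)"
proof -
  have "\<forall>y. lin y i = (1 / B) * fst y + 0 * snd y + (- (of_int i + 1 / 2) * A / B)"
    "\<forall>y. rw y i = 0 * fst y + (1 / B) * snd y + ((of_int i + 1 / 2) * A / B)"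
    using B0 by (simp_all add: lin_def rw_def field_simps)
  then show "affine_fun (\<lambda>y. lin y i)" "affine_fun (\<lambda>y. rw y i)" unfolding affine_fun_def by blast+
qed

lemma affine_const: "affine_fun (\<lambda>y. c)"
  unfolding affine_fun_def by (rule exI[of _ 0], rule exI[of _ 0]) auto

definition Fam :: "(conf \<Rightarrow> real) set" where
  "Fam = (\<Union>i. {\<lambda>y. lin y i + e, \<lambda>y. lin y i + - e, \<lambda>y. rw y i + e, \<lambda>y. rw y i + - e})
     \<union> (\<Union>i. \<Union>j. {\<lambda>y. lin y i + lin y j, \<lambda>y. rw y i + rw y j})"

lemma countable_Fam: "countable Fam"
  unfolding Fam_def by (intro countable_Un countable_UN) auto

lemma Fam: assumes "f \<in> Fam" shows "affine_fun f" "\<not> (\<exists>c. \<forall>y. f y = c)"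
proof -
  show "affine_fun f" using assms unfolding Fam_def by (auto simp del: add_uminus_conv_diff intro: affine_fun_add affine_const affine_ln)
  have l: "lin (B, B) i = lin (0, 0) i + 1" "rw (B, B) i = rw (0, 0) i + 1" for i
    using B0 by (simp_all add: lin_def rw_def diff_divide_distrib add_divide_distrib)
  have "f (B, B) \<noteq> f (0, 0)" using assms unfolding Fam_def by (auto simp: l)
  then show "\<not> (\<exists>c. \<forall>y. f y = c)" by metis
qed

abbreviation karg where "karg w w' y \<equiv> ep w' * ep w * H0 (ph w y) (pl w orig) - H0 (ph w' y) (pl w' orig)"

text \<open>Complements of \<open>LC\<close> rather than sets of integrality are removed for
  \<open>H0\<close> and \<open>karg\<close>, as such functions can be constant: \<open>H0\<close> at
  the place \<open>orig\<close> does not depend on the configuration. The functions in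
  \<open>Fam\<close> are never constant, and their values have to be nonintegral for the reflection
  laws of floors.\<close>

definition CC :: "conf set set" where
  "CC = {- {y. \<exists>k w. copyof T y (0, 0) k w}} \<union> range (\<lambda>k. {y. dist y (ctr (T k)) = rad (T k)})
     \<union> (\<Union>w\<in>W. \<Union>p. {- LC (\<lambda>y. \<lfloor>H0 (ph w y) (pl w p)\<rfloor>)})
     \<union> (\<Union>w\<in>W. \<Union>w'\<in>W. {- LC (\<lambda>y. \<lfloor>karg w w' y\<rfloor>)})
     \<union> (\<lambda>f. {y. f y \<in> \<int>}) ` Fam"

definition gen :: "conf \<Rightarrow> bool" where "gen y \<longleftrightarrow> (\<forall>w\<in>W. \<forall>S\<in>CC. ph w y \<notin> S)"

lemma open_cp: "w \<in> W \<Longrightarrow> open {y. cp t w y}"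
  unfolding cp_def by (intro open_Collect_less continuous_intros cont_ph)

lemma karg_affine: "w \<in> W \<Longrightarrow> w' \<in> W \<Longrightarrow> affine_fun (karg w w')"
  using affine_fun_add[OF affine_fun_cmul[OF H0_affine, of w "ep w' * ep w" orig] affine_fun_cmul[OF H0_affine, of w' "- 1" orig]]
  by simp

lemma CC_nowhere: assumes "S \<in> CC" shows "closed S \<and> interior S = {}"
proof -
  consider "S = - {y. \<exists>k w. copyof T y (0, 0) k w}" | k where "S = {y. dist y (ctr (T k)) = rad (T k)}"
    | w p where "w \<in> W" "S = - LC (\<lambda>y. \<lfloor>H0 (ph w y) (pl w p)\<rfloor>)"
    | w w' where "w \<in> W" "w' \<in> W" "S = - LC (\<lambda>y. \<lfloor>karg w w' y\<rfloor>)"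
    | f where "f \<in> Fam" "S = {y. f y \<in> \<int>}"
    using assms unfolding CC_def by blast
  then show ?thesis
  proof cases
    case 1
    have "{y. \<exists>k w. copyof T y (0, 0) k w} = (\<Union>k. \<Union>w\<in>{w\<in>W. (0, 0) \<in> St (T k) w}. {y. cp (T k) w y})" (is "?Z = ?Y")
      unfolding copyof_def by blast
    moreover have "open ?Y" by (intro open_UN ballI open_cp) simp
    ultimately have o: "open ?Z" by simp
    have "interior S = {}"
    proof (rule ccontr)
      assume "interior S \<noteq> {}"
      then obtain y where "y \<in> interior S" "\<exists>k w. copyof T y (0, 0) k w" using dense_T[of "interior S"] by auto
      then show False using interior_subset 1 by blast
    qed
    then show ?thesis using o 1 by (simp add: closed_Compl)
  next
    case (2 k) then show ?thesis using sphere_nowhere[OF one_W, of "ctr (T k)" "rad (T k)"] by simp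
  next
    case (3 w p) then show ?thesis unfolding 3(2) using floor_affine_LC[OF H0_affine[OF 3(1)]] closed_Compl[OF open_LC] by blast
  next
    case (4 w w') then show ?thesis unfolding 4(3) using floor_affine_LC[OF karg_affine[OF 4(1,2)]] closed_Compl[OF open_LC] by blast
  next
    case (5 f) then show ?thesis using affine_Ints_nowhere[OF Fam[OF 5(1)]] by simp
  qed
qed

lemma countable_CC: "countable CC"
  unfolding CC_def
  by (intro countable_Un countable_image countable_UN countable_W countable_Fam) auto

lemma gen_W: assumes "gen y" "w \<in> W" shows "gen (ph w y)"
  unfolding gen_def
proof (intro ballI)
  fix v S assume "v \<in> W" "S \<in> CC"
  then have "ph (mot_mul v w) y \<notin> S" using assms mul_W unfolding gen_def by blast
  then show "ph v (ph w y) \<notin> S" by simp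
qed

lemma gen_dense: assumes "open Z" "Z \<noteq> {}" shows "\<exists>y\<in>Z. gen y"
proof -
  have 1: "countable ((\<lambda>(w, S). ph w -` S) ` (W \<times> CC))" by (intro countable_image countable_SIGMA countable_W countable_CC)
  have 2: "closed Q \<and> interior Q = {}" if Q: "Q \<in> (\<lambda>(w, S). ph w -` S) ` (W \<times> CC)" for Q
  proof -
    obtain w S where w: "w \<in> W" "S \<in> CC" "Q = ph w -` S" using Q by auto
    have "closed Q" unfolding w(3) using CC_nowhere[OF w(2)] cont_ph[OF w(1)] by (intro closed_vimage) auto
    moreover have "interior Q = {}"
    proof -
      let ?V = "ph (winv w) -` interior Q"
      have "open ?V" using cont_ph[OF winv(1)[OF w(1)]] by (intro open_vimage) auto
      moreover have "?V \<subseteq> S"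
      proof
        fix x assume "x \<in> ?V"
        then have "ph (winv w) x \<in> Q" using interior_subset by auto
        then show "x \<in> S" unfolding w(3) using winv_ph[OF w(1)] by simp
      qed
      ultimately have "?V = {}" using CC_nowhere[OF w(2)] interior_maximal by blast
      then show ?thesis using winv_ph(1)[OF w(1)] by (metis empty_iff ex_in_conv vimageI)
    qed
    ultimately show ?thesis by blast
  qed
  obtain y where y: "y \<in> Z" "\<And>Q. Q \<in> (\<lambda>(w, S). ph w -` S) ` (W \<times> CC) \<Longrightarrow> y \<notin> Q"
    using generic_dense[OF assms 1 2] by blast
  have "gen y" unfolding gen_def
  proof (intro ballI)
    fix w S assume "w \<in> W" "S \<in> CC"
    then have "y \<notin> ph w -` S" using y(2) by auto
    then show "ph w y \<notin> S" by simp
  qed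
  then show ?thesis using y(1) by blast
qed

lemma genD: "gen y \<Longrightarrow> w \<in> W \<Longrightarrow> S \<in> CC \<Longrightarrow> ph w y \<notin> S" and genD1: "gen y \<Longrightarrow> S \<in> CC \<Longrightarrow> y \<notin> S"
  unfolding gen_def using one_W by fastforce+

lemma W_transitive: "\<exists>w\<in>W. pl w p = (0, 0)"
proof -
  let ?w = "mot_mul swp (mot_mul (trn A B (snd p) (snd p)) (mot_mul swp (trn A B (- fst p) (- fst p))))"
  have "?w \<in> W" by (intro mul_W swp_W trn_W) auto
  moreover have "pl ?w p = (0, 0)" by (simp add: swp_def trn_def)
  ultimately show ?thesis by blast
qed

lemma gen_cov: assumes "gen y" shows "cov y"
proof
  fix p
  obtain w where w: "w \<in> W" "pl w p = (0, 0)" using W_transitive by blast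
  have "ph w y \<notin> - {y. \<exists>k w. copyof T y (0, 0) k w}" by (rule genD[OF assms w(1)]) (simp add: CC_def)
  then obtain k v where "copyof T (ph w y) (pl w p) k v" using w(2) by auto
  then show "\<exists>k w. copyof T y p k w" using copyof_cov[OF w(1)] by blast
qed

lemma gen_sphere: assumes "gen y" "w \<in> W" shows "dist (ph w y) (ctr (T k)) \<noteq> rad (T k)"
  using genD[OF assms, of "{y. dist y (ctr (T k)) = rad (T k)}"] unfolding CC_def by simp

lemma gen_H0: assumes "gen y" "w \<in> W" shows "y \<in> LC (\<lambda>y. \<lfloor>H0 (ph w y) (pl w p)\<rfloor>)"
proof -
  have "- LC (\<lambda>y. \<lfloor>H0 (ph w y) (pl w p)\<rfloor>) \<in> CC" unfolding CC_def using assms(2) by blast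
  then show ?thesis using genD1[OF assms(1)] by blast
qed

lemma gen_karg: assumes "gen y" "w \<in> W" "w' \<in> W" shows "y \<in> LC (\<lambda>y. \<lfloor>karg w w' y\<rfloor>)"
proof -
  have "- LC (\<lambda>y. \<lfloor>karg w w' y\<rfloor>) \<in> CC" unfolding CC_def using assms(2,3) by blast
  then show ?thesis using genD1[OF assms(1)] by blast
qed

lemma gen_Fam: assumes "gen y" "f \<in> Fam" shows "f y \<notin> \<int>"
proof -
  have "{y. f y \<in> \<int>} \<in> CC" unfolding CC_def using assms(2) by blast
  then show ?thesis using genD1[OF assms(1)] by blast
qed

abbreviation "\<Omega> \<equiv> {y. gen y}"

lemma nhds_within: "eventually P (nhds y) \<Longrightarrow> eventually P (at (y::conf) within S)"
  by (simp add: eventually_at_filter eventually_mono)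

lemma Fam_local: assumes "gen y" "f \<in> Fam" shows "eventually (\<lambda>z. \<lfloor>f z\<rfloor> = \<lfloor>f y\<rfloor>) (at y within \<Omega>)"
  by (rule nhds_within[OF floor_LC_eventually[OF affine_fun_cont[OF Fam(1)[OF assms(2)]] gen_Fam[OF assms]]])

lemma in_\<Omega>: "eventually gen (at y within \<Omega>)"
  by (simp add: eventually_at_filter)

text \<open>Near \<open>y\<close> only finitely many motions can put a copy of \<open>T k\<close>
  over \<open>p\<close>. A generic \<open>y\<close> lies off their boundary spheres, so each of
  these copies, being absent at \<open>y\<close>, is absent in a neighbourhood.\<close>

lemma no_copy_local:
  assumes y: "gen y" and n: "\<not> (\<exists>w. copyof T y p k w)"
  shows "eventually (\<lambda>z. \<not> (\<exists>w. copyof T z p k w)) (nhds y)"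
proof -
  define M where "M = rad (T k) + norm (ctr (T k)) + 1"
  define Q where "Q = {w \<in> W. norm (ph w y) \<le> M \<and> (\<exists>x\<in>{p}. pl w x \<in> cells (T k))}"
  have "finite Q" unfolding Q_def by (rule fin_rel) (use fin_T in auto)
  moreover have "eventually (\<lambda>z. \<not> cp (T k) w z) (nhds y)" if w: "w \<in> Q" for w
  proof -
    have wW: "w \<in> W" "p \<in> St (T k) w" using w unfolding Q_def St_def by auto
    then have "\<not> cp (T k) w y" using n unfolding copyof_def by blast
    then have "rad (T k) < dist (ph w y) (ctr (T k))" using gen_sphere[OF y wW(1), of k] unfolding cp_def by linarith
    moreover have "open {z. rad (T k) < dist (ph w z) (ctr (T k))}"
      by (intro open_Collect_less continuous_intros cont_ph wW)
    ultimately have "eventually (\<lambda>z. rad (T k) < dist (ph w z) (ctr (T k))) (nhds y)"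
      using eventually_nhds by blast
    then show ?thesis by (rule eventually_mono) (simp add: cp_def)
  qed
  ultimately have "eventually (\<lambda>z. \<forall>w\<in>Q. \<not> cp (T k) w z) (nhds y)"
    by (simp add: eventually_ball_finite)
  moreover have "eventually (\<lambda>z. dist z y < 1) (nhds y)" using eventually_nhds_metric zero_less_one by blast
  ultimately show ?thesis
  proof eventually_elim
    case (elim z)
    show ?case
    proof
      assume "\<exists>w. copyof T z p k w"
      then obtain w where w: "w \<in> W" "cp (T k) w z" "p \<in> St (T k) w" unfolding copyof_def by blast
      have "norm (ph w y) \<le> M"
      proof -
        have "dist (ph w y) (ph w z) < 1" using elim(2) iso_ph[OF w(1)] by (simp add: dist_commute)
        moreover have "dist (ph w z) (ctr (T k)) < rad (T k)" using w(2) unfolding cp_def .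
        ultimately have "dist (ph w y) (ctr (T k)) < 1 + rad (T k)" by (metis dist_triangle_less_add dist_commute)
        then show ?thesis using norm_triangle_ineq2[of "ph w y" "ctr (T k)"] unfolding M_def dist_norm by linarith
      qed
      then have "w \<in> Q" using w unfolding Q_def St_def by auto
      then show False using elim(1) w(2) by blast
    qed
  qed
qed

lemma lev_mc_local: assumes y: "gen y"
  shows "eventually (\<lambda>z. lev z p = lev y p \<and> mc z p = mc y p) (at y within \<Omega>)"
proof -
  have c: "copyof T y p (lev y p) (mc y p)" by (rule mc[OF gen_cov[OF y]])
  then have "open {z. cp (T (lev y p)) (mc y p) z}" "cp (T (lev y p)) (mc y p) y" using open_cp unfolding copyof_def by blast+
  then have "eventually (\<lambda>z. cp (T (lev y p)) (mc y p) z) (nhds y)" using eventually_nhds by blast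
  then have 1: "eventually (\<lambda>z. copyof T z p (lev y p) (mc y p)) (nhds y)"
    by (rule eventually_mono) (use c in \<open>simp add: copyof_def\<close>)
  have "eventually (\<lambda>z. \<forall>k\<in>{..<lev y p}. \<not> (\<exists>w. copyof T z p k w)) (nhds y)"
  proof (rule eventually_ball_finite)
    show "\<forall>k\<in>{..<lev y p}. eventually (\<lambda>z. \<not> (\<exists>w. copyof T z p k w)) (nhds y)"
    proof
      fix k assume "k \<in> {..<lev y p}"
      then have "\<not> (\<exists>w. copyof T y p k w)" using lev_le by fastforce
      then show "eventually (\<lambda>z. \<not> (\<exists>w. copyof T z p k w)) (nhds y)" by (rule no_copy_local[OF y])
    qed
  qed simp
  from nhds_within[OF this] nhds_within[OF 1] in_\<Omega> show ?thesis
  proof eventually_elim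
    case (elim z)
    note m = mc[OF gen_cov[OF elim(3)], of p]
    have l: "lev z p = lev y p"
    proof (rule antisym)
      show "lev z p \<le> lev y p" using lev_le elim(2) by blast
      show "lev y p \<le> lev z p"
      proof (rule ccontr)
        assume "\<not> lev y p \<le> lev z p"
        then show False using elim(1) m by fastforce
      qed
    qed
    then show ?case using mc_eqI[OF gen_cov[OF elim(3)]] elim(2) by simp
  qed
qed

lemma U_tendsto: assumes "gen y" "w \<in> W" shows "((\<lambda>z. U z w p) \<longlongrightarrow> U y w p) (at y within \<Omega>)"
  unfolding U_def by (intro tendsto_intros frac_tendsto H0_affine gen_H0 assms)

lemma kap_tendsto: assumes "gen y" "w \<in> W" "w' \<in> W" shows "((\<lambda>z. kap z w w') \<longlongrightarrow> kap y w w') (at y within \<Omega>)"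
  unfolding kap_def by (intro tendsto_intros frac_tendsto karg_affine gen_karg assms)

lemma d_tendsto: assumes y: "gen y" shows "((\<lambda>z. d z p p') \<longlongrightarrow> d y p p') (at y within \<Omega>)"
proof -
  define w where "w = mc y p"
  define w' where "w' = mc y p'"
  define l where "l \<longleftrightarrow> lev y p \<le> lev y p'"
  have W: "w \<in> W" "w' \<in> W" using mc_W[OF gen_cov[OF y]] unfolding w_def w'_def by blast+
  let ?d = "\<lambda>z. if l then U z w' p' - U z w p - kap z w w' else U z w' p' + kap z w' w - U z w p"
  have "eventually (\<lambda>z. ?d z = d z p p') (at y within \<Omega>)"
    using lev_mc_local[OF y, of p] lev_mc_local[OF y, of p']
    by eventually_elim (simp add: d_def l_def w_def w'_def)
  moreover have "(?d \<longlongrightarrow> d y p p') (at y within \<Omega>)"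
  proof (cases l)
    case True
    then have "d y p p' = U y w' p' - U y w p - kap y w w'" by (simp add: d_def l_def w_def w'_def)
    moreover have "((\<lambda>z. U z w' p' - U z w p - kap z w w') \<longlongrightarrow> U y w' p' - U y w p - kap y w w') (at y within \<Omega>)"
      by (intro tendsto_intros U_tendsto kap_tendsto y W)
    ultimately show ?thesis using True by simp
  next
    case False
    then have "d y p p' = U y w' p' + kap y w' w - U y w p" by (simp add: d_def l_def w_def w'_def)
    moreover have "((\<lambda>z. U z w' p' + kap z w' w - U z w p) \<longlongrightarrow> U y w' p' + kap y w' w - U y w p) (at y within \<Omega>)"
      by (intro tendsto_intros U_tendsto kap_tendsto y W)
    ultimately show ?thesis using False by simp
  qed
  ultimately show ?thesis by (rule Lim_transform_eventually[rotated])
qed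

definition D :: "conf \<Rightarrow> place \<Rightarrow> place \<Rightarrow> int" where
  "D y p p' = \<lfloor>d y p p' + (H0 y p' - H0 y p)\<rfloor>"

lemma of_int_D: "gen y \<Longrightarrow> of_int (D y p p') = d y p p' + (H0 y p' - H0 y p)"
  unfolding D_def using d_int[OF gen_cov] by (simp add: of_int_floor_cancel)

text \<open>Along generic configurations the expression under the floor is continuous and integral,
  hence locally constant.\<close>

lemma D_local: assumes y: "gen y" shows "eventually (\<lambda>z. D z p p' = D y p p') (at y within \<Omega>)"
proof -
  have h: "affine_fun (\<lambda>y. H0 y p)" for p using H0_affine[OF one_W] by simp
  have "eventually (\<lambda>z. d z p p' + (H0 z p' - H0 z p) = d y p p' + (H0 y p' - H0 y p)) (at y within \<Omega>)"
  proof (rule Ints_tendsto_eventually)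
    show "((\<lambda>z. d z p p' + (H0 z p' - H0 z p)) \<longlongrightarrow> d y p p' + (H0 y p' - H0 y p)) (at y within \<Omega>)"
      by (intro tendsto_intros d_tendsto affine_tendsto h y)
  qed (use d_int gen_cov y in auto)
  then show ?thesis by (rule eventually_mono) (simp add: D_def)
qed

end

section \<open>Consecutive elements, ranks and windows\<close>

definition consec :: "(int \<Rightarrow> bool) \<Rightarrow> int \<Rightarrow> int \<Rightarrow> bool" where
  "consec S i j \<longleftrightarrow> S i \<and> S j \<and> i < j \<and> (\<forall>k. i < k \<and> k < j \<longrightarrow> \<not> S k)"

text \<open>\<open>P\<close> cuts \<open>S\<close> into a lower and an upper part; as
  \<open>S\<close> has bounded gaps, the largest element of the lower part has a successor in
  \<open>S\<close>. This locates a point between consecutive boundaries.\<close>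

lemma consec_threshold:
  assumes win: "\<And>x. \<exists>k. S k \<and> x < k \<and> k \<le> x + K"
    and down: "\<And>i j. S i \<Longrightarrow> S j \<Longrightarrow> i < j \<Longrightarrow> P j \<Longrightarrow> P i"
    and ex: "S i0" "P i0" "S j0" "\<not> P j0"
  shows "\<exists>i j. consec S i j \<and> P i \<and> \<not> P j"
    and "consec S i j \<Longrightarrow> P i \<Longrightarrow> \<not> P j \<Longrightarrow> consec S i' j' \<Longrightarrow> P i' \<Longrightarrow> \<not> P j' \<Longrightarrow> i = i' \<and> j = j'"
proof -
  let ?I = "{i. S i \<and> P i \<and> i0 \<le> i}"
  have sub: "?I \<subseteq> {i0..j0}" using down[OF ex(3)] ex(4) by (metis (no_types, lifting) atLeastAtMost_iff mem_Collect_eq not_le subsetI)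
  have f: "finite ?I" using sub by (rule finite_subset) simp
  have ne: "?I \<noteq> {}" using ex by blast
  define i where "i = Max ?I"
  have i: "S i" "P i" "i0 \<le> i" using Max_in[OF f ne] unfolding i_def by auto
  have imax: "k \<le> i" if "S k" "P k" for k
  proof (cases "i0 \<le> k")
    case True then show ?thesis using Max_ge[OF f] that unfolding i_def by blast
  next
    case False then show ?thesis using i by linarith
  qed
  let ?J = "{k. S k \<and> i < k \<and> k \<le> i + K}"
  have fJ: "finite ?J" by (rule finite_subset[of _ "{i..i + K}"]) auto
  have neJ: "?J \<noteq> {}" using win[of i] by blast
  define j where "j = Min ?J"
  have j: "S j" "i < j" "j \<le> i + K" using Min_in[OF fJ neJ] unfolding j_def by auto
  have "\<not> S k" if "i < k" "k < j" for k using Min_le[OF fJ, of k] that j(3) unfolding j_def by fastforce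
  then have "consec S i j" unfolding consec_def using i j by blast
  moreover have "\<not> P j" using imax[OF j(1)] j(2) by linarith
  ultimately show "\<exists>i j. consec S i j \<and> P i \<and> \<not> P j" using i(2) by blast
  show "i = i' \<and> j = j'" if h: "consec S i j" "P i" "\<not> P j" "consec S i' j'" "P i'" "\<not> P j'" for i j i' j'
  proof -
    have *: "\<not> i < i'" if "consec S i j" "P i" "\<not> P j" "consec S i' j'" "P i'" for i j i' j'
    proof
      assume "i < i'"
      then have "j \<le> i'" using that unfolding consec_def by (meson not_le)
      then show False using that down[of j i'] unfolding consec_def by (cases "j = i'") auto
    qed
    have "i = i'" using *[OF h(1-5)] *[OF h(4-6) h(1,2)] by linarith
    then show ?thesis using h(1,4) unfolding consec_def by (metis not_less_iff_gr_or_eq)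
  qed

qed

lemma consec_gap:
  assumes win: "\<And>x. \<exists>k. S k \<and> x < k \<and> k \<le> x + K" and c: "consec S i j"
  shows "j \<le> i + K"
  using win[of i] c unfolding consec_def by (meson not_le order.trans linorder_not_le)

definition rnk :: "('a \<Rightarrow> real) \<Rightarrow> 'a set \<Rightarrow> 'a \<Rightarrow> nat" where
  "rnk f S x = card {z \<in> S. f z < f x}"

lemma rnk_bij: assumes f: "finite S" and i: "inj_on f S" shows "bij_betw (rnk f S) S {..<card S}"
proof -
  have less: "rnk f S x < rnk f S y" if "x \<in> S" "y \<in> S" "f x < f y" for x y
  proof -
    have "{z \<in> S. f z < f x} \<subset> {z \<in> S. f z < f y}" using that by force
    then show ?thesis unfolding rnk_def using f by (intro psubset_card_mono) auto
  qed
  have inj: "inj_on (rnk f S) S"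
  proof (rule inj_onI)
    fix x y assume h: "x \<in> S" "y \<in> S" "rnk f S x = rnk f S y"
    then have "f x = f y" using less[of x y] less[of y x] by (cases "f x" "f y" rule: linorder_cases) auto
    then show "x = y" using i h by (auto dest: inj_onD)
  qed
  have "rnk f S ` S \<subseteq> {..<card S}"
  proof
    fix n assume "n \<in> rnk f S ` S"
    then obtain x where x: "x \<in> S" "n = rnk f S x" by blast
    have "{z \<in> S. f z < f x} \<subset> S" using x(1) by auto
    then show "n \<in> {..<card S}" using x(2) f unfolding rnk_def by (simp add: psubset_card_mono)
  qed
  then have "rnk f S ` S = {..<card S}" using inj card_image[OF inj] by (intro card_subset_eq) auto
  then show ?thesis using inj unfolding bij_betw_def by blast
qed

lemma rnk_ex1: assumes "finite S" "inj_on f S" "k < card S" shows "\<exists>!x. x \<in> S \<and> rnk f S x = k"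
proof -
  have b: "rnk f S ` S = {..<card S}" "inj_on (rnk f S) S" using rnk_bij[OF assms(1,2)] unfolding bij_betw_def by auto
  then obtain x where x: "x \<in> S" "rnk f S x = k" using assms(3) by (metis image_iff lessThan_iff)
  show ?thesis
  proof (rule ex1I[of _ x])
    show "z = x" if "z \<in> S \<and> rnk f S z = k" for z using inj_onD[OF b(2), of z x] that x by simp
  qed (use x in simp)
qed

lemma rnk_less: assumes "finite S" "x \<in> S" shows "rnk f S x < card S"
proof -
  have "{z \<in> S. f z < f x} \<subset> S" using assms(2) by auto
  then show ?thesis unfolding rnk_def using assms(1) by (simp add: psubset_card_mono)
qed

lemma rnk_image:
  assumes "inj_on h S" "x \<in> S" and f: "\<And>z. z \<in> S \<Longrightarrow> g (h z) = f z + c"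
  shows "rnk g (h ` S) (h x) = rnk f S x"
proof -
  have "{z \<in> h ` S. g z < g (h x)} = h ` {z \<in> S. f z < f x}" using f assms(2) by auto
  then show ?thesis unfolding rnk_def using assms(1) by (simp add: card_image inj_on_subset)
qed

lemma sum_int_telescope:
  fixes g :: "int \<Rightarrow> int" and i j :: int
  shows "i \<le> j \<Longrightarrow> (\<Sum>k\<in>{i<..j}. g k - g (k - 1)) = g j - g i"
proof (induction j rule: int_ge_induct)
  case base then show ?case by simp
next
  case (step j)
  have "{i<..j + 1} = insert (j + 1) {i<..j}" using step(1) by auto
  then show ?case using step by simp
qed

lemma card_strips:
  assumes "\<And>q. q \<in> {a<..b} \<Longrightarrow> lo q \<le> hi q"
  shows "int (card {(q, m). a < q \<and> q \<le> (b::int) \<and> lo q < m \<and> m \<le> (hi q :: int)}) = (\<Sum>q\<in>{a<..b}. hi q - lo q)"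
    and "finite {(q, m). a < q \<and> q \<le> b \<and> lo q < m \<and> m \<le> hi q}"
proof -
  have e: "{(q, m). a < q \<and> q \<le> b \<and> lo q < m \<and> m \<le> hi q} = Sigma {a<..b} (\<lambda>q. {lo q<..hi q})" by auto
  show "finite {(q, m). a < q \<and> q \<le> b \<and> lo q < m \<and> m \<le> hi q}" unfolding e by simp
  have "int (card (Sigma {a<..b} (\<lambda>q. {lo q<..hi q}))) = (\<Sum>q\<in>{a<..b}. int (card {lo q<..hi q}))" by simp
  also have "\<dots> = (\<Sum>q\<in>{a<..b}. hi q - lo q)" by (rule sum.cong) (use assms in auto)
  finally show "int (card {(q, m). a < q \<and> q \<le> b \<and> lo q < m \<and> m \<le> hi q}) = (\<Sum>q\<in>{a<..b}. hi q - lo q)" unfolding e .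
qed

section \<open>Separation and recurrence of the multiples of an irrational number modulo
  integers\<close>

lemma irrational_gap:
  assumes irr: "(\<alpha> :: real) \<notin> \<rat>"
  shows "\<exists>e>0. \<forall>k l. 0 < k \<and> k < int N \<longrightarrow> 2 * e < \<bar>of_int k * \<alpha> - of_int l\<bar>"
proof (induction N)
  case 0 then show ?case by (intro exI[of _ 1]) auto
next
  case (Suc N)
  then obtain e where e: "e > 0" "\<And>k l. 0 < k \<Longrightarrow> k < int N \<Longrightarrow> 2 * e < \<bar>of_int k * \<alpha> - of_int l\<bar>" by blast
  show ?case
  proof (cases "N = 0")
    case True then show ?thesis by (intro exI[of _ 1]) auto
  next
    case False
    define x where "x = of_int (int N) * \<alpha>"
    have "x \<notin> \<int>"
    proof
      assume "x \<in> \<int>"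
      then have "x / of_int (int N) \<in> \<rat>" by (auto elim!: Ints_cases)
      then show False using irr False unfolding x_def by simp
    qed
    define e' where "e' = min e (min (frac x) (1 - frac x) / 4)"
    have fx: "0 < frac x" "frac x < 1" using \<open>x \<notin> \<int>\<close> by (simp_all add: frac_gt_0_iff frac_lt_1)
    have e': "e' > 0" "e' \<le> e" "4 * e' \<le> frac x" "4 * e' \<le> 1 - frac x" using e(1) fx unfolding e'_def by (auto simp: min_def)
    have "2 * e' < \<bar>of_int k * \<alpha> - of_int l\<bar>" if k: "0 < k" "k < int (Suc N)" for k l
    proof (cases "k = int N")
      case True
      have "2 * e' < \<bar>x - of_int l\<bar>" using e' by (cases "l \<le> \<lfloor>x\<rfloor>") (unfold frac_def, linarith+)
      then show ?thesis using True unfolding x_def by simp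
    next
      case False
      then show ?thesis using e(2)[of k l] k e'(2) by linarith
    qed
    then show ?thesis using e'(1) by blast
  qed
qed

text \<open>Dirichlet's theorem gives a multiple of \<open>\<alpha>\<close> that differs from an
  integer by a nonzero \<delta> shorter than \<open>e\<close>. Steps of this length cannot jump over
  the target, and about 1 / |\<delta>| of them cross a unit interval, whatever the start.\<close>

lemma irrational_window:
  assumes irr: "(\<alpha> :: real) \<notin> \<rat>" and e: "0 < e"
  shows "\<exists>K\<ge>1. \<forall>t. \<exists>j l. 1 \<le> j \<and> j \<le> K \<and> t + of_int j * \<alpha> - e < of_int l \<and> of_int l \<le> t + of_int j * \<alpha> + e"
proof -
  obtain N :: nat where N: "N > 0" "1 / N < e" using e by (metis nat_approx_posE of_nat_0_less_iff zero_less_Suc)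
  obtain h k where k: "0 < k" "k \<le> int N" "\<bar>of_int k * \<alpha> - of_int h\<bar> < 1 / N" using Dirichlet_approx[OF N(1)] by blast
  define \<delta> where "\<delta> = of_int k * \<alpha> - of_int h"
  have d0: "\<delta> \<noteq> 0"
  proof
    assume "\<delta> = 0"
    then have "\<alpha> = of_int h / of_int k" using k(1) unfolding \<delta>_def by (simp add: field_simps)
    then show False using irr by simp
  qed
  have de: "\<bar>\<delta>\<bar> < e" using k(3) N(2) unfolding \<delta>_def by linarith
  define J where "J = \<lceil>1 / \<bar>\<delta>\<bar>\<rceil> + 1"
  have J: "1 / \<bar>\<delta>\<bar> \<le> of_int J - 1" "1 \<le> J" proof -
    have "0 < 1 / \<bar>\<delta>\<bar>" using d0 by simp
    then show "1 / \<bar>\<delta>\<bar> \<le> of_int J - 1" "1 \<le> J" unfolding J_def by linarith+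
  qed
  show ?thesis
  proof (rule exI[of _ "k * J"], rule conjI, rule_tac [2] allI)
    show "k * J \<ge> 1" using k(1) J(2) mult_mono[of 1 k 1 J] by simp
    fix t
    \<comment> \<open>\<open>n\<close> is the next integer in the direction in which steps of
      \<delta> move, and \<open>r\<close> the distance to it.\<close>
    obtain r n where r: "t = of_int n - r * sgn \<delta>" "0 \<le> r" "r < (1::real)"
    proof (cases "\<delta> > 0")
      case True
      then show ?thesis using that[of "\<lceil>t\<rceil>" "of_int \<lceil>t\<rceil> - t"] by (simp; linarith)
    next
      case False
      then show ?thesis using that[of "\<lfloor>t\<rfloor>" "t - of_int \<lfloor>t\<rfloor>"] d0 by (simp; linarith)
    qed
    define j where "j = \<lfloor>r / \<bar>\<delta>\<bar>\<rfloor> + 1"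
    have s: "r / \<bar>\<delta>\<bar> < of_int j" "of_int j - 1 \<le> r / \<bar>\<delta>\<bar>" unfolding j_def by linarith+
    have "0 \<le> r / \<bar>\<delta>\<bar>" using r(2) by simp
    then have j1: "1 \<le> j" unfolding j_def by simp
    have "r / \<bar>\<delta>\<bar> \<le> 1 / \<bar>\<delta>\<bar>" using r(3) by (intro divide_right_mono) auto
    then have "of_int j \<le> (of_int J :: real)" using s(2) J(1) by linarith
    then have jJ: "j \<le> J" by simp
    have "r < of_int j * \<bar>\<delta>\<bar>" "of_int j * \<bar>\<delta>\<bar> - \<bar>\<delta>\<bar> \<le> r" using s d0 by (simp_all add: field_simps)
    then have b: "0 < of_int j * \<bar>\<delta>\<bar> - r" "of_int j * \<bar>\<delta>\<bar> - r \<le> \<bar>\<delta>\<bar>" by linarith+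
    have eq: "t + of_int (k * j) * \<alpha> - of_int (n + j * h) = sgn \<delta> * (of_int j * \<bar>\<delta>\<bar> - r)"
    proof -
      have "t + of_int (k * j) * \<alpha> - of_int (n + j * h) = of_int j * \<delta> - r * sgn \<delta>"
        unfolding r(1) \<delta>_def by (simp add: algebra_simps)
      also have "\<dots> = sgn \<delta> * (of_int j * \<bar>\<delta>\<bar> - r)"
        using d0 by (simp add: algebra_simps) (simp add: sgn_if abs_if)
      finally show ?thesis .
    qed
    have "\<bar>sgn \<delta> * (of_int j * \<bar>\<delta>\<bar> - r)\<bar> \<le> \<bar>\<delta>\<bar>" using b d0 by (simp add: abs_mult abs_sgn_eq)
    then have "\<bar>t + of_int (k * j) * \<alpha> - of_int (n + j * h)\<bar> < e" unfolding eq using de by linarith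
    moreover have "1 \<le> k * j" "k * j \<le> k * J" using k(1) j1 jJ mult_mono[of 1 k 1 j] by auto
    ultimately show "\<exists>j l. 1 \<le> j \<and> j \<le> k * J \<and> t + of_int j * \<alpha> - e < of_int l \<and> of_int l \<le> t + of_int j * \<alpha> + e"
      by (intro exI[of _ "k * j"] exI[of _ "n + j * h"]) linarith
  qed
qed

section \<open>Matching red and blue points\<close>

lemma image_eq_of_surj: "(\<And>z. h z \<in> S' \<longleftrightarrow> z \<in> S) \<Longrightarrow> surj h \<Longrightarrow> S' = h ` S"
  by (auto simp: image_iff) (metis surjD)

lemma consec_shift: assumes "\<And>i. S' (i + c) = S i" "consec S i j" shows "consec S' (i + c) (j + c)"
  unfolding consec_def
proof (intro conjI allI impI)
  fix k assume "i + c < k \<and> k < j + c"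
  then have "\<not> S (k - c)" using assms(2) unfolding consec_def by simp
  then show "\<not> S' k" using assms(1)[of "k - c"] by simp
qed (use assms in \<open>auto simp: consec_def\<close>)

lemma consec_reflect: assumes "\<And>i. S' (- 1 - i) = S i" "consec S i j" shows "consec S' (- 1 - j) (- 1 - i)"
  unfolding consec_def
proof (intro conjI allI impI)
  fix k assume "- 1 - j < k \<and> k < - 1 - i"
  then have "\<not> S (- 1 - k)" using assms(2) unfolding consec_def by simp
  then show "\<not> S' k" using assms(1)[of "- 1 - k"] by simp
qed (use assms in \<open>auto simp: consec_def\<close>)

lemma floor_uminus: "(t::real) \<notin> \<int> \<Longrightarrow> \<lfloor>- t\<rfloor> = - \<lfloor>t\<rfloor> - 1"
  by (metis Ints_of_int ceiling_def ceiling_altdef minus_diff_eq minus_minus diff_minus_eq_add uminus_add_conv_diff add.commute)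

context setting
begin

text \<open>Lines and rows whose offset is within \<open>e\<close> of an integer cut the plane into cells. They are far enough apart that
  the boundaries \<open>Tv\<close>, \<open>Th\<close> of the cells, perturbed by the bounded \<open>d\<close>, do not cross.\<close>
definition act :: "real \<Rightarrow> bool" where "act t \<longleftrightarrow> \<lfloor>t - e\<rfloor> < \<lfloor>t + e\<rfloor>"

abbreviation AL where "AL y i \<equiv> act (lin y i)"
abbreviation AR where "AR y q \<equiv> act (rw y q)"

lemma act_iff: "act t \<longleftrightarrow> (\<exists>l::int. t - e < of_int l \<and> of_int l \<le> t + e)"
  unfolding act_def by (metis floor_less_iff le_floor_iff order_le_less_trans order_less_le_trans order_refl)

lemma act_shift: "act (t + of_int j) = act t"
proof -
  have "t + of_int j - e = (t - e) + of_int j" "t + of_int j + e = (t + e) + of_int j" by simp_all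
  then show ?thesis unfolding act_def by (simp only: floor_add_int[symmetric] add_less_cancel_right)
qed

text \<open>The window from \<open>t - e\<close> to \<open>t + e\<close> is half open; it becomes
  symmetric under negation when no integer lies on an end point.\<close>

lemma act_uminus: assumes "t + e \<notin> \<int>" "t + - e \<notin> \<int>" shows "act (- t) = act t"
proof -
  have "\<lfloor>- t - e\<rfloor> = - \<lfloor>t + e\<rfloor> - 1" "\<lfloor>- t + e\<rfloor> = - \<lfloor>t - e\<rfloor> - 1"
    using floor_uminus[OF assms(1)] floor_uminus[OF assms(2)] by simp_all
  then show ?thesis unfolding act_def by simp
qed

lemma win_AL: "\<exists>k. AL y k \<and> x < k \<and> k \<le> x + R"
proof -
  obtain j l where j: "1 \<le> j" "j \<le> R" "lin y x - of_int j * (A / B) - e < of_int l" "of_int l \<le> lin y x - of_int j * (A / B) + e"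
    using winB[of "lin y x"] by blast
  have "lin y (x + j) = lin y x - of_int j * (A / B)" unfolding lin_def using B0 by (simp add: field_simps)
  then have "AL y (x + j)" unfolding act_iff using j(3,4) by auto
  then show ?thesis using j(1,2) by (intro exI[of _ "x + j"]) simp
qed

lemma win_AR: "\<exists>k. AR y k \<and> x < k \<and> k \<le> x + R"
proof -
  obtain j l where j: "1 \<le> j" "j \<le> R" "rw y x + of_int j * (A / B) - e < of_int l" "of_int l \<le> rw y x + of_int j * (A / B) + e"
    using winA[of "rw y x"] by blast
  have "rw y (x + j) = rw y x + of_int j * (A / B)" unfolding rw_def using B0 by (simp add: field_simps)
  then have "AR y (x + j)" unfolding act_iff using j(3,4) by auto
  then show ?thesis using j(1,2) by (intro exI[of _ "x + j"]) simp
qed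

text \<open>Two offsets within \<open>e\<close> of integers put \<open>k * (A / B)\<close> within
  \<open>2 * e\<close> of an integer, which \<open>gapA\<close> forbids for \<open>k\<close> below
  \<open>K0\<close>.\<close>

lemma act_gap: assumes "act s" "act t" "s - t = of_int k * (A / B)" "0 < k" shows "14 * B \<le> of_int k * A"
proof -
  obtain l l' :: int where l: "s - e < of_int l" "of_int l \<le> s + e" "t - e < of_int l'" "of_int l' \<le> t + e"
    using assms(1,2) unfolding act_iff by blast
  have "\<bar>of_int k * (A / B) - of_int (l - l')\<bar> \<le> 2 * e" using l assms(3) by simp
  then have "K0 \<le> k" using gapA[of k "l - l'"] assms(4) by (meson not_le)
  then have "A * of_int K0 \<le> A * of_int k" using A0 by simp
  then show ?thesis using K0 by (simp add: mult.commute)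
qed

section \<open>Cells, their two point sets, and the matching by rank\<close>

definition Tv :: "conf \<Rightarrow> int \<Rightarrow> int \<Rightarrow> int" where "Tv y i q = D y (i, q - 1) (i, q)"
definition Th :: "conf \<Rightarrow> int \<Rightarrow> int \<Rightarrow> int" where "Th y i q = D y (i - 1, q) (i, q)"

text \<open>Without \<open>d\<close> the right side is the real \<open>t\<close> with
  \<open>fst y + (q + 2 t + 1) B = (i + 1/2) A\<close>: the boundary is placed half way between the
  red points \<open>t\<close> and \<open>t + 1\<close> of row \<open>q\<close>. Red points with
  \<open>m\<close> up to \<open>Tv\<close> count as left of the line boundary.\<close>

lemma Tv_val: assumes "gen y"
  shows "of_int (Tv y i q) = - lin y i / 2 - (of_int q + 1) / 2 + d y (i, q - 1) (i, q)"
proof -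
  have "H0 y (i, q) - H0 y (i, q - 1) = - lin y i / 2 - (of_int q + 1) / 2"
    using B0 unfolding H0_def lin_def by (simp add: field_simps)
  then show ?thesis unfolding Tv_def of_int_D[OF assms] by simp
qed

lemma Th_val: assumes "gen y"
  shows "of_int (Th y i q) = rw y q / 2 - (of_int i + 1) / 2 + d y (i - 1, q) (i, q)"
proof -
  have "H0 y (i, q) - H0 y (i - 1, q) = rw y q / 2 - (of_int i + 1) / 2"
    using B0 unfolding H0_def rw_def by (simp add: field_simps)
  then show ?thesis unfolding Th_def of_int_D[OF assms] by simp
qed

lemma Tv_less: assumes y: "gen y" and a: "AL y i" "AL y j" "i < j" shows "Tv y i q < Tv y j q"
proof -
  have e: "lin y i - lin y j = of_int (j - i) * (A / B)" unfolding lin_def using B0 by (simp add: field_simps)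
  have "14 * B \<le> of_int (j - i) * A" by (rule act_gap[OF a(1,2) e]) (use a(3) in simp)
  then have "14 \<le> of_int (j - i) * (A / B)" using B0 by (simp add: field_simps)
  then have "of_int (Tv y i q) < (of_int (Tv y j q) :: real)"
    unfolding Tv_val[OF y] using e d_bound[OF gen_cov[OF y], of "(i, q - 1)" "(i, q)"] d_bound[OF gen_cov[OF y], of "(j, q - 1)" "(j, q)"]
    by linarith
  then show ?thesis by simp
qed

lemma Th_less: assumes y: "gen y" and a: "AR y p" "AR y q" "p < q" shows "Th y i p < Th y i q"
proof -
  have e: "rw y q - rw y p = of_int (q - p) * (A / B)" unfolding rw_def using B0 by (simp add: field_simps)
  have "14 * B \<le> of_int (q - p) * A" by (rule act_gap[OF a(2,1) e]) (use a(3) in simp)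
  then have "14 \<le> of_int (q - p) * (A / B)" using B0 by (simp add: field_simps)
  then have "of_int (Th y i p) < (of_int (Th y i q) :: real)"
    unfolding Th_val[OF y] using e d_bound[OF gen_cov[OF y], of "(i - 1, p)" "(i, p)"] d_bound[OF gen_cov[OF y], of "(i - 1, q)" "(i, q)"]
    by linarith
  then show ?thesis by simp
qed

text \<open>The red points and the blue points of the cell between the lines \<open>i\<close>, \<open>j\<close> and the rows \<open>p\<close>, \<open>q\<close>.
  Summing the cocycle \<open>D\<close> around the cell shows that there are equally many of them.\<close>
definition rho where "rho y i j p q = {(r, m). p < r \<and> r \<le> q \<and> Tv y i r < m \<and> m \<le> Tv y j r}"
definition beta where "beta y i j p q = {(k, m). i < k \<and> k \<le> j \<and> Th y k p < m \<and> m \<le> Th y k q}"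
definition cell where "cell y i j p q \<longleftrightarrow> consec (AL y) i j \<and> consec (AR y) p q"

lemma D_add: assumes "gen y" "cheb a b \<le> R" "cheb a c \<le> R" "cheb b c \<le> R" shows "D y b c = D y a c - D y a b"
proof -
  have "of_int (D y b c) = (of_int (D y a c - D y a b) :: real)"
    unfolding of_int_diff of_int_D[OF assms(1)] using d_add[OF gen_cov[OF assms(1)] assms(2-4)] by simp
  then show ?thesis by (simp only: of_int_eq_iff)
qed

lemma cell_card: assumes y: "gen y" and c: "cell y i j p q"
  shows "finite (rho y i j p q)" "finite (beta y i j p q)" "card (rho y i j p q) = card (beta y i j p q)"
proof -
  have ij: "consec (AL y) i j" and pq: "consec (AR y) p q" using c unfolding cell_def by auto
  have l: "i < j" "j \<le> i + R" "p < q" "q \<le> p + R"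
    using consec_gap[OF win_AL ij] consec_gap[OF win_AR pq] ij pq unfolding consec_def by auto
  have tv: "Tv y i r \<le> Tv y j r" for r using Tv_less[OF y, of i j r] ij unfolding consec_def by auto
  have th: "Th y k p \<le> Th y k q" for k using Th_less[OF y, of p q k] pq unfolding consec_def by auto
  \<comment> \<open>A potential of \<open>D\<close> based at the corner \<open>(i, p)\<close>. It
    exists on the cell because its sides are at most \<open>R\<close>; both counts then equal the
    alternating sum of \<open>G\<close> over the four corners.\<close>
  define G where "G k r = D y (i, p) (k, r)" for k r
  have DG: "D y (k, r) (k', r') = G k' r' - G k r"
    if "i \<le> k" "k \<le> j" "i \<le> k'" "k' \<le> j" "p \<le> r" "r \<le> q" "p \<le> r'" "r' \<le> q" for k r k' r'
    unfolding G_def by (rule D_add[OF y]) (use that l in \<open>auto simp: cheb_def\<close>)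
  have "int (card (rho y i j p q)) = (\<Sum>r\<in>{p<..q}. Tv y j r - Tv y i r)"
    unfolding rho_def by (rule card_strips(1)) (rule tv)
  also have "\<dots> = (\<Sum>r\<in>{p<..q}. (G j r - G i r) - (G j (r - 1) - G i (r - 1)))"
    unfolding Tv_def using l by (intro sum.cong refl) (simp add: DG)
  also have "\<dots> = (G j q - G i q) - (G j p - G i p)" using l by (intro sum_int_telescope) simp
  also have "\<dots> = (G j q - G j p) - (G i q - G i p)" by simp
  also have "\<dots> = (\<Sum>k\<in>{i<..j}. (G k q - G k p) - (G (k - 1) q - G (k - 1) p))" using l by (intro sum_int_telescope[symmetric]) simp
  also have "\<dots> = (\<Sum>k\<in>{i<..j}. Th y k q - Th y k p)"
    unfolding Th_def using l by (intro sum.cong refl) (simp add: DG)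
  also have "\<dots> = int (card (beta y i j p q))"
    unfolding beta_def by (rule card_strips(1)[symmetric]) (rule th)
  finally show "card (rho y i j p q) = card (beta y i j p q)" by simp
  show "finite (rho y i j p q)" "finite (beta y i j p q)" unfolding rho_def beta_def
    by (rule card_strips(2), rule tv) (rule card_strips(2), rule th)
qed

text \<open>Signs orienting a cell. The swap of the axes exchanges red and blue points and reverses both coordinates of
  the indices, hence the opposite sign conventions in \<open>sx\<close> and \<open>sy\<close>.\<close>
definition sx where "sx y i j = (if even \<lfloor>lin y i + lin y j\<rfloor> then 1 else - 1 :: real)"
definition sy where "sy y p q = (if even \<lfloor>rw y p + rw y q\<rfloor> then - 1 else 1 :: real)"

text \<open>Up to a constant of the configuration this is \<open>s\<close> times the abscissa plus
  \<open>t\<close> times the ordinate of the red point with index \<open>z\<close>; points are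
  ranked along a diagonal direction. \<open>bkey\<close> is the same for blue points.\<close>

definition rkey :: "real \<Rightarrow> real \<Rightarrow> place \<Rightarrow> real" where
  "rkey s t z = s * of_int (fst z + 2 * snd z) * B + t * of_int (fst z) * A"
definition bkey :: "real \<Rightarrow> real \<Rightarrow> place \<Rightarrow> real" where
  "bkey s t z = s * of_int (fst z) * A + t * of_int (fst z + 2 * snd z) * B"

text \<open>No ties occur, since the keys are integral combinations of \<open>A\<close> and
  \<open>B\<close>.\<close>

lemma key_inj: assumes "s = 1 \<or> s = - 1" "t = 1 \<or> t = - 1" shows "inj_on (rkey s t) S" "inj_on (bkey s t) S"
proof -
  have *: "z = z'" if eq: "s * of_int (fst z + 2 * snd z) * B + t * of_int (fst z) * A = s * of_int (fst z' + 2 * snd z') * B + t * of_int (fst z') * A"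
      and st: "s = 1 \<or> s = - 1" "t = 1 \<or> t = - 1" for s t :: real and z z' :: place
  proof -
    obtain s' t' :: int where s': "s = of_int s'" "t = of_int t'" "s' \<noteq> 0" "t' \<noteq> 0"
      using st by (metis of_int_1 of_int_minus one_neq_zero neg_equal_0_iff_equal)
    have "of_int (t' * (fst z - fst z')) * A + of_int (s' * ((fst z + 2 * snd z) - (fst z' + 2 * snd z'))) * B = 0"
      using eq unfolding s' by (simp add: algebra_simps)
    from lin_indep[OF this] show ?thesis using s' by (simp add: prod_eq_iff)
  qed
  have r: "inj_on (rkey s t) S" if "s = 1 \<or> s = - 1" "t = 1 \<or> t = - 1" for s t
  proof (rule inj_onI)
    fix z z' assume "rkey s t z = rkey s t z'"
    then show "z = z'" unfolding rkey_def by (rule *) (rule that)+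
  qed
  then show "inj_on (rkey s t) S" using assms by blast
  have "bkey s t = rkey t s" by (simp add: fun_eq_iff bkey_def rkey_def add.commute)
  then show "inj_on (bkey s t) S" using r[OF assms(2,1)] by simp
qed

lemma sx_cases: "sx y i j = 1 \<or> sx y i j = - 1" "sy y i j = 1 \<or> sy y i j = - 1"
  by (auto simp: sx_def sy_def)

definition matched where
  "matched y r b i j p q \<longleftrightarrow> cell y i j p q \<and> r \<in> rho y i j p q \<and> b \<in> beta y i j p q \<and>
     rnk (rkey (sx y i j) (sy y p q)) (rho y i j p q) r = rnk (bkey (sx y i j) (sy y p q)) (beta y i j p q) b"

definition Mt where "Mt y r b \<longleftrightarrow> (\<exists>i j p q. matched y r b i j p q)"

text \<open>In the row of the red point, the offsets of the selected lines increase strictly and are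
  unbounded in both directions, since their linear growth in \<open>i\<close> outweighs the bounded
  \<open>d\<close>. The point thus lies between exactly one consecutive pair, and likewise for the
  rows.\<close>

lemma cell_ex1: assumes y: "gen y"
  shows "\<exists>i j p q. cell y i j p q \<and> r \<in> rho y i j p q"
    "cell y i j p q \<Longrightarrow> r \<in> rho y i j p q \<Longrightarrow> cell y i' j' p' q' \<Longrightarrow> r \<in> rho y i' j' p' q' \<Longrightarrow>
      i = i' \<and> j = j' \<and> p = p' \<and> q = q'"
proof -
  obtain r0 m0 where r: "r = (r0, m0)" by (cases r)
  have row: "\<exists>p. AR y p \<and> p < r0" "\<exists>q. AR y q \<and> \<not> q < r0"
    using win_AR[of y "r0 - R - 1"] win_AR[of y "r0"] by fastforce+
  define c where "c = of_int m0 + (of_int r0 + 1) / 2 + fst y / (2 * B) - A / (4 * B)"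
  have val: "of_int (Tv y i r0) = of_int m0 + (of_int i * (A / (2 * B)) - c) + d y (i, r0 - 1) (i, r0)" for i
    unfolding Tv_val[OF y] lin_def c_def using B0 by (simp add: field_simps)
  note db = d_bound[OF gen_cov[OF y]]
  have a0: "A / (2 * B) > 0" using A0 B0 by simp
  \<comment> \<open>The margin 4 exceeds the bound 3 on \<open>d\<close>, so beyond
    \<open>N1\<close> and \<open>N2\<close> the side of the point is decided.\<close>
  define N1 where "N1 = \<lfloor>(c - 4) / (A / (2 * B))\<rfloor>"
  define N2 where "N2 = \<lceil>(c + 4) / (A / (2 * B))\<rceil>"
  obtain i1 where i1: "AL y i1" "i1 \<le> N1" using win_AL[of y "N1 - R"] by auto
  obtain i2 where i2: "AL y i2" "N2 < i2" using win_AL[of y N2] by blast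
  have "of_int i1 \<le> (c - 4) / (A / (2 * B))" using i1(2) unfolding N1_def by (simp add: le_floor_iff)
  then have "of_int i1 * (A / (2 * B)) \<le> c - 4" using a0 by (simp only: pos_le_divide_eq)
  then have t1: "Tv y i1 r0 < m0" using val[of i1] db[of "(i1, r0 - 1)" "(i1, r0)"] by linarith
  have "(c + 4) / (A / (2 * B)) \<le> of_int i2" using i2(2) unfolding N2_def by (simp add: ceiling_less_iff)
  then have "c + 4 \<le> of_int i2 * (A / (2 * B))" using a0 by (simp only: pos_divide_le_eq)
  then have t2: "\<not> Tv y i2 r0 < m0" using val[of i2] db[of "(i2, r0 - 1)" "(i2, r0)"] by linarith
  have down: "Tv y i r0 < m0" if "AL y i" "AL y j" "i < j" "Tv y j r0 < m0" for i j
    using Tv_less[OF y that(1-3), of r0] that(4) by linarith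
  obtain p0 q0 where pq0: "AR y p0" "p0 < r0" "AR y q0" "\<not> q0 < r0" using row by blast
  have L1: "\<exists>i j. consec (AL y) i j \<and> Tv y i r0 < m0 \<and> \<not> Tv y j r0 < m0"
    by (rule consec_threshold(1)[of "AL y" R "\<lambda>i. Tv y i r0 < m0" i1 i2]) (fact win_AL, fact down, fact i1(1), fact t1, fact i2(1), fact t2)
  have L2: "i = i' \<and> j = j'" if "consec (AL y) i j" "Tv y i r0 < m0" "\<not> Tv y j r0 < m0" "consec (AL y) i' j'" "Tv y i' r0 < m0" "\<not> Tv y j' r0 < m0" for i j i' j'
    by (rule consec_threshold(2)[of "AL y" R "\<lambda>i. Tv y i r0 < m0" i1 i2])
      (fact win_AL, fact down, fact i1(1), fact t1, fact i2(1), fact t2, (fact that)+)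
  have downr: "p < r0" if "AR y p" "AR y q" "p < q" "q < r0" for p q using that by simp
  have Q1: "\<exists>p q. consec (AR y) p q \<and> p < r0 \<and> \<not> q < r0"
    by (rule consec_threshold(1)[of "AR y" R "\<lambda>q. q < r0" p0 q0]) (fact win_AR, fact downr, (fact pq0)+)
  have Q2: "p = p' \<and> q = q'" if "consec (AR y) p q" "p < r0" "\<not> q < r0" "consec (AR y) p' q'" "p' < r0" "\<not> q' < r0" for p q p' q'
    by (rule consec_threshold(2)[of "AR y" R "\<lambda>q. q < r0" p0 q0]) (fact win_AR, fact downr, (fact pq0)+, (fact that)+)
  have mem: "r \<in> rho y i j p q \<longleftrightarrow> Tv y i r0 < m0 \<and> \<not> Tv y j r0 < m0 \<and> p < r0 \<and> \<not> q < r0" for i j p q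
    unfolding rho_def r by auto
  show "\<exists>i j p q. cell y i j p q \<and> r \<in> rho y i j p q"
    using L1 Q1 unfolding cell_def mem by blast
  show "i = i' \<and> j = j' \<and> p = p' \<and> q = q'"
    if "cell y i j p q" "r \<in> rho y i j p q" "cell y i' j' p' q'" "r \<in> rho y i' j' p' q'"
    using L2[of i j i' j'] Q2[of p q p' q'] that unfolding cell_def mem by blast
qed

lemma Mt_ex1: assumes y: "gen y" shows "\<exists>!b. Mt y r b"
proof -
  obtain i j p q where c: "cell y i j p q" "r \<in> rho y i j p q" using cell_ex1(1)[OF y] by blast
  note f = cell_card[OF y c(1)]
  let ?s = "sx y i j" and ?t = "sy y p q"
  have lt: "rnk (rkey ?s ?t) (rho y i j p q) r < card (beta y i j p q)"
    using rnk_less[OF f(1) c(2)] f(3) by simp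
  have *: "Mt y r b \<longleftrightarrow> b \<in> beta y i j p q \<and> rnk (bkey ?s ?t) (beta y i j p q) b = rnk (rkey ?s ?t) (rho y i j p q) r" for b
  proof
    assume "Mt y r b"
    then obtain i' j' p' q' where m: "matched y r b i' j' p' q'" unfolding Mt_def by blast
    then have "i = i' \<and> j = j' \<and> p = p' \<and> q = q'" using cell_ex1(2)[OF y c] unfolding matched_def by blast
    then show "b \<in> beta y i j p q \<and> rnk (bkey ?s ?t) (beta y i j p q) b = rnk (rkey ?s ?t) (rho y i j p q) r"
      using m unfolding matched_def by simp
  next
    assume "b \<in> beta y i j p q \<and> rnk (bkey ?s ?t) (beta y i j p q) b = rnk (rkey ?s ?t) (rho y i j p q) r"
    then have "matched y r b i j p q" using c unfolding matched_def by simp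
    then show "Mt y r b" unfolding Mt_def by blast
  qed
  show ?thesis unfolding * by (rule rnk_ex1[OF f(2) key_inj(2)[OF sx_cases] lt])
qed

end

context setting
begin

section \<open>Equivariance of the matching\<close>

lemma cheb_step: "cheb (i, q - 1) (i, q) \<le> R" "cheb (i - 1, q) (i, q) \<le> R"
  using R1 by (simp_all add: cheb_def)

lemma d_flip: assumes "gen y" "cheb p p' \<le> R" shows "d y p' p = - d y p p'"
proof -
  have "d y p p' + d y p' p = d y p p"
    using assms R0 by (intro d_add[OF gen_cov]) (simp_all add: cheb_commute)
  moreover have "d y p p + d y p p = d y p p" using assms R0 by (intro d_add[OF gen_cov]) simp_all
  ultimately show ?thesis by simp
qed

text \<open>A bijection that shifts all keys by one constant preserves ranks, so equivariance
  reduces to transporting cells, point sets and keys. The variant with a swap exchanges the two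
  colours.\<close>

lemma Mt_transport:
  assumes c: "cell y' i' j' p' q'"
    and rho: "rho y' i' j' p' q' = h ` rho y i j p q" "inj h"
    and beta: "beta y' i' j' p' q' = g ` beta y i j p q" "inj g"
    and key: "\<And>z. rkey (sx y' i' j') (sy y' p' q') (h z) = rkey (sx y i j) (sy y p q) z + c1"
      "\<And>z. bkey (sx y' i' j') (sy y' p' q') (g z) = bkey (sx y i j) (sy y p q) z + c2"
    and m: "matched y r b i j p q"
  shows "Mt y' (h r) (g b)"
proof -
  have rb: "r \<in> rho y i j p q" "b \<in> beta y i j p q" using m unfolding matched_def by auto
  have "rnk (rkey (sx y' i' j') (sy y' p' q')) (h ` rho y i j p q) (h r) = rnk (rkey (sx y i j) (sy y p q)) (rho y i j p q) r"
    using inj_on_subset[OF rho(2)] rb(1) key(1) by (intro rnk_image) auto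
  moreover have "rnk (bkey (sx y' i' j') (sy y' p' q')) (g ` beta y i j p q) (g b) = rnk (bkey (sx y i j) (sy y p q)) (beta y i j p q) b"
    using inj_on_subset[OF beta(2)] rb(2) key(2) by (intro rnk_image) auto
  ultimately have "matched y' (h r) (g b) i' j' p' q'" using c rho(1) beta(1) m rb unfolding matched_def by simp
  then show ?thesis unfolding Mt_def by blast
qed

lemma Mt_transport_swap:
  assumes c: "cell y' i' j' p' q'"
    and rho: "rho y' i' j' p' q' = g ` beta y i j p q" "inj g"
    and beta: "beta y' i' j' p' q' = h ` rho y i j p q" "inj h"
    and key: "\<And>z. rkey (sx y' i' j') (sy y' p' q') (g z) = bkey (sx y i j) (sy y p q) z + c1"
      "\<And>z. bkey (sx y' i' j') (sy y' p' q') (h z) = rkey (sx y i j) (sy y p q) z + c2"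
    and m: "matched y r b i j p q"
  shows "Mt y' (g b) (h r)"
proof -
  have rb: "r \<in> rho y i j p q" "b \<in> beta y i j p q" using m unfolding matched_def by auto
  have "rnk (bkey (sx y' i' j') (sy y' p' q')) (h ` rho y i j p q) (h r) = rnk (rkey (sx y i j) (sy y p q)) (rho y i j p q) r"
    using inj_on_subset[OF beta(2)] rb(1) key(2) by (intro rnk_image) auto
  moreover have "rnk (rkey (sx y' i' j') (sy y' p' q')) (g ` beta y i j p q) (g b) = rnk (bkey (sx y i j) (sy y p q)) (beta y i j p q) b"
    using inj_on_subset[OF rho(2)] rb(2) key(1) by (intro rnk_image) auto
  ultimately have "matched y' (g b) (h r) i' j' p' q'" using c rho(1) beta(1) m rb unfolding matched_def by simp
  then show ?thesis unfolding Mt_def by blast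
qed

lemma minus_one_shifts: "- i - 1 = - 1 - (i :: int)" "- 1 - (i - 1) = - i"
  by simp_all

text \<open>This is why the signs of a cell are parities of floors of a sum over both sides:
  reversing the axis flips the parity, whereas moving both offsets by the same integer changes the
  sum by an even number.\<close>

lemma sgn_flip: "t \<notin> \<int> \<Longrightarrow> even \<lfloor>- t :: real\<rfloor> \<longleftrightarrow> odd \<lfloor>t\<rfloor>"
  by (simp add: floor_uminus)

lemma Fam_mem: "(\<lambda>y. lin y i + e) \<in> Fam" "(\<lambda>y. lin y i + - e) \<in> Fam" "(\<lambda>y. rw y i + e) \<in> Fam"
  "(\<lambda>y. rw y i + - e) \<in> Fam" "(\<lambda>y. lin y i + lin y j) \<in> Fam" "(\<lambda>y. rw y i + rw y j) \<in> Fam"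
  unfolding Fam_def by blast+

lemma gen_lin: assumes "gen y"
  shows "lin y i + e \<notin> \<int>" "lin y i + - e \<notin> \<int>" "lin y i + lin y j \<notin> \<int>" "rw y i + rw y j \<notin> \<int>"
  using gen_Fam[OF assms Fam_mem(1)] gen_Fam[OF assms Fam_mem(2)] gen_Fam[OF assms Fam_mem(5)] gen_Fam[OF assms Fam_mem(6)]
  by auto

context
  fixes y :: conf and i2 k2 :: int
  assumes y: "gen y"
begin

abbreviation (input) "g1 \<equiv> trn A B i2 (i2 + 2 * k2)"
abbreviation (input) "y1 \<equiv> ph g1 y"

lemma g1_W: "g1 \<in> W" by (rule trn_W) simp

lemma gen_y1: "gen y1" by (rule gen_W[OF y g1_W])

lemma trn_lin: "lin y1 (i + i2) = lin y i" "rw y1 q = rw y q + of_int (i2 + 2 * k2)"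
  unfolding lin_def rw_def trn_def using B0 by (simp_all add: field_simps)

lemma trn_d: "d y1 (i + i2, q) (i' + i2, q') = d y (i, q) (i', q')"
  using d_cov[OF g1_W gen_cov[OF y], of "(i, q)" "(i', q')"] by (simp add: trn_def)

lemma trn_Tv: "Tv y1 (i + i2) q = Tv y i q"
proof -
  have "of_int (Tv y1 (i + i2) q) = (of_int (Tv y i q) :: real)"
    unfolding Tv_val[OF gen_y1] Tv_val[OF y] trn_lin trn_d by simp
  then show ?thesis by simp
qed

lemma trn_Th: "Th y1 (i + i2) q = Th y i q + k2"
proof -
  have "d y1 (i + i2 - 1, q) (i + i2, q) = d y (i - 1, q) (i, q)" using trn_d[of "i - 1" q i q] by (simp add: algebra_simps)
  then have "of_int (Th y1 (i + i2) q) = (of_int (Th y i q + k2) :: real)"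
    unfolding Th_val[OF gen_y1] of_int_add Th_val[OF y] trn_lin by (simp add: field_simps)
  then show ?thesis by (simp only: of_int_eq_iff)
qed

lemma Mt_trn: assumes "Mt y r (a, b)" shows "Mt y1 r (a + i2, b + k2)"
proof -
  obtain i j p q where m: "matched y r (a, b) i j p q" using assms unfolding Mt_def by blast
  let ?g = "\<lambda>z. (fst z + i2, snd z + k2)"
  have c: "cell y1 (i + i2) (j + i2) p q"
    using m consec_shift[of "AL y1" i2 "AL y" i j] unfolding matched_def cell_def trn_lin act_shift by simp
  have rho: "rho y1 (i + i2) (j + i2) p q = id ` rho y i j p q" unfolding rho_def trn_Tv by simp
  have beta: "beta y1 (i + i2) (j + i2) p q = ?g ` beta y i j p q"
  proof (rule image_eq_of_surj)
    show "surj ?g"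
    proof (rule surjI[where f = "\<lambda>z. (fst z - i2, snd z - k2)"])
    qed simp
    show "?g z \<in> beta y1 (i + i2) (j + i2) p q \<longleftrightarrow> z \<in> beta y i j p q" for z
      unfolding beta_def by (cases z) (simp add: trn_Th)
  qed
  have sx: "sx y1 (i + i2) (j + i2) = sx y i j" unfolding sx_def trn_lin ..
  have "rw y1 p + rw y1 q = rw y p + rw y q + of_int (2 * (i2 + 2 * k2))" unfolding trn_lin by simp
  then have sy: "sy y1 p q = sy y p q" unfolding sy_def by (simp only: floor_add_int[symmetric]) simp
  have "Mt y1 (id r) (?g (a, b))"
  proof (rule Mt_transport[OF c rho _ beta _ _ _ m])
    show "inj (id :: place \<Rightarrow> place)" by simp
    show "inj ?g" by (rule injI) (simp add: prod_eq_iff)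
    show "rkey (sx y1 (i + i2) (j + i2)) (sy y1 p q) (id z) = rkey (sx y i j) (sy y p q) z + 0" for z
      unfolding sx sy by simp
    show "bkey (sx y1 (i + i2) (j + i2)) (sy y1 p q) (?g z) = bkey (sx y i j) (sy y p q) z
        + (sx y i j * of_int i2 * A + sy y p q * of_int (i2 + 2 * k2) * B)" for z
      unfolding sx sy bkey_def by (simp add: algebra_simps)
  qed
  then show ?thesis by simp
qed

lemma mir_lin: "lin (ph mir y) (- 1 - i) = - lin y i" "rw (ph mir y) q = rw y q"
  unfolding lin_def rw_def mir_def using B0 by (simp_all add: field_simps)

lemma mir_d: "d (ph mir y) (- 1 - i, q) (- 1 - i', q') = - d y (i, q) (i', q')"
  using d_cov[OF mir_W gen_cov[OF y], of "(i, q)" "(i', q')"] by (simp add: mir_def)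

text \<open>The final \<open>- 1\<close> makes up for reversing half-open intervals:
  \<open>Tv < m\<close> becomes \<open>m' \<le> Tv'\<close> for the mirrored index
  \<open>m' = - q - m\<close>.\<close>

lemma mir_Tv: "Tv (ph mir y) (- 1 - i) q = - q - Tv y i q - 1"
proof -
  have "of_int (Tv (ph mir y) (- 1 - i) q) = (of_int (- q - Tv y i q - 1) :: real)"
    unfolding of_int_diff of_int_minus Tv_val[OF gen_W[OF y mir_W]] Tv_val[OF y] mir_lin mir_d by (simp add: field_simps)
  then show ?thesis by (simp only: of_int_eq_iff)
qed

lemma mir_Th: "Th (ph mir y) (- i) q = Th y i q + i"
proof -
  have "d (ph mir y) (- i - 1, q) (- i, q) = - d y (i, q) (i - 1, q)" using mir_d[of i q "i - 1" q] unfolding minus_one_shifts by simp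
  also have "\<dots> = d y (i - 1, q) (i, q)" using d_flip[OF y cheb_step(2)] by simp
  finally have "of_int (Th (ph mir y) (- i) q) = (of_int (Th y i q + i) :: real)"
    unfolding of_int_add Th_val[OF gen_W[OF y mir_W]] Th_val[OF y] mir_lin by (simp add: field_simps)
  then show ?thesis by (simp only: of_int_eq_iff)
qed

lemma Mt_mir: assumes "Mt y (r, m) (a, b)" shows "Mt (ph mir y) (r, - r - m) (- a, b + a)"
proof -
  obtain i j p q where m: "matched y (r, m) (a, b) i j p q" using assms unfolding Mt_def by blast
  \<comment> \<open>Mirror images in terms of indices: \<open>- (r + 2 m) = r + 2 (- r - m)\<close>
    for red points and \<open>a + 2 b = - a + 2 (b + a)\<close> for blue points.\<close>
  let ?h = "\<lambda>z. (fst z, - fst z - snd z) :: place" and ?g = "\<lambda>z. (- fst z, snd z + fst z) :: place"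
  have "AL (ph mir y) (- 1 - i) = AL y i" for i unfolding mir_lin using act_uminus gen_lin[OF y] by blast
  then have c: "cell (ph mir y) (- 1 - j) (- 1 - i) p q"
    using m consec_reflect[of "AL (ph mir y)" "AL y" i j] unfolding matched_def cell_def mir_lin by simp
  have hh: "?h (?h z) = z" "?g (?g z) = z" for z by (simp_all add: prod_eq_iff)
  have rho: "rho (ph mir y) (- 1 - j) (- 1 - i) p q = ?h ` rho y i j p q"
  proof (rule image_eq_of_surj)
    show "surj ?h" by (rule surjI[where f = ?h]) (rule hh)
    show "?h z \<in> rho (ph mir y) (- 1 - j) (- 1 - i) p q \<longleftrightarrow> z \<in> rho y i j p q" for z
      unfolding rho_def by (cases z) (auto simp: mir_Tv)
  qed
  have beta: "beta (ph mir y) (- 1 - j) (- 1 - i) p q = ?g ` beta y i j p q"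
  proof (rule image_eq_of_surj)
    show "surj ?g" by (rule surjI[where f = ?g]) (rule hh)
    show "?g z \<in> beta (ph mir y) (- 1 - j) (- 1 - i) p q \<longleftrightarrow> z \<in> beta y i j p q" for z
      unfolding beta_def by (cases z) (auto simp: mir_Th)
  qed
  have "lin (ph mir y) (- 1 - j) + lin (ph mir y) (- 1 - i) = - (lin y i + lin y j)" unfolding mir_lin by simp
  then have sx: "sx (ph mir y) (- 1 - j) (- 1 - i) = - sx y i j"
    unfolding sx_def using sgn_flip[OF gen_lin(3)[OF y, of i j]] by simp
  have sy: "sy (ph mir y) p q = sy y p q" unfolding sy_def mir_lin ..
  have "Mt (ph mir y) (?h (r, m)) (?g (a, b))"
  proof (rule Mt_transport[OF c rho _ beta _ _ _ m])
    show "inj ?h" by (rule inj_on_inverseI[where g = ?h]) (rule hh)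
    show "inj ?g" by (rule inj_on_inverseI[where g = ?g]) (rule hh)
    show "rkey (sx (ph mir y) (- 1 - j) (- 1 - i)) (sy (ph mir y) p q) (?h z) = rkey (sx y i j) (sy y p q) z + 0" for z
      unfolding sx sy rkey_def by (simp add: algebra_simps)
    show "bkey (sx (ph mir y) (- 1 - j) (- 1 - i)) (sy (ph mir y) p q) (?g z) = bkey (sx y i j) (sy y p q) z + 0" for z
      unfolding sx sy bkey_def by (simp add: algebra_simps)
  qed
  then show ?thesis by simp
qed

lemma swp_lin: "lin (ph swp y) (- 1 - q) = rw y q" "rw (ph swp y) (- 1 - i) = lin y i"
  unfolding lin_def rw_def swp_def using B0 by (simp_all add: field_simps)

lemma swp_d: "d (ph swp y) (- 1 - q, - 1 - i) (- 1 - q', - 1 - i') = d y (i, q) (i', q')"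
  using d_cov[OF swp_W gen_cov[OF y], of "(i, q)" "(i', q')"] by (simp add: swp_def)

lemma swp_Th: "Th (ph swp y) (- q) (- 1 - i) = - 1 - Tv y i q"
proof -
  have "d (ph swp y) (- q - 1, - 1 - i) (- q, - 1 - i) = d y (i, q) (i, q - 1)" using swp_d[of q i "q - 1" i] unfolding minus_one_shifts by simp
  also have "\<dots> = - d y (i, q - 1) (i, q)" using d_flip[OF y cheb_step(1)] by simp
  finally have "of_int (Th (ph swp y) (- q) (- 1 - i)) = (of_int (- 1 - Tv y i q) :: real)"
    unfolding of_int_diff Th_val[OF gen_W[OF y swp_W]] Tv_val[OF y] swp_lin by (simp add: field_simps)
  then show ?thesis by (simp only: of_int_eq_iff)
qed

lemma swp_Tv: "Tv (ph swp y) (- 1 - q) (- i) = - 1 - Th y i q"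
proof -
  have "d (ph swp y) (- 1 - q, - i - 1) (- 1 - q, - i) = d y (i, q) (i - 1, q)" using swp_d[of q i q "i - 1"] unfolding minus_one_shifts by simp
  also have "\<dots> = - d y (i - 1, q) (i, q)" using d_flip[OF y cheb_step(2)] by simp
  finally have "of_int (Tv (ph swp y) (- 1 - q) (- i)) = (of_int (- 1 - Th y i q) :: real)"
    unfolding of_int_diff Tv_val[OF gen_W[OF y swp_W]] Th_val[OF y] swp_lin by (simp add: field_simps)
  then show ?thesis by (simp only: of_int_eq_iff)
qed

lemma Mt_swp: assumes "Mt y (r, m) (a, b)" shows "Mt (ph swp y) (- a, - b) (- r, - m)"
proof -
  obtain i j p q where m: "matched y (r, m) (a, b) i j p q" using assms unfolding Mt_def by blast
  let ?h = "\<lambda>z. (- fst z, - snd z) :: place"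
  have c: "cell (ph swp y) (- 1 - q) (- 1 - p) (- 1 - j) (- 1 - i)"
    using m consec_reflect[of "AL (ph swp y)" "AR y" p q] consec_reflect[of "AR (ph swp y)" "AL y" i j]
    unfolding matched_def cell_def swp_lin by simp
  have hh: "?h (?h z) = z" for z by simp
  have s: "surj ?h" by (rule surjI[where f = ?h]) (rule hh)
  have inj: "inj ?h" by (rule inj_on_inverseI[where g = ?h]) (rule hh)
  have rho: "rho (ph swp y) (- 1 - q) (- 1 - p) (- 1 - j) (- 1 - i) = ?h ` beta y i j p q"
  proof (rule image_eq_of_surj[OF _ s])
    show "?h z \<in> rho (ph swp y) (- 1 - q) (- 1 - p) (- 1 - j) (- 1 - i) \<longleftrightarrow> z \<in> beta y i j p q" for z
      unfolding rho_def beta_def by (cases z) (auto simp: swp_Tv)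
  qed
  have beta: "beta (ph swp y) (- 1 - q) (- 1 - p) (- 1 - j) (- 1 - i) = ?h ` rho y i j p q"
  proof (rule image_eq_of_surj[OF _ s])
    show "?h z \<in> beta (ph swp y) (- 1 - q) (- 1 - p) (- 1 - j) (- 1 - i) \<longleftrightarrow> z \<in> rho y i j p q" for z
      unfolding rho_def beta_def by (cases z) (auto simp: swp_Th)
  qed
  have sx: "sx (ph swp y) (- 1 - q) (- 1 - p) = - sy y p q" unfolding sx_def sy_def swp_lin by (simp add: add.commute)
  have sy: "sy (ph swp y) (- 1 - j) (- 1 - i) = - sx y i j" unfolding sx_def sy_def swp_lin by (simp add: add.commute)
  have "Mt (ph swp y) (?h (a, b)) (?h (r, m))"
  proof (rule Mt_transport_swap[OF c rho inj beta inj _ _ m])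
    show "rkey (sx (ph swp y) (- 1 - q) (- 1 - p)) (sy (ph swp y) (- 1 - j) (- 1 - i)) (?h z) = bkey (sx y i j) (sy y p q) z + 0" for z
      unfolding sx sy rkey_def bkey_def by (simp add: algebra_simps)
    show "bkey (sx (ph swp y) (- 1 - q) (- 1 - p)) (sy (ph swp y) (- 1 - j) (- 1 - i)) (?h z) = rkey (sx y i j) (sy y p q) z + 0" for z
      unfolding sx sy rkey_def bkey_def by (simp add: algebra_simps)
  qed
  then show ?thesis by simp
qed

end

end

section \<open>Square-symmetric domains: irrational ratio\<close>

definition rlat :: "real \<Rightarrow> real \<Rightarrow> conf set" where
  "rlat A B = {(of_int i * A, of_int j * B) | i j. even (i + j)}"

definition core :: "real \<Rightarrow> real \<Rightarrow> conf set \<Rightarrow> bool" where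
  "core A B F \<longleftrightarrow> compact F \<and> (\<forall>x y. (x, y) \<in> F \<longrightarrow> (- x, y) \<in> F \<and> (y, x) \<in> F) \<and>
     (\<forall>z. \<exists>p\<in>F. \<exists>v\<in>rlat A B. z = p + v) \<and>
     (\<forall>v\<in>rlat A B. v \<noteq> 0 \<longrightarrow> interior F \<inter> interior ((\<lambda>p. p + v) ` F) = {})"

lemma rlat_minus: "v \<in> rlat A B \<Longrightarrow> - v \<in> rlat A B"
proof -
  assume "v \<in> rlat A B"
  then obtain i j where "v = (of_int i * A, of_int j * B)" "even (i + j)" unfolding rlat_def by blast
  then have "- v = (of_int (- i) * A, of_int (- j) * B) \<and> even (- i + - j)" by simp
  then show ?thesis unfolding rlat_def by blast
qed

lemma closed_rlat: assumes "0 < A" "0 < B" shows "closed (rlat A B)"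
proof (rule discrete_imp_closed[of "min A B"])
  show "0 < min A B" using assms by simp
  show "\<forall>x\<in>rlat A B. \<forall>y\<in>rlat A B. dist y x < min A B \<longrightarrow> y = x"
  proof (intro ballI impI)
    fix x y assume h: "x \<in> rlat A B" "y \<in> rlat A B" "dist y x < min A B"
    obtain i j k l where x: "x = (of_int i * A, of_int j * B)" and y: "y = (of_int k * A, of_int l * B)"
      using h(1,2) unfolding rlat_def by blast
    have "\<bar>fst y - fst x\<bar> < A" "\<bar>snd y - snd x\<bar> < B"
      using h(3) dist_fst_le[of y x] dist_snd_le[of y x] by (auto simp: dist_real_def)
    then have "\<bar>of_int (k - i) * A\<bar> < 1 * A" "\<bar>of_int (l - j) * B\<bar> < 1 * B"
      unfolding x y by (simp_all add: algebra_simps)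
    then have "\<bar>of_int (k - i)\<bar> < (1 :: real)" "\<bar>of_int (l - j)\<bar> < (1 :: real)"
      using assms by (simp_all add: abs_mult del: mult_1)
    then have "k = i" "l = j" by linarith+
    then show "y = x" unfolding x y by simp
  qed
qed

text \<open>Translates of the closure under the lattice form a closed union that contains all
  generic points, hence everything. If interiors of two translates met, the open intersection would
  contain a generic \<open>y\<close>; local constancy puts \<open>y\<close> and its translate back
  into \<open>F\<close>, against uniqueness.\<close>

lemma core_closure:
  assumes AB: "0 < A" "0 < B"
    and dense: "\<And>Z. open Z \<Longrightarrow> Z \<noteq> {} \<Longrightarrow> \<exists>y\<in>Z. g y"
    and bdd: "bounded F"
    and mir: "\<And>x y. (x, y) \<in> F \<Longrightarrow> (- x, y) \<in> F" and swp: "\<And>x y. (x, y) \<in> F \<Longrightarrow> (y, x) \<in> F"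
    and cover: "\<And>y. g y \<Longrightarrow> \<exists>v\<in>rlat A B. y + v \<in> F"
    and uniq: "\<And>y v. y \<in> F \<Longrightarrow> v \<in> rlat A B \<Longrightarrow> y + v \<in> F \<Longrightarrow> v = 0"
    and loc: "\<And>y. g y \<Longrightarrow> y \<in> closure F \<Longrightarrow> y \<in> F"
    and gtr: "\<And>y v. g y \<Longrightarrow> v \<in> rlat A B \<Longrightarrow> g (y + v)"
  shows "core A B (closure F)"
proof -
  have comp: "compact (closure F)" using bdd by (simp add: compact_closure)
  have im: "f z \<in> closure F" if "\<And>z. z \<in> F \<Longrightarrow> f z \<in> F" "continuous_on UNIV f" "z \<in> closure F" for f z
  proof -
    have "f ` closure F \<subseteq> closure (f ` F)"
      using that(2) by (intro image_closure_subset continuous_on_subset[OF that(2)]) (auto simp: closure_subset)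
    also have "\<dots> \<subseteq> closure F" using that(1) by (intro closure_mono) auto
    finally show ?thesis using that(3) by blast
  qed
  have "continuous_on UNIV (\<lambda>z :: conf. (- fst z, snd z))" "continuous_on UNIV (\<lambda>z :: conf. (snd z, fst z))"
    by (intro continuous_intros)+
  then have m: "(- x, y) \<in> closure F" "(y, x) \<in> closure F" if xy: "(x, y) \<in> closure F" for x y
    using im[of "\<lambda>z. (- fst z, snd z)", OF _ _ xy] im[of "\<lambda>z. (snd z, fst z)", OF _ _ xy] mir swp
    by auto
  have cl: "closed (\<Union>x\<in>closure F. \<Union>y\<in>rlat A B. {x + y})"
    by (rule compact_closed_sums[OF comp closed_rlat[OF AB]])
  have cov: "(\<Union>x\<in>closure F. \<Union>y\<in>rlat A B. {x + y}) = UNIV"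
  proof (rule ccontr)
    assume "(\<Union>x\<in>closure F. \<Union>y\<in>rlat A B. {x + y}) \<noteq> UNIV"
    then have "- (\<Union>x\<in>closure F. \<Union>y\<in>rlat A B. {x + y}) \<noteq> {}" by blast
    from dense[OF open_Compl[OF cl] this] obtain y where y: "y \<notin> (\<Union>x\<in>closure F. \<Union>y\<in>rlat A B. {x + y})" "g y" by blast
    obtain v where v: "v \<in> rlat A B" "y + v \<in> F" using cover[OF y(2)] by blast
    have "y = (y + v) + - v" by simp
    moreover have "y + v \<in> closure F" using v(2) closure_subset by blast
    ultimately show False using y(1) rlat_minus[OF v(1)] by blast
  qed
  have disj: "interior (closure F) \<inter> interior ((\<lambda>p. p + v) ` closure F) = {}" if v: "v \<in> rlat A B" "v \<noteq> 0" for v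
  proof (rule ccontr)
    assume n: "interior (closure F) \<inter> interior ((\<lambda>p. p + v) ` closure F) \<noteq> {}"
    have "open (interior (closure F) \<inter> interior ((\<lambda>p. p + v) ` closure F))" by (intro open_Int open_interior)
    from dense[OF this n] obtain y where y: "g y" "y \<in> closure F" "y \<in> (\<lambda>p. p + v) ` closure F"
      using interior_subset by blast
    then obtain p where p: "p \<in> closure F" "y = p + v" by blast
    have "p = y + - v" using p(2) by simp
    then have "g p" using gtr[OF y(1) rlat_minus[OF v(1)]] by simp
    then have "p \<in> F" using loc p(1) by blast
    moreover have "p + v \<in> F" using loc[OF y(1,2)] p(2) by simp
    ultimately show False using uniq v by blast
  qed
  show ?thesis unfolding core_def
  proof (intro conjI allI impI ballI)
    show "\<exists>p\<in>closure F. \<exists>v\<in>rlat A B. z = p + v" for z using cov by blast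
  qed (use comp m disj in auto)
qed

context setting
begin

lemma matched_box: assumes "matched y (0, 0) (0, 0) i j p q"
  shows "i < 0" "0 \<le> j" "- R \<le> i" "j \<le> R" "p < 0" "0 \<le> q" "- R \<le> p" "q \<le> R"
    "Tv y i 0 < 0" "0 \<le> Tv y j 0" "Th y 0 p < 0" "0 \<le> Th y 0 q"
proof -
  have "j \<le> i + R" "q \<le> p + R"
    using consec_gap[OF win_AL[of y], of i j] consec_gap[OF win_AR[of y], of p q] assms unfolding matched_def cell_def by auto
  then show "i < 0" "0 \<le> j" "- R \<le> i" "j \<le> R" "p < 0" "0 \<le> q" "- R \<le> p" "q \<le> R"
    "Tv y i 0 < 0" "0 \<le> Tv y j 0" "Th y 0 p < 0" "0 \<le> Th y 0 q"
    using assms unfolding matched_def rho_def beta_def by auto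
qed

text \<open>A red point and a blue point are matched iff their difference lies in \<open>F0\<close>: a configuration puts the red point
  \<open>(0, 0)\<close> at \<open>z\<close> and the blue point \<open>(0, 0)\<close> at the origin.\<close>
definition F0 :: "conf set" where "F0 = {z. gen z \<and> Mt z (0, 0) (0, 0)}"

lemma F0_bounded: "bounded F0"
proof (rule bounded_subset)
  \<comment> \<open>As \<open>d\<close> is below 3 in absolute value, the offsets of the four sides
    are bounded by 5 on the relevant side, so 7 suffices; \<open>R + 1\<close> bounds the index of a
    side plus one half.\<close>
  let ?C = "7 * B + (of_int R + 1) * A"
  show "bounded (cbox (- ?C, - ?C) (?C, ?C))" by (rule bounded_cbox)
  show "F0 \<subseteq> cbox (- ?C, - ?C) (?C, ?C)"
  proof
    fix y assume "y \<in> F0"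
    then obtain i j p q where y: "gen y" and m: "matched y (0, 0) (0, 0) i j p q" unfolding F0_def Mt_def by blast
    note b = matched_box[OF m] and d = d_bound[OF gen_cov[OF y]]
    have TT: "of_int (Tv y i 0) \<le> (-1 :: real)" "of_int (Tv y j 0) \<ge> (0 :: real)"
      "of_int (Th y 0 p) \<le> (-1 :: real)" "of_int (Th y 0 q) \<ge> (0 :: real)" using b(9-12) by linarith+
    have l: "- 7 \<le> lin y i" "lin y j \<le> 7" "rw y p \<le> 7" "- 7 \<le> rw y q"
      using TT[unfolded Tv_val[OF y] Th_val[OF y]] d[of "(i, 0 - 1)" "(i, 0)"] d[of "(j, 0 - 1)" "(j, 0)"]
        d[of "(0 - 1, p)" "(0, p)"] d[of "(0 - 1, q)" "(0, q)"] by auto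
    have k: "(of_int x + 1 / 2) * A \<le> (of_int R + 1) * A" "- ((of_int R + 1) * A) \<le> (of_int x + 1 / 2) * A"
      if "- R \<le> x" "x \<le> R" for x
    proof -
      have "of_int x \<le> (of_int R :: real)" "- of_int R \<le> (of_int x :: real)" using that by linarith+
      then have "of_int x + 1 / 2 \<le> (of_int R + 1 :: real)" "- (of_int R + 1) \<le> (of_int x + 1 / 2 :: real)" by linarith+
      then show "(of_int x + 1 / 2) * A \<le> (of_int R + 1) * A" "- ((of_int R + 1) * A) \<le> (of_int x + 1 / 2) * A"
        using A0 mult_right_mono[of _ _ A] by (metis less_eq_real_def, metis less_eq_real_def mult_minus_left)
    qed
    have f: "fst y = lin y x * B + (of_int x + 1 / 2) * A" "snd y = rw y x * B - (of_int x + 1 / 2) * A" for x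
      unfolding lin_def rw_def using B0 by simp_all
    have "- 7 * B \<le> lin y i * B" "lin y j * B \<le> 7 * B" "rw y p * B \<le> 7 * B" "- 7 * B \<le> rw y q * B"
      using l B0 by (intro mult_right_mono; simp)+
    then have "- ?C \<le> fst y" "fst y \<le> ?C" "- ?C \<le> snd y" "snd y \<le> ?C"
      using f(1)[of i] f(1)[of j] f(2)[of p] f(2)[of q] k[of i] k[of j] k[of p] k[of q] b by linarith+
    then show "y \<in> cbox (- ?C, - ?C) (?C, ?C)" by (cases y) (simp add: cbox_Pair_eq)
  qed
qed

text \<open>By \<open>matched_box\<close> a cell that matches the two points with index
  \<open>(0, 0)\<close> has its sides within \<open>R\<close> of the origin. These finitely many
  locally constant data therefore decide membership in \<open>F0\<close>.\<close>

definition agree where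
  "agree y z \<longleftrightarrow> (\<forall>i\<in>{- R..R}. \<forall>q\<in>{- R..R}. AL z i = AL y i \<and> AR z i = AR y i \<and> Tv z i q = Tv y i q \<and> Th z i q = Th y i q
      \<and> sx z i q = sx y i q \<and> sy z i q = sy y i q)"

lemma Mt_agree: assumes a: "agree y z" and m: "Mt y (0, 0) (0, 0)" shows "Mt z (0, 0) (0, 0)"
proof -
  obtain i j p q where m: "matched y (0, 0) (0, 0) i j p q" using m unfolding Mt_def by blast
  note b = matched_box[OF m]
  have ag: "AL z i = AL y i" "AR z i = AR y i" "Tv z i q = Tv y i q" "Th z i q = Th y i q"
     "sx z i q = sx y i q" "sy z i q = sy y i q" if "- R \<le> i" "i \<le> R" "- R \<le> q" "q \<le> R" for i q
    using a that unfolding agree_def by auto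
  have "consec (AL z) i j \<longleftrightarrow> consec (AL y) i j" unfolding consec_def
    using ag(1)[of _ 0] b R0 by (smt (verit))
  moreover have "consec (AR z) p q \<longleftrightarrow> consec (AR y) p q" unfolding consec_def
    using ag(2)[of _ 0] b R0 by (smt (verit))
  moreover have "rho z i j p q = rho y i j p q" unfolding rho_def using ag(3) b by auto
  moreover have "beta z i j p q = beta y i j p q" unfolding beta_def using ag(4) b by auto
  moreover have "sx z i j = sx y i j" "sy z p q = sy y p q" using ag(5,6) b by auto
  ultimately have "matched z (0, 0) (0, 0) i j p q" using m unfolding matched_def cell_def by simp
  then show ?thesis unfolding Mt_def by blast
qed

lemma agree_local: assumes y: "gen y" shows "eventually (agree y) (at y within \<Omega>)"
  unfolding agree_def
proof (intro eventually_ball_finite ballI eventually_conj)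
  fix i q
  have f: "eventually (\<lambda>z. \<lfloor>lin z i + e\<rfloor> = \<lfloor>lin y i + e\<rfloor>) (at y within \<Omega>)" "eventually (\<lambda>z. \<lfloor>lin z i + - e\<rfloor> = \<lfloor>lin y i + - e\<rfloor>) (at y within \<Omega>)"
    "eventually (\<lambda>z. \<lfloor>rw z i + e\<rfloor> = \<lfloor>rw y i + e\<rfloor>) (at y within \<Omega>)" "eventually (\<lambda>z. \<lfloor>rw z i + - e\<rfloor> = \<lfloor>rw y i + - e\<rfloor>) (at y within \<Omega>)"
    "eventually (\<lambda>z. \<lfloor>lin z i + lin z q\<rfloor> = \<lfloor>lin y i + lin y q\<rfloor>) (at y within \<Omega>)"
    "eventually (\<lambda>z. \<lfloor>rw z i + rw z q\<rfloor> = \<lfloor>rw y i + rw y q\<rfloor>) (at y within \<Omega>)"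
    using Fam_local[OF y Fam_mem(1)] Fam_local[OF y Fam_mem(2)] Fam_local[OF y Fam_mem(3)] Fam_local[OF y Fam_mem(4)]
      Fam_local[OF y Fam_mem(5)] Fam_local[OF y Fam_mem(6)] by auto
  show "eventually (\<lambda>z. AL z i = AL y i) (at y within \<Omega>)"
    using f(1,2) by eventually_elim (simp add: act_def)
  show "eventually (\<lambda>z. AR z i = AR y i) (at y within \<Omega>)"
    using f(3,4) by eventually_elim (simp add: act_def)
  show "eventually (\<lambda>z. Tv z i q = Tv y i q) (at y within \<Omega>)" unfolding Tv_def by (rule D_local[OF y])
  show "eventually (\<lambda>z. Th z i q = Th y i q) (at y within \<Omega>)" unfolding Th_def by (rule D_local[OF y])
  show "eventually (\<lambda>z. sx z i q = sx y i q) (at y within \<Omega>)"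
    using f(5) by (rule eventually_mono) (simp add: sx_def)
  show "eventually (\<lambda>z. sy z i q = sy y i q) (at y within \<Omega>)"
    using f(6) by (rule eventually_mono) (simp add: sy_def)
qed auto

lemma F0_local: assumes y: "gen y" "y \<in> closure F0" shows "y \<in> F0"
proof (cases "y \<in> F0")
  case False
  obtain \<delta> where d: "\<delta> > 0" "\<And>z. gen z \<Longrightarrow> z \<noteq> y \<Longrightarrow> dist z y < \<delta> \<Longrightarrow> agree y z"
    using agree_local[OF y(1)] unfolding eventually_at by auto
  obtain z where z: "z \<in> F0" "dist z y < \<delta>" using y(2) d(1) unfolding closure_approachable by blast
  then have "gen z" "z \<noteq> y" using False unfolding F0_def by auto
  then have "agree y z" using d(2) z(2) by blast
  then have "agree z y" unfolding agree_def by auto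
  then have "Mt y (0, 0) (0, 0)" using Mt_agree z(1) unfolding F0_def by blast
  then show ?thesis using y(1) unfolding F0_def by simp
qed

lemma F0_translate: assumes y: "gen y"
  shows "y + (of_int i * A, of_int (i + 2 * k) * B) \<in> F0 \<longleftrightarrow> Mt y (0, 0) (- i, - k)"
proof -
  let ?z = "y + (of_int i * A, of_int (i + 2 * k) * B)"
  have z: "ph (trn A B i (i + 2 * k)) y = ?z" by (simp add: trn_def prod_eq_iff)
  have gz: "gen ?z" using gen_W[OF y trn_W[of i "i + 2 * k"]] z by simp
  have zy: "ph (trn A B (- i) (- i + 2 * - k)) ?z = y" by (simp add: trn_def prod_eq_iff algebra_simps)
  show ?thesis
  proof
    assume "?z \<in> F0"
    then have "Mt ?z (0, 0) (0, 0)" unfolding F0_def by simp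
    from Mt_trn[OF gz this, of "- i" "- k"] show "Mt y (0, 0) (- i, - k)" unfolding zy by simp
  next
    assume "Mt y (0, 0) (- i, - k)"
    from Mt_trn[OF y this, of i k] have "Mt ?z (0, 0) (0, 0)" unfolding z by simp
    then show "?z \<in> F0" using gz unfolding F0_def by simp
  qed
qed

lemma rlat_form: "v \<in> rlat A B \<Longrightarrow> \<exists>i k. v = (of_int i * A, of_int (i + 2 * k) * B)"
proof -
  assume "v \<in> rlat A B"
  then obtain i j where v: "v = (of_int i * A, of_int j * B)" "even (i + j)" unfolding rlat_def by blast
  then obtain k where "j = i + 2 * k" by (metis add.commute add_diff_cancel_left' dvdE even_diff diff_add_cancel)
  then show ?thesis using v(1) by blast
qed

lemma core_F0: "core A B (closure F0)"
proof (rule core_closure[OF A0 B0, where g = gen])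
  show "\<exists>y\<in>Z. gen y" if "open Z" "Z \<noteq> {}" for Z using gen_dense[OF that] .
  show "bounded F0" by (rule F0_bounded)
  show "(- x, y) \<in> F0" if "(x, y) \<in> F0" for x y
    using that Mt_mir[of "(x, y)" 0 0 0 0] gen_W[OF _ mir_W, of "(x, y)"] unfolding F0_def by (simp add: mir_def)
  show "(y, x) \<in> F0" if "(x, y) \<in> F0" for x y
    using that Mt_swp[of "(x, y)" 0 0 0 0] gen_W[OF _ swp_W, of "(x, y)"] unfolding F0_def by (simp add: swp_def)
  show "\<exists>v\<in>rlat A B. y + v \<in> F0" if y: "gen y" for y
  proof -
    obtain a b where "Mt y (0, 0) (a, b)" using Mt_ex1[OF y] by (metis surj_pair)
    then have "y + (of_int (- a) * A, of_int (- a + 2 * - b) * B) \<in> F0" using F0_translate[OF y, of "- a" "- b"] by simp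
    moreover have "(of_int (- a) * A, of_int (- a + 2 * - b) * B) \<in> rlat A B" unfolding rlat_def
      by (intro CollectI exI[of _ "- a"] exI[of _ "- a + 2 * - b"] conjI refl) simp
    ultimately show ?thesis by blast
  qed
  show "v = 0" if h: "y \<in> F0" "v \<in> rlat A B" "y + v \<in> F0" for y v
  proof -
    obtain i k where v: "v = (of_int i * A, of_int (i + 2 * k) * B)" using rlat_form[OF h(2)] by blast
    have y: "gen y" "Mt y (0, 0) (0, 0)" using h(1) unfolding F0_def by auto
    have "Mt y (0, 0) (- i, - k)" using F0_translate[OF y(1)] h(3) v by simp
    then have "(- i, - k) = (0, 0)" using Mt_ex1[OF y(1)] y(2) by blast
    then show ?thesis unfolding v by (simp add: zero_prod_def)
  qed
  show "y \<in> F0" if "gen y" "y \<in> closure F0" for y by (rule F0_local[OF that])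
  show "gen (y + v)" if h: "gen y" "v \<in> rlat A B" for y v
  proof -
    obtain i k where v: "v = (of_int i * A, of_int (i + 2 * k) * B)" using rlat_form[OF h(2)] by blast
    have "ph (trn A B i (i + 2 * k)) y = y + v" unfolding v by (simp add: trn_def prod_eq_iff)
    then show ?thesis using gen_W[OF h(1) trn_W[of i "i + 2 * k"]] by simp
  qed
qed

end

text \<open>Order of choices: \<open>N\<close> is the required distance of selected lines,
  \<open>e\<close> is small enough to enforce it, \<open>R\<close> bounds the gaps that this
  \<open>e\<close> leaves in either direction, and the hierarchy is built for this
  \<open>R\<close>.\<close>

lemma core_irrational: assumes "0 < A" "0 < B" "A / B \<notin> \<rat>" shows "\<exists>F. core A B F"
proof -
  interpret irrational_ratio A B by unfold_locales (use assms in auto)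
  define N where "N = nat \<lceil>14 * B / A\<rceil>"
  have "14 * B / A \<le> real N" unfolding N_def by linarith
  then have N: "14 * B \<le> A * of_int (int N)" using assms by (simp add: field_simps)
  obtain e where e: "e > 0" "\<And>k l. 0 < k \<Longrightarrow> k < int N \<Longrightarrow> 2 * e < \<bar>of_int k * (A / B) - of_int l\<bar>"
    using irrational_gap[OF assms(3), of N] by blast
  have irr2: "- (A / B) \<notin> \<rat>" using assms(3) by (metis Rats_minus_iff)
  obtain K where K: "K \<ge> 1" "\<And>t. \<exists>j l. 1 \<le> j \<and> j \<le> K \<and> t + of_int j * (A / B) - e < of_int l \<and> of_int l \<le> t + of_int j * (A / B) + e"
    using irrational_window[OF assms(3) e(1)] by blast
  obtain K' where K': "K' \<ge> 1" "\<And>t. \<exists>j l. 1 \<le> j \<and> j \<le> K' \<and> t + of_int j * - (A / B) - e < of_int l \<and> of_int l \<le> t + of_int j * - (A / B) + e"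
    using irrational_window[OF irr2 e(1)] by blast
  define R where "R = max K K'"
  have R: "0 \<le> R" "1 \<le> R" "K \<le> R" "K' \<le> R" using K(1) unfolding R_def by auto
  obtain T where T: "\<And>k. finite (cells (T k))"
    "\<And>y k k' w w'. k \<le> k' \<Longrightarrow> w \<in> W \<Longrightarrow> w' \<in> W \<Longrightarrow> cp (T k) w y \<Longrightarrow> cp (T k') w' y \<Longrightarrow> (k, w) \<noteq> (k', w') \<Longrightarrow>
      (k < k' \<and> nbd R (St (T k) w) \<subseteq> St (T k') w') \<or> nbd R (St (T k) w) \<inter> St (T k') w' = {}"
    "\<And>U. open U \<Longrightarrow> U \<noteq> {} \<Longrightarrow> \<exists>y\<in>U. \<exists>k w. copyof T y (0, 0) k w"
    using toast_exists[OF R(1)] by blast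
  interpret S: setting A B R T e "int N"
  proof
    show "\<exists>j l. 1 \<le> j \<and> j \<le> R \<and> t + of_int j * (A / B) - e < of_int l \<and> of_int l \<le> t + of_int j * (A / B) + e" for t
      using K(2)[of t] R(3) by (meson order_trans)
    show "\<exists>j l. 1 \<le> j \<and> j \<le> R \<and> t - of_int j * (A / B) - e < of_int l \<and> of_int l \<le> t - of_int j * (A / B) + e" for t
    proof -
      obtain j l where "1 \<le> j" "j \<le> K'" "t + of_int j * - (A / B) - e < of_int l" "of_int l \<le> t + of_int j * - (A / B) + e"
        using K'(2)[of t] by blast
      then show ?thesis using R(4) by (intro exI[of _ j] exI[of _ l]) simp
    qed
  qed (use R T e N in auto)
  show ?thesis using S.core_F0 by blast
qed

section \<open>Square-symmetric domains: rational ratio\<close>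

text \<open>For coprime \<open>P\<close>, \<open>Q\<close> this is a transversal of \<open>{(i P, j Q) | i + j even}\<close> and of \<open>{(j Q, i P) | i + j even}\<close>
  in the integer lattice at once.\<close>
definition transv :: "int \<Rightarrow> int \<Rightarrow> place set" where
  "transv P Q = (if even (P * Q) then {(k, k) | k. 0 \<le> k \<and> k < 2 * (P * Q)}
     else {(k + \<epsilon>, k) | k \<epsilon>. 0 \<le> k \<and> k < P * Q \<and> (\<epsilon> = 0 \<or> \<epsilon> = 1)})"

lemma finite_transv: "finite (transv P Q)"
proof -
  have "transv P Q \<subseteq> {0..2 * \<bar>P * Q\<bar>} \<times> {0..2 * \<bar>P * Q\<bar>}" unfolding transv_def by (auto split: if_splits)
  then show ?thesis by (rule finite_subset) simp
qed

lemma transv_commute: "transv P Q = transv Q P"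
  unfolding transv_def by (simp add: mult.commute)

lemma coprime_multiples:
  fixes P Q :: int
  assumes "coprime P Q" "0 < P" "0 < Q" "i * P = j * Q"
  obtains t where "i = Q * t" "j = P * t"
proof -
  have "Q dvd i * P" using assms(4) by simp
  then have "Q dvd i" using assms(1) by (simp add: coprime_commute coprime_dvd_mult_left_iff)
  then obtain t where t: "i = Q * t" by (elim dvdE)
  then have "j = P * t" using assms(3,4) by (simp add: algebra_simps)
  then show thesis using t that by blast
qed

text \<open>For equal \<open>\<epsilon>\<close> a coincidence changes \<open>k\<close> by
  \<open>P * Q * t\<close>. If \<open>P + Q\<close> is odd, the parity condition makes
  \<open>t\<close> even, so a range of length \<open>2 * P * Q\<close> is free of repetitions. If
  both are odd, the parity of the coordinate sum determines \<open>\<epsilon>\<close>, and the range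
  has length \<open>P * Q\<close>.\<close>

lemma transv_unique:
  fixes P Q :: int
  assumes c: "coprime P Q" "0 < P" "0 < Q"
    and 1: "even (i + j)" "(a + i * P, b + j * Q) \<in> transv P Q"
    and 2: "even (i' + j')" "(a + i' * P, b + j' * Q) \<in> transv P Q"
  shows "i = i' \<and> j = j'"
proof -
  have PQ: "0 < P * Q" using c by simp
  show ?thesis
  proof (cases "even (P * Q)")
    case True
    then have odd: "odd (P + Q)" using c(1) coprime_common_divisor[of P Q 2] by auto
    obtain k k' where k: "a + i * P = k" "b + j * Q = k" "0 \<le> k" "k < 2 * (P * Q)"
        "a + i' * P = k'" "b + j' * Q = k'" "0 \<le> k'" "k' < 2 * (P * Q)"
      using True 1(2) 2(2) unfolding transv_def by auto
    have "(i - i') * P = (j - j') * Q" using k by (simp add: algebra_simps)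
    then obtain t where t: "i - i' = Q * t" "j - j' = P * t" using coprime_multiples c by blast
    have "(i + j) - (i' + j') = (P + Q) * t" using t by (simp add: algebra_simps)
    moreover have "even ((i + j) - (i' + j'))" using 1(1) 2(1) by simp
    ultimately have "even ((P + Q) * t)" by simp
    then have et: "even t" using odd by simp
    have "k - k' = (i - i') * P" using k by (simp add: algebra_simps)
    then have kt: "k - k' = (P * Q) * t" unfolding t by (simp add: algebra_simps)
    have "t = 0"
    proof (rule ccontr)
      assume "t \<noteq> 0"
      then have "2 \<le> \<bar>t\<bar>" using et by (auto elim!: evenE)
      then have "(P * Q) * 2 \<le> \<bar>k - k'\<bar>" unfolding kt abs_mult[of "P * Q" t] abs_of_pos[OF PQ] using PQ by (intro mult_left_mono) simp_all
      then show False using k by linarith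
    qed
    then show ?thesis using t by simp
  next
    case False
    then have o: "odd P" "odd Q" by auto
    obtain k \<epsilon> where k: "a + i * P = k + \<epsilon>" "b + j * Q = k" "0 \<le> k" "k < P * Q" "\<epsilon> = 0 \<or> \<epsilon> = 1"
      using False 1(2) unfolding transv_def by auto
    obtain k' \<epsilon>' where k': "a + i' * P = k' + \<epsilon>'" "b + j' * Q = k'" "0 \<le> k'" "k' < P * Q" "\<epsilon>' = 0 \<or> \<epsilon>' = 1"
      using False 2(2) unfolding transv_def by auto
    have ev: "even (i * P + j * Q)" "even (i' * P + j' * Q)" using 1(1) 2(1) o by auto
    have "\<epsilon> + 2 * k = a + b + (i * P + j * Q)" "\<epsilon>' + 2 * k' = a + b + (i' * P + j' * Q)" using k k' by simp_all
    then have "even \<epsilon> \<longleftrightarrow> even \<epsilon>'" using ev by (metis even_add even_mult_iff even_numeral)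
    then have ee: "\<epsilon> = \<epsilon>'" using k(5) k'(5) by auto
    have "(i - i') * P = (j - j') * Q" using k k' ee by (simp add: algebra_simps)
    then obtain t where t: "i - i' = Q * t" "j - j' = P * t" using coprime_multiples c by blast
    have "k - k' = (i - i') * P" using k k' ee by (simp add: algebra_simps)
    then have kt: "k - k' = (P * Q) * t" unfolding t by (simp add: algebra_simps)
    have "t = 0"
    proof (rule ccontr)
      assume "t \<noteq> 0"
      then have "1 \<le> \<bar>t\<bar>" by simp
      then have "(P * Q) * 1 \<le> \<bar>k - k'\<bar>" unfolding kt abs_mult[of "P * Q" t] abs_of_pos[OF PQ] using PQ by (intro mult_left_mono) simp_all
      then show False using k k' by linarith
    qed
    then show ?thesis using t by simp
  qed
qed

text \<open>The Chinese remainder theorem yields \<open>k\<close> below \<open>P * Q\<close>. A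
  wrong parity is repaired by adding \<open>(Q, P)\<close> to \<open>(i, j)\<close> if
  \<open>P + Q\<close> is odd, and is avoided by the choice of \<open>\<epsilon>\<close> if both are
  odd.\<close>

lemma transv_ex:
  fixes P Q :: int
  assumes c: "coprime P Q" "0 < P" "0 < Q"
  shows "\<exists>i j. even (i + j) \<and> (a + i * P, b + j * Q) \<in> transv P Q"
proof -
  have PQ: "0 < P * Q" using c by simp
  have crt: "\<exists>k i j. 0 \<le> k \<and> k < P * Q \<and> k = a + i * P \<and> k = b + j * Q" for a b
  proof -
    obtain u v where uv: "u * P + v * Q = 1" using bezout_int[of P Q] c(1) by (metis coprime_iff_gcd_eq_1)
    define x where "x = a + (b - a) * u * P"
    let ?k = "x mod (P * Q)"
    have d: "?k = x - P * Q * (x div (P * Q))" by (simp add: minus_mult_div_eq_mod)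
    have xa: "x - a = P * ((b - a) * u)" unfolding x_def by simp
    have "x - b = (a - b) * (1 - u * P)" unfolding x_def by (simp add: algebra_simps)
    also have "\<dots> = Q * ((a - b) * v)" using uv by (simp add: algebra_simps flip: uv)
    finally have xb: "x - b = Q * ((a - b) * v)" .
    have "?k = a + ((b - a) * u - Q * (x div (P * Q))) * P" using d xa by (simp add: algebra_simps)
    moreover have "?k = b + ((a - b) * v - P * (x div (P * Q))) * Q" using d xb by (simp add: algebra_simps)
    moreover have "0 \<le> ?k" "?k < P * Q" using PQ by simp_all
    ultimately show ?thesis by blast
  qed
  show ?thesis
  proof (cases "even (P * Q)")
    case True
    then have odd: "odd (P + Q)" using c(1) coprime_common_divisor[of P Q 2] by auto
    obtain k i j where k: "0 \<le> k" "k < P * Q" "k = a + i * P" "k = b + j * Q" using crt by blast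
    have T: "transv P Q = {(k, k) | k. 0 \<le> k \<and> k < 2 * (P * Q)}" using True unfolding transv_def by simp
    show ?thesis
    proof (cases "even (i + j)")
      case True
      have "(a + i * P, b + j * Q) \<in> transv P Q" unfolding T using k by auto
      then show ?thesis using True by blast
    next
      case False
      have "a + (i + Q) * P = k + P * Q" "b + (j + P) * Q = k + P * Q" using k(3,4) by (simp_all add: algebra_simps)
      then have "(a + (i + Q) * P, b + (j + P) * Q) \<in> transv P Q" unfolding T using k(1,2) PQ by auto
      moreover have "even ((i + Q) + (j + P))" using False odd by auto
      ultimately show ?thesis by blast
    qed
  next
    case False
    define \<epsilon> where "\<epsilon> = (a + b) mod 2"
    have e: "\<epsilon> = 0 \<or> \<epsilon> = 1" "even (\<epsilon> - (a + b))" unfolding \<epsilon>_def by (auto simp: mod2_eq_if)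
    obtain k i j where k: "0 \<le> k" "k < P * Q" "k = a - \<epsilon> + i * P" "k = b + j * Q" using crt by blast
    have "(a + i * P, b + j * Q) = (k + \<epsilon>, k)" using k(3,4) by simp
    then have "(a + i * P, b + j * Q) \<in> transv P Q" unfolding transv_def using False k(1,2) e(1) by auto
    moreover have "even (i + j)"
    proof -
      have "i * P + j * Q = 2 * k + (\<epsilon> - (a + b))" using k(3,4) by linarith
      then have "even (i * P + j * Q)" using e(2) by simp
      then show ?thesis using False by simp
    qed
    ultimately show ?thesis by blast
  qed
qed

text \<open>\<open>nrm a b\<close> is the translation part of the element of the wallpaper group generated by the integer translations
  and the symmetries of the square that moves a generic point \<open>(a, b)\<close> into the triangle \<open>0 < y < x < 1/2\<close>.\<close>
definition rn :: "real \<Rightarrow> int" where "rn a = \<lfloor>a + 1 / 2\<rfloor>"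
definition sn :: "real \<Rightarrow> int" where "sn a = (if rn a \<le> \<lfloor>a\<rfloor> then 1 else - 1)"
text \<open>For the remainders \<open>x = a - rn a\<close> and \<open>z = b - rn b\<close> this says
  that \<open>x + z\<close> and \<open>x - z\<close> have the same sign, generically that |x| > |z|.
  Floors are used so that invariance under integer shifts and local constancy are immediate.\<close>

definition big :: "real \<Rightarrow> real \<Rightarrow> bool" where
  "big a b \<longleftrightarrow> (rn a + rn b \<le> \<lfloor>a + b\<rfloor> \<longleftrightarrow> rn a - rn b \<le> \<lfloor>a - b\<rfloor>)"
definition nrm :: "real \<Rightarrow> real \<Rightarrow> place" where
  "nrm a b = (if big a b then (sn a * rn a, sn b * rn b) else (sn b * rn b, sn a * rn a))"

definition generic :: "real \<Rightarrow> real \<Rightarrow> bool" where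
  "generic a b \<longleftrightarrow> a \<notin> \<int> \<and> b \<notin> \<int> \<and> a + 1 / 2 \<notin> \<int> \<and> b + 1 / 2 \<notin> \<int> \<and> a + b \<notin> \<int> \<and> a - b \<notin> \<int>"

lemma rn_minus: assumes "a + 1 / 2 \<notin> \<int>" shows "rn (- a) = - rn a"
proof -
  have "- a + 1 / 2 = - (a + 1 / 2) + of_int 1" by simp
  then have "\<lfloor>- a + 1 / 2\<rfloor> = \<lfloor>- (a + 1 / 2)\<rfloor> + 1" by (simp only: floor_add_int[symmetric])
  then show ?thesis unfolding rn_def floor_uminus[OF assms] by simp
qed

lemma sn_minus: "a \<notin> \<int> \<Longrightarrow> a + 1 / 2 \<notin> \<int> \<Longrightarrow> sn (- a) = - sn a"
  unfolding sn_def by (simp add: rn_minus floor_uminus)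

text \<open>The motion that takes a generic point into the triangle is unique, and composing it with
  a symmetry of the square about the origin changes only its linear part. Its translation part is
  thus a label invariant under these symmetries.\<close>

lemma nrm_minus: assumes "generic a b" shows "nrm (- a) b = nrm a b"
proof -
  note g = assms[unfolded generic_def]
  have "big (- a) b = big a b"
  proof -
    have "- a + b = - (a - b)" "- a - b = - (a + b)" by simp_all
    then have "\<lfloor>- a + b\<rfloor> = - \<lfloor>a - b\<rfloor> - 1" "\<lfloor>- a - b\<rfloor> = - \<lfloor>a + b\<rfloor> - 1"
      using g floor_uminus[of "a - b"] floor_uminus[of "a + b"] by simp_all
    then show ?thesis unfolding big_def using g rn_minus[of a] by auto
  qed
  then show ?thesis unfolding nrm_def using g by (simp add: rn_minus sn_minus)
qed

lemma nrm_swap: assumes "generic a b" shows "nrm b a = nrm a b"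
proof -
  note g = assms[unfolded generic_def]
  have "\<lfloor>b - a\<rfloor> = - \<lfloor>a - b\<rfloor> - 1" using g floor_uminus[of "a - b"] by simp
  then have "big b a \<longleftrightarrow> \<not> big a b" unfolding big_def by (auto simp: add.commute)
  then show ?thesis unfolding nrm_def by simp
qed

lemma shifts: "rn (a + of_int m) = rn a + m" "sn (a + of_int m) = sn a"
  "big (a + of_int m) (b + of_int n) = big a b"
proof -
  have r: "rn (a + of_int m) = rn a + m" for a m
  proof -
    have "a + of_int m + 1 / 2 = (a + 1 / 2) + of_int m" by simp
    then show ?thesis unfolding rn_def by (simp only: floor_add_int)
  qed
  then show "rn (a + of_int m) = rn a + m" .
  show "sn (a + of_int m) = sn a" unfolding sn_def r by simp
  have "a + of_int m + (b + of_int n) = (a + b) + of_int (m + n)" "a + of_int m - (b + of_int n) = (a - b) + of_int (m - n)" by simp_all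
  then have "\<lfloor>a + of_int m + (b + of_int n)\<rfloor> = \<lfloor>a + b\<rfloor> + (m + n)" "\<lfloor>a + of_int m - (b + of_int n)\<rfloor> = \<lfloor>a - b\<rfloor> + (m - n)"
    by (simp_all only: floor_add_int)
  then show "big (a + of_int m) (b + of_int n) = big a b" unfolding big_def r by auto
qed

lemma Ints_shift: "x + of_int m \<in> \<int> \<longleftrightarrow> (x :: real) \<in> \<int>"
  using Ints_diff[of "x + of_int m" "of_int m"] by (auto intro: Ints_add)

lemma generic_shift: assumes "generic a b" shows "generic (a + of_int m) (b + of_int n)"
proof -
  have "a + of_int m + 1 / 2 = (a + 1 / 2) + of_int m" "b + of_int n + 1 / 2 = (b + 1 / 2) + of_int n"
   "a + of_int m + (b + of_int n) = (a + b) + of_int (m + n)" "a + of_int m - (b + of_int n) = (a - b) + of_int (m - n)" by simp_all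
  then show ?thesis using assms unfolding generic_def by (simp only: Ints_shift) simp
qed

lemma generic_minus: assumes "generic a b" shows "generic (- a) b"
proof -
  have "- a + 1 / 2 = - (a + 1 / 2) + of_int 1" "- a + b = - (a - b)" "- a - b = - (a + b)" by simp_all
  then show ?thesis using assms unfolding generic_def by (simp only: Ints_shift minus_in_Ints_iff) simp
qed

lemma generic_swap: assumes "generic a b" shows "generic b a"
proof -
  have "b + a = a + b" "b - a = - (a - b)" by simp_all
  then show ?thesis using assms unfolding generic_def by (simp only: minus_in_Ints_iff) simp
qed

lemma sn_sq: "sn a * sn a = 1"
  by (simp add: sn_def)

text \<open>Moving the point by \<open>(i P, j Q)\<close> keeps the linear part and adds the same
  vector to the label, up to signs and possibly with coordinates exchanged. The exchange is the
  reason why \<open>transv\<close> has to serve both lattices.\<close>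

lemma nrm_transversal:
  fixes P Q :: int
  assumes c: "coprime P Q" "0 < P" "0 < Q"
  shows "\<exists>i j. even (i + j) \<and> nrm (a + of_int (i * P)) (b + of_int (j * Q)) \<in> transv P Q"
    and "nrm a b \<in> transv P Q \<Longrightarrow> even (i + j) \<Longrightarrow> nrm (a + of_int (i * P)) (b + of_int (j * Q)) \<in> transv P Q \<Longrightarrow> i = 0 \<and> j = 0"
proof -
  define x where "x = sn a * rn a"
  define z where "z = sn b * rn b"
  have n: "nrm (a + of_int (i * P)) (b + of_int (j * Q)) =
    (if big a b then (x + (sn a * i) * P, z + (sn b * j) * Q) else (z + (sn b * j) * Q, x + (sn a * i) * P))" for i j
    unfolding nrm_def shifts x_def z_def by (simp add: algebra_simps)
  have n0: "nrm a b = (if big a b then (x, z) else (z, x))" unfolding nrm_def x_def z_def by simp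
  have ev: "even (sn a * i + sn b * j) \<longleftrightarrow> even (i + j)" for i j unfolding sn_def by auto
  have c': "coprime Q P" using c(1) by (simp add: coprime_commute)
  have s: "sn t * (sn t * i) = i" for t i using sn_sq[of t] by (simp add: mult.assoc[symmetric])
  show "\<exists>i j. even (i + j) \<and> nrm (a + of_int (i * P)) (b + of_int (j * Q)) \<in> transv P Q"
  proof (cases "big a b")
    case True
    obtain i j where "even (i + j)" "(x + i * P, z + j * Q) \<in> transv P Q" using transv_ex[OF c] by blast
    then have "even (sn a * i + sn b * j)" "nrm (a + of_int ((sn a * i) * P)) (b + of_int ((sn b * j) * Q)) \<in> transv P Q"
      unfolding n ev using True by (simp_all only: s if_True)
    then show ?thesis by blast
  next
    case False
    obtain j i where "even (j + i)" "(z + j * Q, x + i * P) \<in> transv Q P" using transv_ex[OF c' c(3,2)] by blast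
    then have "even (sn a * i + sn b * j)" "nrm (a + of_int ((sn a * i) * P)) (b + of_int ((sn b * j) * Q)) \<in> transv P Q"
      unfolding n ev transv_commute[of P Q] using False by (simp_all only: s if_False add.commute)
    then show ?thesis by blast
  qed
  show "i = 0 \<and> j = 0" if h: "nrm a b \<in> transv P Q" "even (i + j)" "nrm (a + of_int (i * P)) (b + of_int (j * Q)) \<in> transv P Q"
  proof -
    have "sn a * i = 0 \<and> sn b * j = 0"
    proof (cases "big a b")
      case True
      show ?thesis using transv_unique[OF c, of "sn a * i" "sn b * j" x z 0 0] h True unfolding n n0 ev by simp
    next
      case False
      show ?thesis using transv_unique[OF c' c(3,2), of "sn b * j" "sn a * i" z x 0 0] h False
        unfolding n n0 transv_commute[of P Q] using ev[of i j] by (simp add: add.commute)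
    qed
    then show ?thesis using sn_sq[of a] sn_sq[of b] by (metis mult_eq_0_iff zero_neq_one)
  qed
qed

lemma core_rational:
  assumes AB: "0 < A" "0 < B" and r: "A / B \<in> \<rat>"
  shows "\<exists>F. core A B F"
proof -
  obtain m n :: nat where mn: "n \<noteq> 0" "\<bar>A / B\<bar> = real m / real n" "coprime m n"
    using Rats_abs_nat_div_natE[OF r] by blast
  define P where "P = int m"
  define Q where "Q = int n"
  \<comment> \<open>The mesh of the square grid: \<open>A = P g\<close> and
    \<open>B = Q g\<close>.\<close>
  define g where "g = B / of_int Q"
  have Q: "0 < Q" using mn(1) unfolding Q_def by simp
  have g: "0 < g" using AB Q unfolding g_def by simp
  have Bg: "B = of_int Q * g" using Q unfolding g_def by simp
  have "A / B = of_int P / of_int Q" using mn(2) AB unfolding P_def Q_def by simp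
  then have "A = (of_int P / of_int Q) * B" using AB by (simp add: divide_eq_eq)
  then have Ag: "A = of_int P * g" unfolding g_def by simp
  have P: "0 < P" using AB(1) g unfolding Ag by (simp add: zero_less_mult_iff)
  have c: "coprime P Q" using mn(3) unfolding P_def Q_def by simp
  define ge where "ge = (\<lambda>y :: conf. generic (fst y / g) (snd y / g))"
  define N where "N = (\<lambda>y :: conf. nrm (fst y / g) (snd y / g))"
  define F where "F = {y. ge y \<and> N y \<in> transv P Q}"
  define Fs where "Fs = {\<lambda>y::conf. fst y / g, \<lambda>y. snd y / g, \<lambda>y. fst y / g + 1 / 2, \<lambda>y. snd y / g + 1 / 2,
     \<lambda>y. fst y / g + snd y / g, \<lambda>y. fst y / g - snd y / g}"
  have ge: "ge y \<longleftrightarrow> (\<forall>f\<in>Fs. f y \<notin> \<int>)" for y unfolding ge_def Fs_def generic_def by simp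
  have aff: "affine_fun f" if "f \<in> Fs" for f
  proof -
    have "\<exists>a b c. \<forall>y. f y = a * fst y + b * snd y + c"
      using that unfolding Fs_def
    proof (elim insertE)
      show "f = (\<lambda>y. fst y / g) \<Longrightarrow> ?thesis" by (intro exI[of _ "1 / g"] exI[of _ 0]) simp
      show "f = (\<lambda>y. snd y / g) \<Longrightarrow> ?thesis" by (rule exI[of _ 0], rule exI[of _ "1 / g"], rule exI[of _ 0]) simp
      show "f = (\<lambda>y. fst y / g + 1 / 2) \<Longrightarrow> ?thesis" by (rule exI[of _ "1 / g"], rule exI[of _ 0], rule exI[of _ "1 / 2"]) simp
      show "f = (\<lambda>y. snd y / g + 1 / 2) \<Longrightarrow> ?thesis" by (rule exI[of _ 0], rule exI[of _ "1 / g"], rule exI[of _ "1 / 2"]) simp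
      show "f = (\<lambda>y. fst y / g + snd y / g) \<Longrightarrow> ?thesis" by (rule exI[of _ "1 / g"], rule exI[of _ "1 / g"], rule exI[of _ 0]) simp
      show "f = (\<lambda>y. fst y / g - snd y / g) \<Longrightarrow> ?thesis" by (rule exI[of _ "1 / g"], rule exI[of _ "- 1 / g"], rule exI[of _ 0]) simp
    qed simp
    then show ?thesis unfolding affine_fun_def .
  qed
  have ncon: "\<not> (\<exists>c. \<forall>y. f y = c)" if "f \<in> Fs" for f
  proof -
    have "f (g, 0) \<noteq> f (0, 0) \<or> f (0, g) \<noteq> f (0, 0)" using that g unfolding Fs_def by auto
    then show ?thesis by metis
  qed
  have tr: "ge (y + (of_int i * A, of_int j * B)) = generic (fst y / g + of_int (i * P)) (snd y / g + of_int (j * Q))"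
    "N (y + (of_int i * A, of_int j * B)) = nrm (fst y / g + of_int (i * P)) (snd y / g + of_int (j * Q))" for y i j
    unfolding ge_def N_def Ag Bg using g by (simp_all add: add_divide_distrib)
  have "core A B (closure F)"
  proof (rule core_closure[OF AB, where g = ge])
    show "\<exists>y\<in>Z. ge y" if Z: "open Z" "Z \<noteq> {}" for Z
    proof -
      have "negligible {y. f y \<in> \<int>}" if "f \<in> Fs" for f
        by (rule affine_Ints_negligible[OF aff[OF that] ncon[OF that]])
      then have "negligible (\<Union>f\<in>Fs. {y. f y \<in> \<int>})" by (intro negligible_Union) (auto simp: Fs_def)
      then have "\<not> Z \<subseteq> (\<Union>f\<in>Fs. {y. f y \<in> \<int>})" using open_not_negligible[OF Z] negligible_subset by blast
      then show ?thesis unfolding ge by blast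
    qed
    show "bounded F"
    proof (rule bounded_subset)
      define K where "K = Max (insert 0 ((\<lambda>z. max \<bar>fst z\<bar> \<bar>snd z\<bar>) ` transv P Q))"
      have K: "\<bar>fst z\<bar> \<le> K \<and> \<bar>snd z\<bar> \<le> K" if "z \<in> transv P Q" for z
      proof -
        have "max \<bar>fst z\<bar> \<bar>snd z\<bar> \<le> K" unfolding K_def by (rule Max_ge) (use that finite_transv in auto)
        then show ?thesis by simp
      qed
      let ?C = "(of_int K + 1) * g"
      show "bounded (cbox (- ?C, - ?C) (?C, ?C))" by (rule bounded_cbox)
      show "F \<subseteq> cbox (- ?C, - ?C) (?C, ?C)"
      proof
        fix y assume "y \<in> F"
        then have "\<bar>fst (N y)\<bar> \<le> K" "\<bar>snd (N y)\<bar> \<le> K" using K unfolding F_def by auto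
        then have "\<bar>rn (fst y / g)\<bar> \<le> K" "\<bar>rn (snd y / g)\<bar> \<le> K"
          unfolding N_def nrm_def by (auto split: if_splits simp: abs_mult sn_def)
        then have "\<bar>fst y / g\<bar> \<le> of_int K + 1" "\<bar>snd y / g\<bar> \<le> of_int K + 1" unfolding rn_def by linarith+
        then have "\<bar>fst y\<bar> \<le> ?C" "\<bar>snd y\<bar> \<le> ?C" using g by (simp_all add: divide_le_eq)
        then show "y \<in> cbox (- ?C, - ?C) (?C, ?C)" by (cases y) (simp add: cbox_Pair_eq abs_le_iff)
      qed
    qed
    show "(- x, y) \<in> F" if "(x, y) \<in> F" for x y
      using that nrm_minus generic_minus unfolding F_def ge_def N_def by auto
    show "(y, x) \<in> F" if "(x, y) \<in> F" for x y
      using that nrm_swap generic_swap unfolding F_def ge_def N_def by auto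
    show gt: "ge (y + v)" if h: "ge y" "v \<in> rlat A B" for y v
    proof -
      obtain i j where "v = (of_int i * A, of_int j * B)" using h(2) unfolding rlat_def by blast
      moreover have "ge (y + (of_int i * A, of_int j * B))" for i j
        unfolding tr(1) by (rule generic_shift) (use h(1) in \<open>simp add: ge_def\<close>)
      ultimately show ?thesis by blast
    qed
    show "\<exists>v\<in>rlat A B. y + v \<in> F" if y: "ge y" for y
    proof -
      obtain i j where ij: "even (i + j)" "nrm (fst y / g + of_int (i * P)) (snd y / g + of_int (j * Q)) \<in> transv P Q"
        using nrm_transversal(1)[OF c P Q] by blast
      have v: "(of_int i * A, of_int j * B) \<in> rlat A B" using ij(1) unfolding rlat_def by blast
      have "y + (of_int i * A, of_int j * B) \<in> F" using gt[OF y v] ij(2) unfolding F_def tr(2)[symmetric] by simp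
      then show ?thesis using v by blast
    qed
    show "v = 0" if h: "y \<in> F" "v \<in> rlat A B" "y + v \<in> F" for y v
    proof -
      obtain i j where v: "v = (of_int i * A, of_int j * B)" "even (i + j)" using h(2) unfolding rlat_def by blast
      have "nrm (fst y / g) (snd y / g) \<in> transv P Q" using h(1) unfolding F_def N_def by simp
      moreover have "nrm (fst y / g + of_int (i * P)) (snd y / g + of_int (j * Q)) \<in> transv P Q"
        using h(3) unfolding F_def v(1) tr(2)[symmetric] by simp
      ultimately have "i = 0 \<and> j = 0" using nrm_transversal(2)[OF c P Q _ v(2)] by blast
      then show ?thesis unfolding v(1) by (simp add: zero_prod_def)
    qed
    show "y \<in> F" if y: "ge y" "y \<in> closure F" for y
    proof -
      have "eventually (\<lambda>z. \<forall>f\<in>Fs. \<lfloor>f z\<rfloor> = \<lfloor>f y\<rfloor>) (nhds y)"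
      proof (rule eventually_ball_finite)
        show "finite Fs" unfolding Fs_def by simp
        show "\<forall>f\<in>Fs. eventually (\<lambda>z. \<lfloor>f z\<rfloor> = \<lfloor>f y\<rfloor>) (nhds y)"
          using floor_LC_eventually[OF affine_fun_cont[OF aff]] y(1) unfolding ge by blast
      qed
      then obtain d where d: "d > 0" "\<And>z. dist z y < d \<Longrightarrow> \<forall>f\<in>Fs. \<lfloor>f z\<rfloor> = \<lfloor>f y\<rfloor>"
        unfolding eventually_nhds_metric by blast
      obtain z where z: "z \<in> F" "dist z y < d" using y(2) d(1) unfolding closure_approachable by blast
      \<comment> \<open>The label is a function of the floors of the functions in \<open>Fs\<close>
        only.\<close>
      have "N z = N y" using d(2)[OF z(2)] unfolding Fs_def N_def nrm_def big_def sn_def rn_def by simp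
      then show ?thesis using z(1) y(1) unfolding F_def by simp
    qed
  qed
  then show ?thesis by blast
qed

lemma core_exists: "0 < A \<Longrightarrow> 0 < B \<Longrightarrow> \<exists>F. core A B F"
  using core_rational core_irrational by blast

section \<open>Symmetries of a frame\<close>

lemma group_Sym_group: "group (Sym_group Y)"
proof (rule groupI)
  show "x \<otimes>\<^bsub>Sym_group Y\<^esub> y \<in> carrier (Sym_group Y)" if "x \<in> carrier (Sym_group Y)" "y \<in> carrier (Sym_group Y)" for x y
  proof -
    have h: "\<And>u v. dist (x u) (x v) = dist u v" "surj x" "x ` Y = Y" "\<And>u v. dist (y u) (y v) = dist u v" "surj y" "y ` Y = Y"
      using that unfolding Sym_group_def Symm_def plane_isometry_def by auto
    have "surj (x \<circ> y)" by (rule comp_surj[OF h(5,2)])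
    moreover have "(x \<circ> y) ` Y = Y" using h(3,6) by (metis image_comp)
    ultimately show ?thesis using h(1,4) unfolding Sym_group_def Symm_def plane_isometry_def by simp
  qed
  show "\<one>\<^bsub>Sym_group Y\<^esub> \<in> carrier (Sym_group Y)"
    unfolding Sym_group_def Symm_def plane_isometry_def by simp
  show "\<exists>y\<in>carrier (Sym_group Y). y \<otimes>\<^bsub>Sym_group Y\<^esub> x = \<one>\<^bsub>Sym_group Y\<^esub>" if x: "x \<in> carrier (Sym_group Y)" for x
  proof -
    have x': "\<And>u v. dist (x u) (x v) = dist u v" "surj x" "x ` Y = Y"
      using x unfolding Sym_group_def Symm_def plane_isometry_def by auto
    have inj: "inj x" by (rule injI) (metis x'(1) dist_eq_0_iff)
    have "dist (inv_into UNIV x u) (inv_into UNIV x v) = dist u v" for u v using x'(1)[of "inv_into UNIV x u" "inv_into UNIV x v"] surj_f_inv_f[OF x'(2)] by simp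
    moreover have "surj (inv_into UNIV x)" by (rule inj_imp_surj_inv[OF inj])
    moreover have "inv_into UNIV x ` Y = Y" using x'(3) inj by (metis image_inv_f_f)
    moreover have "inv_into UNIV x \<circ> x = id" using inj by simp
    ultimately show ?thesis unfolding Sym_group_def Symm_def plane_isometry_def
      by (intro bexI[of _ "inv_into UNIV x"]) auto
  qed
qed (auto simp: Sym_group_def comp_assoc)

lemma inner_parallelogram: "(p - q) \<bullet> (p - q) + (p + q) \<bullet> (p + q) = 2 * (p \<bullet> p) + 2 * (q \<bullet> (q :: 'a :: real_inner))"
  by (simp add: inner_add inner_diff inner_commute)

lemma double_sum: "x + y + (x - y) = x + (x :: 'a :: ab_group_add)"
  by (simp add: algebra_simps)

text \<open>Cosine and sine of the \<open>k\<close>-th quarter turn, and the sign of a reflection: \<open>(k, b)\<close> in \<open>D4\<close> will act as the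
  \<open>b\<close>-th power of the reflection in the first axis followed by \<open>k\<close> quarter turns.\<close>
definition c4 :: "int \<Rightarrow> real" where "c4 k = (if k = 0 then 1 else if k = 2 then - 1 else 0)"
definition s4 :: "int \<Rightarrow> real" where "s4 k = (if k = 1 then 1 else if k = 3 then - 1 else 0)"
definition m4 :: "int \<Rightarrow> real" where "m4 b = (if b = 0 then 1 else - 1)"

abbreviation dih :: "(int \<times> int) set" where "dih \<equiv> {0..3} \<times> {0..1}"

lemma dih_cases:
  assumes "x \<in> dih"
  shows "x = (0, 0) \<or> x = (1, 0) \<or> x = (2, 0) \<or> x = (3, 0) \<or> x = (0, 1) \<or> x = (1, 1) \<or> x = (2, 1) \<or> x = (3, 1)"
proof -
  obtain k b where "x = (k, b)" "0 \<le> k" "k \<le> 3" "0 \<le> b" "b \<le> 1" using assms by auto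
  then show ?thesis by simp presburger
qed

text \<open>These are the addition theorems; a reflection in the left factor reverses the turn of
  the right one, which is the twist in the multiplication of \<open>D4\<close>.\<close>

lemma D4_coeffs:
  assumes "x \<in> dih" "y \<in> dih"
  shows "c4 (fst (x \<otimes>\<^bsub>D4\<^esub> y)) = c4 (fst x) * c4 (fst y) - s4 (fst x) * m4 (snd x) * s4 (fst y)"
    "s4 (fst (x \<otimes>\<^bsub>D4\<^esub> y)) = s4 (fst x) * c4 (fst y) + c4 (fst x) * m4 (snd x) * s4 (fst y)"
    "m4 (snd (x \<otimes>\<^bsub>D4\<^esub> y)) = m4 (snd x) * m4 (snd y)"
proof -
  obtain a b where x: "x = (a, b)" "a = 0 \<or> a = 1 \<or> a = 2 \<or> a = 3" "b = 0 \<or> b = 1" using dih_cases[OF assms(1)] by fastforce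
  obtain c d where y: "y = (c, d)" "c = 0 \<or> c = 1 \<or> c = 2 \<or> c = 3" "d = 0 \<or> d = 1" using dih_cases[OF assms(2)] by fastforce
  have m: "(a, b) \<otimes>\<^bsub>D4\<^esub> (c, d) = ((a + (- 1) ^ nat b * c) mod 4, (b + d) mod 2)" by (simp add: D4_def)
  show "m4 (snd (x \<otimes>\<^bsub>D4\<^esub> y)) = m4 (snd x) * m4 (snd y)"
    unfolding m x(1) y(1) snd_conv using x(3) y(3) by (elim disjE; simp add: m4_def)
  show "c4 (fst (x \<otimes>\<^bsub>D4\<^esub> y)) = c4 (fst x) * c4 (fst y) - s4 (fst x) * m4 (snd x) * s4 (fst y)"
    unfolding m x(1) y(1) fst_conv snd_conv using x(2,3) y(2) by (elim disjE; simp add: c4_def s4_def m4_def)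
  show "s4 (fst (x \<otimes>\<^bsub>D4\<^esub> y)) = s4 (fst x) * c4 (fst y) + c4 (fst x) * m4 (snd x) * s4 (fst y)"
    unfolding m x(1) y(1) fst_conv snd_conv using x(2,3) y(2) by (elim disjE; simp add: c4_def s4_def m4_def)
qed

lemma m4_sq: "m4 b * m4 b = 1" "m4 b * (m4 b * t) = t"
  by (simp_all add: m4_def)

locale frame =
  fixes e1 e2 :: "real^2"
  assumes n1: "e1 \<bullet> e1 = 1" and n2: "e2 \<bullet> e2 = 1" and orth: "e1 \<bullet> e2 = 0"
begin

lemma orth': "e2 \<bullet> e1 = 0" using orth by (simp add: inner_commute)

lemmas ip = n1 n2 orth orth'

lemma decomp: "v = (v \<bullet> e1) *\<^sub>R e1 + (v \<bullet> e2) *\<^sub>R e2"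
proof -
  have ne: "e1 \<noteq> e2" using n1 orth by auto
  have "independent {e1, e2}"
  proof (rule pairwise_orthogonal_independent)
    show "pairwise orthogonal {e1, e2}" using orth orth' by (simp add: pairwise_insert orthogonal_def)
    show "0 \<notin> {e1, e2}" using n1 n2 by auto
  qed
  then have "UNIV \<subseteq> span {e1, e2}" using ne by (intro card_ge_dim_independent) auto
  then have "v \<in> span {e1, e2}" by blast
  then obtain a b where v: "v = a *\<^sub>R e1 + b *\<^sub>R e2"
    by (auto simp: span_insert span_singleton algebra_simps)
  then have "v \<bullet> e1 = a" "v \<bullet> e2 = b" using ip by (simp_all add: inner_add_left)
  then show ?thesis using v by simp
qed

lemma frame_eqI: "v \<bullet> e1 = w \<bullet> e1 \<Longrightarrow> v \<bullet> e2 = w \<bullet> e2 \<Longrightarrow> v = w"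
  using decomp[of v] decomp[of w] by simp

lemma inner_frame: "v \<bullet> w = (v \<bullet> e1) * (w \<bullet> e1) + (v \<bullet> e2) * (w \<bullet> e2)"
proof -
  have "v \<bullet> w = v \<bullet> ((w \<bullet> e1) *\<^sub>R e1 + (w \<bullet> e2) *\<^sub>R e2)" using decomp[of w] by simp
  then show ?thesis by (simp add: inner_add_right mult.commute)
qed

definition phi :: "int \<times> int \<Rightarrow> real^2 \<Rightarrow> real^2" where
  "phi x v = (c4 (fst x) * (v \<bullet> e1) - s4 (fst x) * m4 (snd x) * (v \<bullet> e2)) *\<^sub>R e1
     + (s4 (fst x) * (v \<bullet> e1) + c4 (fst x) * m4 (snd x) * (v \<bullet> e2)) *\<^sub>R e2"

lemma phi_coord: "phi x v \<bullet> e1 = c4 (fst x) * (v \<bullet> e1) - s4 (fst x) * m4 (snd x) * (v \<bullet> e2)"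
  "phi x v \<bullet> e2 = s4 (fst x) * (v \<bullet> e1) + c4 (fst x) * m4 (snd x) * (v \<bullet> e2)"
  unfolding phi_def using ip by (simp_all add: inner_add_left)

lemma phi_one: "phi (0, 0) = id"
proof
  fix v show "phi (0, 0) v = id v" by (rule frame_eqI) (simp_all add: phi_coord c4_def s4_def m4_def)
qed

lemma phi_mult: assumes "x \<in> dih" "y \<in> dih" shows "phi x \<circ> phi y = phi (x \<otimes>\<^bsub>D4\<^esub> y)"
proof
  fix v
  show "(phi x \<circ> phi y) v = phi (x \<otimes>\<^bsub>D4\<^esub> y) v"
    by (rule frame_eqI) (simp_all add: phi_coord D4_coeffs[OF assms] algebra_simps m4_sq)
qed

lemma D4_mult_closed: "x \<in> dih \<Longrightarrow> y \<in> dih \<Longrightarrow> x \<otimes>\<^bsub>D4\<^esub> y \<in> dih"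
  unfolding D4_def by (cases x; cases y) auto

lemma phi_inverse: assumes "x \<in> dih" shows "\<exists>y\<in>dih. phi x \<circ> phi y = id \<and> phi y \<circ> phi x = id"
proof -
  define y where "y = (if snd x = 0 then ((- fst x) mod 4, 0) else x)"
  have y: "y \<in> dih" using assms unfolding y_def by auto
  have "x \<otimes>\<^bsub>D4\<^esub> y = (0, 0)" "y \<otimes>\<^bsub>D4\<^esub> x = (0, 0)"
    using dih_cases[OF assms] unfolding y_def D4_def by (elim disjE; simp)+
  then have "phi x \<circ> phi y = id" "phi y \<circ> phi x = id" using phi_mult assms y phi_one by simp_all
  then show ?thesis using y by blast
qed

lemma phi_isometry: assumes x: "x \<in> dih" shows "plane_isometry (phi x)"
  unfolding plane_isometry_def
proof (intro conjI allI)
  fix v w :: "real^2"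
  let ?u = "v - w"
  have d: "phi x v - phi x w = phi x ?u"
    by (rule frame_eqI) (simp_all add: phi_coord inner_diff_left algebra_simps)
  have "phi x ?u \<bullet> phi x ?u = ?u \<bullet> ?u"
    unfolding inner_frame[of "phi x ?u" "phi x ?u"] inner_frame[of ?u ?u] phi_coord
    using dih_cases[OF x] by (elim disjE; simp add: c4_def s4_def m4_def)
  then show "dist (phi x v) (phi x w) = dist v w" unfolding dist_norm d norm_eq_sqrt_inner by simp
next
  obtain y where "phi x \<circ> phi y = id" using phi_inverse[OF x] by blast
  then show "surj (phi x)" by (metis surj_id surj_def comp_apply id_apply)
qed

lemma phi_Symm: assumes Y: "\<And>x. x \<in> dih \<Longrightarrow> phi x ` Y \<subseteq> Y" and x: "x \<in> dih" shows "phi x ` Y = Y"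
proof
  obtain y where y: "y \<in> dih" "phi x \<circ> phi y = id" using phi_inverse[OF x] by blast
  show "Y \<subseteq> phi x ` Y"
  proof
    fix v assume "v \<in> Y"
    then have "phi y v \<in> Y" using Y[OF y(1)] by blast
    moreover have "v = phi x (phi y v)" using y(2) by (metis comp_apply id_apply)
    ultimately show "v \<in> phi x ` Y" by blast
  qed
qed (rule Y[OF x])

lemma linear_phiI:
  assumes f: "linear f" "f e1 = phi x e1" "f e2 = phi x e2" shows "f = phi x"
proof
  fix v
  have "f v = (v \<bullet> e1) *\<^sub>R f e1 + (v \<bullet> e2) *\<^sub>R f e2"
    using decomp[of v] f(1) by (metis linear_add linear_scale)
  then show "f v = phi x v" unfolding f(2,3)
    by (intro frame_eqI) (simp_all add: inner_add_left phi_coord ip algebra_simps)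
qed

lemma phi_e: "phi x e1 = c4 (fst x) *\<^sub>R e1 + s4 (fst x) *\<^sub>R e2"
  "phi x e2 = (- s4 (fst x) * m4 (snd x)) *\<^sub>R e1 + (c4 (fst x) * m4 (snd x)) *\<^sub>R e2"
  by (rule frame_eqI; simp add: phi_coord inner_add_left inner_diff_left ip)+

lemma phi_inj: "inj_on phi dih"
proof (rule inj_onI)
  fix x y assume h: "x \<in> dih" "y \<in> dih" "phi x = phi y"
  have "phi x e1 \<bullet> e1 = phi y e1 \<bullet> e1" "phi x e1 \<bullet> e2 = phi y e1 \<bullet> e2"
    "phi x e2 \<bullet> e1 = phi y e2 \<bullet> e1" "phi x e2 \<bullet> e2 = phi y e2 \<bullet> e2" using h(3) by simp_all
  then have "c4 (fst x) = c4 (fst y)" "s4 (fst x) = s4 (fst y)" "s4 (fst x) * m4 (snd x) = s4 (fst y) * m4 (snd y)"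
    "c4 (fst x) * m4 (snd x) = c4 (fst y) * m4 (snd y)" unfolding phi_coord ip by simp_all
  then show "x = y" using dih_cases[OF h(1)] dih_cases[OF h(2)]
    by (elim disjE; simp add: c4_def s4_def m4_def)
qed

lemma orthogonal_axis:
  assumes f: "orthogonal_transformation f"
    and 1: "f e1 = e1 \<or> f e1 = - e1 \<or> f e1 = e2 \<or> f e1 = - e2"
    and 2: "f e2 = e1 \<or> f e2 = - e1 \<or> f e2 = e2 \<or> f e2 = - e2"
  shows "f \<in> phi ` dih"
proof -
  have l: "linear f" and o: "f e1 \<bullet> f e2 = 0" using f orth unfolding orthogonal_transformation_def by auto
  have *: "f \<in> phi ` dih" if "x \<in> dih" "f e1 = c4 (fst x) *\<^sub>R e1 + s4 (fst x) *\<^sub>R e2"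
    "f e2 = (- s4 (fst x) * m4 (snd x)) *\<^sub>R e1 + (c4 (fst x) * m4 (snd x)) *\<^sub>R e2" for x
    using linear_phiI[OF l, of x] that unfolding phi_e by blast
  note v = c4_def s4_def m4_def
  have h0: "f e1 = e1 \<Longrightarrow> f e2 = e2 \<Longrightarrow> f \<in> phi ` dih" by (rule *[of "(0, 0)"]) (simp_all add: v)
  have h1: "f e1 = e2 \<Longrightarrow> f e2 = - e1 \<Longrightarrow> f \<in> phi ` dih" by (rule *[of "(1, 0)"]) (simp_all add: v)
  have h2: "f e1 = - e1 \<Longrightarrow> f e2 = - e2 \<Longrightarrow> f \<in> phi ` dih" by (rule *[of "(2, 0)"]) (simp_all add: v)
  have h3: "f e1 = - e2 \<Longrightarrow> f e2 = e1 \<Longrightarrow> f \<in> phi ` dih" by (rule *[of "(3, 0)"]) (simp_all add: v)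
  have h4: "f e1 = e1 \<Longrightarrow> f e2 = - e2 \<Longrightarrow> f \<in> phi ` dih" by (rule *[of "(0, 1)"]) (simp_all add: v)
  have h5: "f e1 = e2 \<Longrightarrow> f e2 = e1 \<Longrightarrow> f \<in> phi ` dih" by (rule *[of "(1, 1)"]) (simp_all add: v)
  have h6: "f e1 = - e1 \<Longrightarrow> f e2 = e2 \<Longrightarrow> f \<in> phi ` dih" by (rule *[of "(2, 1)"]) (simp_all add: v)
  have h7: "f e1 = - e2 \<Longrightarrow> f e2 = - e1 \<Longrightarrow> f \<in> phi ` dih" by (rule *[of "(3, 1)"]) (simp_all add: v)
  from 1 show ?thesis
  proof (elim disjE)
    assume a: "f e1 = e1"
    then have "f e2 = e2 \<or> f e2 = - e2" using 2 o ip by auto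
    then show ?thesis using a h0 h4 by blast
  next
    assume a: "f e1 = - e1"
    then have "f e2 = e2 \<or> f e2 = - e2" using 2 o ip by auto
    then show ?thesis using a h2 h6 by blast
  next
    assume a: "f e1 = e2"
    then have "f e2 = e1 \<or> f e2 = - e1" using 2 o ip by auto
    then show ?thesis using a h1 h5 by blast
  next
    assume a: "f e1 = - e2"
    then have "f e2 = e1 \<or> f e2 = - e1" using 2 o ip by auto
    then show ?thesis using a h3 h7 by blast
  qed
qed

section \<open>The rhombic lattice in a frame and its short vectors\<close>

definition lat :: "real \<Rightarrow> real \<Rightarrow> (real^2) set" where
  "lat A B = {v. (v \<bullet> e1, v \<bullet> e2) \<in> rlat A B}"

lemma lat_mem: "v \<in> lat A B \<longleftrightarrow> (\<exists>i j. even (i + j) \<and> v \<bullet> e1 = of_int i * A \<and> v \<bullet> e2 = of_int j * B)"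
  unfolding lat_def rlat_def by auto

lemma int_sq: "(i :: int) \<noteq> 0 \<Longrightarrow> 1 \<le> (of_int i :: real)^2" "i \<noteq> 0 \<Longrightarrow> even i \<Longrightarrow> 4 \<le> (of_int i :: real)^2"
proof -
  show "1 \<le> (of_int i :: real)^2" if "i \<noteq> 0"
  proof -
    have "1 \<le> \<bar>i\<bar>" using that by simp
    then have "(1::real) \<le> \<bar>of_int i\<bar>" by linarith
    then show ?thesis using power_mono[of 1 "\<bar>of_int i :: real\<bar>" 2] by simp
  qed
  show "4 \<le> (of_int i :: real)^2" if "i \<noteq> 0" "even i"
  proof -
    have "2 \<le> \<bar>i\<bar>" using that by (auto elim!: evenE)
    then have "(2::real) \<le> \<bar>of_int i\<bar>" by linarith
    then show ?thesis using power_mono[of 2 "\<bar>of_int i :: real\<bar>" 2] by simp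
  qed
qed

text \<open>In this range the vectors \<open>(\<plusminus>A, \<plusminus>B)\<close> are longer than
  \<open>2 * B\<close>, so the short diagonal of the rhombus alone gives the shortest vectors and
  its axis is preserved.\<close>

lemma lat_short:
  assumes AB: "0 < A" "0 < B" "3 * B^2 < A^2" and v: "v \<in> lat A B" "v \<bullet> v = 4 * B^2"
  shows "v = (2 * B) *\<^sub>R e2 \<or> v = - (2 * B) *\<^sub>R e2"
proof -
  obtain i j where ij: "even (i + j)" "v \<bullet> e1 = of_int i * A" "v \<bullet> e2 = of_int j * B" using v(1) unfolding lat_mem by blast
  have q: "(of_int i)^2 * A^2 + (of_int j)^2 * B^2 = 4 * B^2"
    using v(2) unfolding inner_frame[of v v] ij by (simp add: power2_eq_square algebra_simps)
  have p: "0 < A^2" "0 < B^2" using AB by simp_all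
  have i0: "i = 0"
  proof (rule ccontr)
    assume i: "i \<noteq> 0"
    show False
    \<comment> \<open>For \<open>j = 0\<close> parity makes \<open>i\<close> even, so
      \<open>i\<close> squared is at least 4; otherwise both squares are at least 1.\<close>
    proof (cases "j = 0")
      case True
      then have "4 * A^2 \<le> (of_int i)^2 * A^2" using int_sq(2)[OF i] ij(1) p by (intro mult_right_mono) auto
      then show False using q True AB(3) p by simp
    next
      case False
      have "1 * A^2 \<le> (of_int i)^2 * A^2" "1 * B^2 \<le> (of_int j)^2 * B^2"
        using int_sq(1)[OF i] int_sq(1)[OF False] p by (intro mult_right_mono; simp)+
      then show False using q AB(3) p by simp
    qed
  qed
  then have "(of_int j)^2 = (2::real)^2" using q p by simp
  then have "of_int j = (2::real) \<or> of_int j = (- 2::real)" by (simp only: power2_eq_iff)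
  then show ?thesis using ij i0 by (auto intro!: frame_eqI simp: ip)
qed

end

lemma frame_swap: "frame e1 e2 \<Longrightarrow> frame e2 e1"
  unfolding frame_def by (simp add: inner_commute)

lemma lat_swap: "frame e1 e2 \<Longrightarrow> frame.lat e1 e2 A B = frame.lat e2 e1 B A"
  unfolding frame.lat_def[OF frame_swap] frame.lat_def by (auto simp: rlat_def add.commute)

context frame
begin

lemma axis_other:
  assumes f: "orthogonal_transformation f" and 2: "f e2 = e2 \<or> f e2 = - e2"
  shows "f e1 = e1 \<or> f e1 = - e1"
proof -
  have "f e1 \<bullet> f e2 = 0" "f e1 \<bullet> f e1 = 1" using f ip unfolding orthogonal_transformation_def by auto
  then have z: "f e1 \<bullet> e2 = 0" "f e1 \<bullet> f e1 = 1" using 2 by auto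
  then have "(f e1 \<bullet> e1)^2 = 1^2" using inner_frame[of "f e1" "f e1"] by (simp add: power2_eq_square)
  then have "f e1 \<bullet> e1 = 1 \<or> f e1 \<bullet> e1 = - 1" by (simp only: power2_eq_iff)
  then show ?thesis using z(1) by (auto intro!: frame_eqI simp: ip)
qed

lemma lat_short_axis:
  assumes AB: "0 < A" "0 < B" "3 * B^2 < A^2"
    and f: "orthogonal_transformation f" "f ` lat A B \<subseteq> lat A B"
  shows "f e2 = e2 \<or> f e2 = - e2"
proof -
  have "(2 * B) *\<^sub>R e2 \<in> lat A B" unfolding lat_mem by (intro exI[of _ 0] exI[of _ 2]) (simp add: ip)
  then have "f ((2 * B) *\<^sub>R e2) \<in> lat A B" using f(2) by blast
  moreover have "f ((2 * B) *\<^sub>R e2) \<bullet> f ((2 * B) *\<^sub>R e2) = 4 * B^2"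
    using f(1) unfolding orthogonal_transformation_def by (simp add: ip power2_eq_square)
  ultimately have "f ((2 * B) *\<^sub>R e2) = (2 * B) *\<^sub>R e2 \<or> f ((2 * B) *\<^sub>R e2) = - (2 * B) *\<^sub>R e2"
    by (rule lat_short[OF AB])
  moreover have "f ((2 * B) *\<^sub>R e2) = (2 * B) *\<^sub>R f e2"
    using f(1) unfolding orthogonal_transformation_def by (simp add: linear_scale)
  ultimately have "(2 * B) *\<^sub>R f e2 = (2 * B) *\<^sub>R e2 \<or> (2 * B) *\<^sub>R f e2 = (2 * B) *\<^sub>R (- e2)" by simp
  then show ?thesis using AB(2) by (simp only: scaleR_cancel_left) auto
qed

text \<open>Both inequalities together say that \<open>4 * A^2\<close> and \<open>4 * B^2\<close>
  exceed \<open>A^2 + B^2\<close>: neither diagonal of the rhombus is as short as its sides.\<close>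

lemma lat_diag:
  assumes AB: "0 < A" "0 < B" "A^2 < 3 * B^2" "B^2 < 3 * A^2" and v: "v \<in> lat A B" "v \<bullet> v = A^2 + B^2"
  shows "(v \<bullet> e1 = A \<or> v \<bullet> e1 = - A) \<and> (v \<bullet> e2 = B \<or> v \<bullet> e2 = - B)"
proof -
  obtain i j where ij: "even (i + j)" "v \<bullet> e1 = of_int i * A" "v \<bullet> e2 = of_int j * B" using v(1) unfolding lat_mem by blast
  have q: "(of_int i)^2 * A^2 + (of_int j)^2 * B^2 = A^2 + B^2"
    using v(2) unfolding inner_frame[of v v] ij by (simp add: power2_eq_square algebra_simps)
  have p: "0 < A^2" "0 < B^2" using AB by simp_all
  have i: "i \<noteq> 0"
  proof
    assume i: "i = 0"
    have "j \<noteq> 0" using i q p by auto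
    then have "4 * B^2 \<le> (of_int j)^2 * B^2" using int_sq(2)[of j] ij(1) i p by (intro mult_right_mono) auto
    then show False using q i AB(3) by simp
  qed
  have j: "j \<noteq> 0"
  proof
    assume j: "j = 0"
    then have "4 * A^2 \<le> (of_int i)^2 * A^2" using int_sq(2)[of i] ij(1) i p by (intro mult_right_mono) auto
    then show False using q j AB(4) by simp
  qed
  have "1 * A^2 \<le> (of_int i)^2 * A^2" "1 * B^2 \<le> (of_int j)^2 * B^2"
    using int_sq(1)[OF i] int_sq(1)[OF j] p by (intro mult_right_mono; simp)+
  then have "(of_int i)^2 * A^2 = 1 * A^2" "(of_int j)^2 * B^2 = 1 * B^2" using q by linarith+
  then have "(of_int i)^2 = (1::real)^2" "(of_int j)^2 = (1::real)^2" using p by simp_all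
  then have "of_int i = (1::real) \<or> of_int i = (- 1::real)" "of_int j = (1::real) \<or> of_int j = (- 1::real)"
    by (simp_all only: power2_eq_iff)
  then show ?thesis using ij by auto
qed

text \<open>The four sides \<open>(\<plusminus>A, \<plusminus>B)\<close> are permuted, and a sum of
  two of them is \<open>2 * A\<close> times the image of \<open>e1\<close>. So this image lies on an
  axis, and it could be on the second one only if \<open>A = B\<close>.\<close>

lemma lat_diag_axis:
  assumes AB: "0 < A" "0 < B" "A^2 < 3 * B^2" "B^2 < 3 * A^2" "A \<noteq> B"
    and f: "orthogonal_transformation f" "f ` lat A B \<subseteq> lat A B"
  shows "f e1 = e1 \<or> f e1 = - e1"
proof -
  have pr: "f v \<bullet> f w = v \<bullet> w" and l: "linear f" for v w using f(1) unfolding orthogonal_transformation_def by auto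
  define a where "a = A *\<^sub>R e1 + B *\<^sub>R e2"
  define b where "b = A *\<^sub>R e1 - B *\<^sub>R e2"
  have m: "a \<in> lat A B" "b \<in> lat A B" unfolding lat_mem a_def b_def
    by (intro exI[of _ 1] exI[of _ 1], simp add: ip inner_add_left) (rule exI[of _ 1], rule exI[of _ "- 1"], simp add: ip inner_diff_left)
  have n: "a \<bullet> a = A^2 + B^2" "b \<bullet> b = A^2 + B^2"
    unfolding a_def b_def by (simp_all add: inner_add inner_diff ip power2_eq_square)
  have fa: "(f a \<bullet> e1 = A \<or> f a \<bullet> e1 = - A) \<and> (f a \<bullet> e2 = B \<or> f a \<bullet> e2 = - B)"
    by (rule lat_diag[OF AB(1-4)]) (use m f(2) pr n in auto)
  have fb: "(f b \<bullet> e1 = A \<or> f b \<bullet> e1 = - A) \<and> (f b \<bullet> e2 = B \<or> f b \<bullet> e2 = - B)"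
    by (rule lat_diag[OF AB(1-4)]) (use m f(2) pr n in auto)
  have "a + b = (2 * A) *\<^sub>R e1" unfolding a_def b_def mult_2 scaleR_add_left by (rule double_sum)
  then have s: "f a + f b = (2 * A) *\<^sub>R f e1" using l by (metis linear_add linear_scale)
  have c: "f a \<bullet> e1 + f b \<bullet> e1 = 2 * A * (f e1 \<bullet> e1)" "f a \<bullet> e2 + f b \<bullet> e2 = 2 * A * (f e1 \<bullet> e2)"
    using s by (metis inner_add_left inner_scaleR_left)+
  have u: "(f e1 \<bullet> e1)^2 + (f e1 \<bullet> e2)^2 = 1"
    using inner_frame[of "f e1" "f e1"] pr[of e1 e1] by (simp add: ip power2_eq_square)
  have "A * (f e1 \<bullet> e1) = A * 1 \<or> A * (f e1 \<bullet> e1) = A * 0 \<or> A * (f e1 \<bullet> e1) = A * - 1" using fa fb c(1) by auto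
  then have x: "f e1 \<bullet> e1 = 1 \<or> f e1 \<bullet> e1 = 0 \<or> f e1 \<bullet> e1 = - 1" using AB(1) by (simp only: mult_cancel_left) simp
  have y: "A * (f e1 \<bullet> e2) = B \<or> f e1 \<bullet> e2 = 0 \<or> A * (f e1 \<bullet> e2) = - B" using fa fb c(2) AB(1) by auto
  have "f e1 \<bullet> e1 \<noteq> 0"
  proof
    assume z: "f e1 \<bullet> e1 = 0"
    then have "(f e1 \<bullet> e2)^2 = 1" using u by simp
    then have "f e1 \<bullet> e2 = 1 \<or> f e1 \<bullet> e2 = - 1" by (simp add: power2_eq_1_iff)
    then show False using y AB by auto
  qed
  then have "f e1 \<bullet> e1 = 1 \<or> f e1 \<bullet> e1 = - 1" using x by blast
  moreover from this have "f e1 \<bullet> e2 = 0" using u by auto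
  ultimately show ?thesis by (auto intro!: frame_eqI simp: ip)
qed

lemma lat_axis:
  assumes AB: "0 < A" "0 < B" "A \<noteq> B" "A^2 \<noteq> 3 * B^2" "B^2 \<noteq> 3 * A^2"
    and f: "orthogonal_transformation f" "f ` lat A B \<subseteq> lat A B"
  shows "(f e1 = e1 \<or> f e1 = - e1) \<and> (f e2 = e2 \<or> f e2 = - e2)"
proof -
  have fr: "frame e2 e1" by (rule frame_swap) unfold_locales
  have sw: "lat A B = frame.lat e2 e1 B A" by (rule lat_swap) unfold_locales
  have o: "f e1 = e1 \<or> f e1 = - e1 \<Longrightarrow> f e2 = e2 \<or> f e2 = - e2" by (rule frame.axis_other[OF fr f(1)])
  consider "3 * B^2 < A^2" | "3 * A^2 < B^2" | "A^2 < 3 * B^2" "B^2 < 3 * A^2" using AB(4,5) by linarith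
  then show ?thesis
  proof cases
    case 1 then show ?thesis using lat_short_axis[OF AB(1,2) 1 f] axis_other[OF f(1)] by blast
  next
    case 2 then show ?thesis using frame.lat_short_axis[OF fr AB(2,1) 2 f(1)] f(2) o unfolding sw by blast
  next
    case 3 then show ?thesis using lat_diag_axis[OF AB(1,2) 3 AB(3) f] o by blast
  qed
qed

end

section \<open>Spikes that reduce the symmetry group to the eight symmetries of the square\<close>

context frame
begin

abbreviation spikes :: "real \<Rightarrow> (real^2) set" where
  "spikes r \<equiv> {r *\<^sub>R e1, - (r *\<^sub>R e1), r *\<^sub>R e2, - (r *\<^sub>R e2)}"

definition lift :: "conf set \<Rightarrow> (real^2) set" where "lift Z = {v. (v \<bullet> e1, v \<bullet> e2) \<in> Z}"

definition frame_vec :: "conf \<Rightarrow> real^2" where "frame_vec z = fst z *\<^sub>R e1 + snd z *\<^sub>R e2"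

lemma frame_vec: "frame_vec z \<bullet> e1 = fst z" "frame_vec z \<bullet> e2 = snd z" "frame_vec (v \<bullet> e1, v \<bullet> e2) = v"
  unfolding frame_vec_def using decomp[of v] by (simp_all add: ip inner_add_left)

lemma lift_image: "lift Z = frame_vec ` Z"
proof
  show "lift Z \<subseteq> frame_vec ` Z"
  proof
    fix v assume "v \<in> lift Z"
    then show "v \<in> frame_vec ` Z" unfolding lift_def using frame_vec(3)[of v] by (metis image_eqI mem_Collect_eq)
  qed
  show "frame_vec ` Z \<subseteq> lift Z" unfolding lift_def by (auto simp: frame_vec)
qed

lemma cont_frame_vec: "continuous_on Z frame_vec"
  unfolding frame_vec_def by (intro continuous_intros)

lemma norm_e: "norm e1 = 1" "norm e2 = 1"
  using n1 n2 by (simp_all add: norm_eq_sqrt_inner)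

lemma spikes_cancel: assumes "0 < r" "r *\<^sub>R v \<in> spikes r" shows "v = e1 \<or> v = - e1 \<or> v = e2 \<or> v = - e2"
proof -
  have "r *\<^sub>R v \<in> {r *\<^sub>R e1, r *\<^sub>R (- e1), r *\<^sub>R e2, r *\<^sub>R (- e2)}" using assms(2) by simp
  then show ?thesis using assms(1) by (auto simp del: scaleR_minus_right)
qed

text \<open>Both points lie in the closed ball of radius \<open>r\<close>, where distance
  \<open>2 * r\<close> forces norm \<open>r\<close>; the parallelogram law then makes them
  antipodal. Points of norm \<open>r\<close> are spikes.\<close>

lemma far_points:
  assumes r: "0 < r" "\<And>v. v \<in> K \<Longrightarrow> norm v < r"
    and pq: "p \<in> K \<union> spikes r" "q \<in> K \<union> spikes r" "dist p q = 2 * r"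
  shows "p \<in> spikes r \<and> q = - p"
proof -
  have s: "norm v = r" if "v \<in> spikes r" for v using that r(1) norm_e by auto
  have le: "norm v \<le> r" if "v \<in> K \<union> spikes r" for v using that r(2) s by fastforce
  have t: "2 * r \<le> norm p + norm q" using pq(3) norm_triangle_ineq4[of p q] by (simp add: dist_norm)
  have np: "norm p = r" "norm q = r" using t le[OF pq(1)] le[OF pq(2)] by linarith+
  then have "p \<notin> K" using r(2) by fastforce
  then have pS: "p \<in> spikes r" using pq(1) by blast
  have n2: "v \<bullet> v = (norm v)^2" for v :: "real^2" by (simp add: power2_norm_eq_inner)
  have "(norm (p - q))^2 + (norm (p + q))^2 = 2 * (norm p)^2 + 2 * (norm q)^2"
    using inner_parallelogram[of p q] unfolding n2 .
  moreover have "norm (p - q) = 2 * r" using pq(3) by (simp add: dist_norm)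
  ultimately have "(norm (p + q))^2 = 0" using np by (simp add: power2_eq_square)
  then have "p + q = 0" by simp
  then have "q = - p" by (metis add.commute add_eq_0_iff)
  then show ?thesis using pS by blast
qed

lemma Symm_spikes_subset:
  assumes r: "0 < r" "\<And>v. v \<in> K \<Longrightarrow> norm v < r" and f: "f \<in> Symm (K \<union> spikes r)"
  shows "f \<in> phi ` dih"
proof -
  have iso: "\<And>x y. dist (f x) (f y) = dist x y" and im: "f ` (K \<union> spikes r) = K \<union> spikes r"
    using f unfolding Symm_def plane_isometry_def by auto
  have sp: "f p \<in> spikes r \<and> f (- p) = - f p" if p: "p \<in> spikes r" for p
  proof (rule far_points[OF r])
    have mp: "- p \<in> spikes r" using p by auto
    show "f p \<in> K \<union> spikes r" "f (- p) \<in> K \<union> spikes r" using im p mp by blast+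
    have "dist p (- p) = norm (2 *\<^sub>R p)" by (simp add: dist_norm scaleR_2)
    then show "dist (f p) (f (- p)) = 2 * r" using iso p r(1) norm_e by auto
  qed
  \<comment> \<open>\<open>f 0\<close> has distance \<open>r\<close> from both of the antipodal
    points \<open>f ?p\<close> and \<open>- f ?p\<close> of norm \<open>r\<close>; by the
    parallelogram law it is the origin.\<close>
  have f0: "f 0 = 0"
  proof -
    let ?p = "r *\<^sub>R e1"
    have p: "f ?p \<in> spikes r" "f (- ?p) = - f ?p" using sp[of ?p] by auto
    have n: "norm (f ?p) = r" using p(1) r(1) norm_e by auto
    have "norm (f 0 - f ?p) = r" using iso[of 0 ?p] r(1) norm_e by (simp add: dist_norm)
    moreover have "norm (f 0 + f ?p) = r" using iso[of 0 "- ?p"] r(1) norm_e p(2) by (simp add: dist_norm)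
    moreover have "(norm (f 0 - f ?p))^2 + (norm (f 0 + f ?p))^2 = 2 * (norm (f 0))^2 + 2 * (norm (f ?p))^2"
      using inner_parallelogram[of "f 0" "f ?p"] by (simp add: power2_norm_eq_inner)
    ultimately have "(norm (f 0))^2 = 0" using n by simp
    then show ?thesis by simp
  qed
  have ot: "orthogonal_transformation f" using f0 iso by (simp add: orthogonal_transformation_isometry)
  then have l: "linear f" unfolding orthogonal_transformation_def by simp
  have "r *\<^sub>R f e1 \<in> spikes r" "r *\<^sub>R f e2 \<in> spikes r"
    using sp[of "r *\<^sub>R e1"] sp[of "r *\<^sub>R e2"] l by (simp_all add: linear_scale)
  then show ?thesis using orthogonal_axis[OF ot] spikes_cancel[OF r(1)] by blast
qed

lemma phi_spikes: "x \<in> dih \<Longrightarrow> v \<in> spikes r \<Longrightarrow> phi x v \<in> spikes r"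
proof -
  assume x: "x \<in> dih" and v: "v \<in> spikes r"
  have pe: "phi x (t *\<^sub>R w) = t *\<^sub>R phi x w" "phi x (- w) = - phi x w" for t w
    by (rule frame_eqI; simp add: phi_coord algebra_simps)+
  have "phi x v = r *\<^sub>R phi x e1 \<or> phi x v = - (r *\<^sub>R phi x e1) \<or> phi x v = r *\<^sub>R phi x e2 \<or> phi x v = - (r *\<^sub>R phi x e2)"
    using v by (auto simp: pe)
  moreover have "phi x e1 \<in> {e1, - e1, e2, - e2}" "phi x e2 \<in> {e1, - e1, e2, - e2}"
    unfolding phi_e using dih_cases[OF x] by (elim disjE; simp add: c4_def s4_def m4_def)+
  ultimately show "phi x v \<in> spikes r" by auto
qed

lemma phi_lift:
  assumes Z: "\<And>x y. (x, y) \<in> Z \<Longrightarrow> (- x, y) \<in> Z \<and> (y, x) \<in> Z" and x: "x \<in> dih" and v: "v \<in> lift Z"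
  shows "phi x v \<in> lift Z"
proof -
  define a where "a = v \<bullet> e1"
  define b where "b = v \<bullet> e2"
  have m: "(a, b) \<in> Z" using v unfolding lift_def a_def b_def by simp
  then have "(- a, b) \<in> Z" "(b, a) \<in> Z" "(- b, a) \<in> Z" "(a, - b) \<in> Z" "(- a, - b) \<in> Z" "(b, - a) \<in> Z" "(- b, - a) \<in> Z"
    using Z by blast+
  then show ?thesis unfolding lift_def mem_Collect_eq phi_coord a_def[symmetric] b_def[symmetric]
    using dih_cases[OF x] m by (elim disjE; simp add: c4_def s4_def m4_def)
qed

lemma Symm_spikes:
  assumes r: "0 < r" "\<And>v. v \<in> lift Z \<Longrightarrow> norm v < r"
    and Z: "\<And>x y. (x, y) \<in> Z \<Longrightarrow> (- x, y) \<in> Z \<and> (y, x) \<in> Z"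
  shows "Symm (lift Z \<union> spikes r) = phi ` dih"
proof
  show "Symm (lift Z \<union> spikes r) \<subseteq> phi ` dih" using Symm_spikes_subset[OF r] by blast
  show "phi ` dih \<subseteq> Symm (lift Z \<union> spikes r)"
  proof
    fix f assume "f \<in> phi ` dih"
    then obtain x where x: "x \<in> dih" "f = phi x" by blast
    have "phi x ` (lift Z \<union> spikes r) \<subseteq> lift Z \<union> spikes r" if "x \<in> dih" for x
      using phi_lift[OF Z that] phi_spikes[OF that] by blast
    then have "phi x ` (lift Z \<union> spikes r) = lift Z \<union> spikes r" by (rule phi_Symm[OF _ x(1)])
    then show "f \<in> Symm (lift Z \<union> spikes r)" unfolding Symm_def x(2) using phi_isometry[OF x(1)] by simp
  qed
qed

abbreviation klein :: "(int \<times> int) set" where "klein \<equiv> {(0, 0), (0, 1), (2, 0), (2, 1)}"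

lemma point_group_lat:
  assumes AB: "0 < A" "0 < B" "A \<noteq> B" "A^2 \<noteq> 3 * B^2" "B^2 \<noteq> 3 * A^2"
  shows "point_group (lat A B) = phi ` klein"
proof
  show "point_group (lat A B) \<subseteq> phi ` klein"
  proof
    fix f assume f: "f \<in> point_group (lat A B)"
    then have iso: "\<And>x y. dist (f x) (f y) = dist x y" and f0: "f 0 = 0" and im: "f ` lat A B \<subseteq> lat A B"
      unfolding point_group_def plane_isometry_def by auto
    have ot: "orthogonal_transformation f" using f0 iso by (simp add: orthogonal_transformation_isometry)
    then have l: "linear f" unfolding orthogonal_transformation_def by simp
    have "f = phi (0, 0) \<or> f = phi (0, 1) \<or> f = phi (2, 0) \<or> f = phi (2, 1)"
      using lat_axis[OF AB ot im] linear_phiI[OF l, of "(0, 0)"] linear_phiI[OF l, of "(0, 1)"]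
        linear_phiI[OF l, of "(2, 0)"] linear_phiI[OF l, of "(2, 1)"]
      unfolding phi_e by (auto simp: c4_def s4_def m4_def)
    then show "f \<in> phi ` klein" by blast
  qed
  show "phi ` klein \<subseteq> point_group (lat A B)"
  proof
    fix f assume "f \<in> phi ` klein"
    then obtain x where x: "x \<in> klein" "f = phi x" by blast
    have x8: "x \<in> dih" using x(1) by auto
    have sub: "phi x v \<in> lat A B" if v: "v \<in> lat A B" for v
    proof -
      obtain i j where ij: "even (i + j)" "v \<bullet> e1 = of_int i * A" "v \<bullet> e2 = of_int j * B" using v unfolding lat_mem by blast
      define s :: int where "s = (if fst x = 0 then 1 else - 1)"
      define t :: int where "t = s * (if snd x = 0 then 1 else - 1)"
      have st: "s = 1 \<or> s = - 1" "t = 1 \<or> t = - 1" unfolding s_def t_def by simp_all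
      have "c4 (fst x) = of_int s" "s4 (fst x) = 0" "c4 (fst x) * m4 (snd x) = of_int t"
        unfolding s_def t_def using x(1) by (elim insertE emptyE; simp add: c4_def s4_def m4_def)+
      then have p: "phi x v \<bullet> e1 = of_int (s * i) * A" "phi x v \<bullet> e2 = of_int (t * j) * B"
        unfolding phi_coord ij(2,3) by simp_all
      have "even (s * i + t * j)" using ij(1) st by auto
      then show ?thesis unfolding lat_mem using p by blast
    qed
    have involution: "phi x (phi x v) = v" for v
      using x(1) by (intro frame_eqI; elim insertE emptyE; simp add: phi_coord c4_def s4_def m4_def)
    have "phi x ` lat A B = lat A B"
    proof
      show "lat A B \<subseteq> phi x ` lat A B" using sub involution by (metis image_eqI subsetI)
    qed (use sub in blast)
    moreover have "phi x 0 = 0" unfolding phi_def by simp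
    ultimately show "f \<in> point_group (lat A B)" unfolding point_group_def x(2) using phi_isometry[OF x8] by simp
  qed
qed

text \<open>The index comes from Lagrange's theorem with orders 8 and 4. The elements of
  \<open>klein\<close> are involutions, so inverses are immediate.\<close>

lemma group_structure:
  assumes S: "Symm F = phi ` dih" and P: "P = phi ` klein"
  shows "subgroup P (Sym_group F)" "card (rcosets\<^bsub>Sym_group F\<^esub> P) = 2" "Sym_group F \<cong> D4"
proof -
  interpret G: group "Sym_group F" by (rule group_Sym_group)
  have car: "carrier (Sym_group F) = phi ` dih" and mot_mul: "f \<otimes>\<^bsub>Sym_group F\<^esub> g = f \<circ> g" and mot_one: "\<one>\<^bsub>Sym_group F\<^esub> = id" for f g
    unfolding Sym_group_def S by simp_all
  have Q48: "klein \<subseteq> dih" by auto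
  have mult4: "x \<otimes>\<^bsub>D4\<^esub> y \<in> klein" "x \<otimes>\<^bsub>D4\<^esub> x = (0, 0)" if "x \<in> klein" "y \<in> klein" for x y
    using that by (auto simp: D4_def)
  show sub: "subgroup P (Sym_group F)"
  proof (rule G.subgroupI)
    show "P \<subseteq> carrier (Sym_group F)" unfolding car P using Q48 by blast
    show "P \<noteq> {}" unfolding P by simp
    show "inv\<^bsub>Sym_group F\<^esub> f \<in> P" if f: "f \<in> P" for f
    proof -
      obtain x where x: "x \<in> klein" "f = phi x" using f unfolding P by blast
      have "f \<circ> f = id" using phi_mult[of x x] mult4(2)[OF x(1,1)] x Q48 phi_one by auto
      then have "inv\<^bsub>Sym_group F\<^esub> f = f"
        by (intro G.inv_equality) (use x Q48 in \<open>auto simp: mot_mul mot_one car\<close>)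
      then show ?thesis using f by simp
    qed
    show "f \<otimes>\<^bsub>Sym_group F\<^esub> g \<in> P" if fg: "f \<in> P" "g \<in> P" for f g
    proof -
      obtain x y where xy: "x \<in> klein" "f = phi x" "y \<in> klein" "g = phi y" using fg unfolding P by blast
      have "f \<circ> g = phi (x \<otimes>\<^bsub>D4\<^esub> y)" using phi_mult[of x y] xy Q48 by auto
      then show ?thesis unfolding mot_mul P using mult4(1)[OF xy(1,3)] by blast
    qed
  qed
  have c8: "card (phi ` dih) = 8" using phi_inj by (simp add: card_image card_cartesian_product)
  have c4: "card P = 4" unfolding P using inj_on_subset[OF phi_inj Q48] by (simp add: card_image)
  have "card (rcosets\<^bsub>Sym_group F\<^esub> P) * card P = order (Sym_group F)" by (rule G.lagrange[OF sub])
  then show "card (rcosets\<^bsub>Sym_group F\<^esub> P) = 2" unfolding order_def car c8 c4 by simp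
  define psi where "psi = the_inv_into dih phi"
  have psi: "psi (phi x) = x" if "x \<in> dih" for x unfolding psi_def by (rule the_inv_into_f_f[OF phi_inj that])
  have carD: "carrier D4 = dih" by (simp add: D4_def)
  have "psi \<in> iso (Sym_group F) D4"
  proof (rule isoI)
    show "psi \<in> hom (Sym_group F) D4"
    proof (rule homI)
      show "psi f \<in> carrier D4" if "f \<in> carrier (Sym_group F)" for f using that psi unfolding car carD by auto
      show "psi (f \<otimes>\<^bsub>Sym_group F\<^esub> g) = psi f \<otimes>\<^bsub>D4\<^esub> psi g"
        if fg: "f \<in> carrier (Sym_group F)" "g \<in> carrier (Sym_group F)" for f g
      proof -
        obtain x y where xy: "x \<in> dih" "f = phi x" "y \<in> dih" "g = phi y" using fg unfolding car by blast
        show ?thesis unfolding mot_mul xy(2,4) phi_mult[OF xy(1,3)] psi[OF xy(1)] psi[OF xy(3)]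
          by (rule psi[OF D4_mult_closed[OF xy(1,3)]])
      qed
    qed
    show "bij_betw psi (carrier (Sym_group F)) (carrier D4)"
      unfolding car carD psi_def by (rule bij_betw_the_inv_into) (use phi_inj in \<open>auto simp: bij_betw_def\<close>)
  qed
  then show "Sym_group F \<cong> D4" unfolding is_iso_def by blast
qed

section \<open>The domain in the plane\<close>

lemma open_minus_finite_nonempty:
  fixes Z :: "(real^2) set"
  assumes "open Z" "Z \<noteq> {}" "finite S"
  shows "Z - S \<noteq> {}"
proof
  assume "Z - S = {}"
  then have "finite Z" using assms(3) by (metis Diff_eq_empty_iff finite_subset)
  then show False using assms(1,2) by (metis finite_imp_not_open)
qed

lemma lift_fundamental_domain:
  assumes AB: "0 < A" "0 < B" and Z: "core A B Z" and S: "finite S"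
  shows "fundamental_domain (lat A B) (lift Z \<union> S)"
  unfolding fundamental_domain_def
proof (intro conjI ballI impI)
  have comp: "compact Z" using Z unfolding core_def by simp
  show "compact (lift Z \<union> S)" unfolding lift_image
    by (intro compact_Un compact_continuous_image cont_frame_vec comp finite_imp_compact S)
  show "{p + v |p v. p \<in> lift Z \<union> S \<and> v \<in> lat A B} = UNIV"
  proof -
    have "\<exists>p v. w = p + v \<and> p \<in> lift Z \<union> S \<and> v \<in> lat A B" for w
    proof -
      obtain p v where pv: "p \<in> Z" "v \<in> rlat A B" "(w \<bullet> e1, w \<bullet> e2) = p + v"
        using Z unfolding core_def by blast
      have "w = frame_vec p + frame_vec v"
        using pv(3) by (intro frame_eqI) (simp_all add: inner_add_left frame_vec prod_eq_iff)
      moreover have "frame_vec p \<in> lift Z" unfolding lift_def using pv(1) by (simp add: frame_vec)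
      moreover have "frame_vec v \<in> lat A B" unfolding lat_def using pv(2) by (simp add: frame_vec)
      ultimately show ?thesis by blast
    qed
    then show ?thesis by auto
  qed
  fix v assume v: "v \<in> lat A B" "v \<noteq> 0"
  let ?F = "lift Z \<union> S"
  let ?z = "(v \<bullet> e1, v \<bullet> e2)"
  show "interior ?F \<inter> interior ((\<lambda>p. p + v) ` ?F) = {}"
  proof (rule ccontr)
    assume n: "interior ?F \<inter> interior ((\<lambda>p. p + v) ` ?F) \<noteq> {}"
    \<comment> \<open>The finitely many added points and their translates are cut out of the
      overlap. What remains is open and nonempty and lies in both lifts, which reduces packing to
      that of \<open>Z\<close>.\<close>
    let ?S = "S \<union> (\<lambda>p. p + v) ` S"
    let ?O = "interior ?F \<inter> interior ((\<lambda>p. p + v) ` ?F) - ?S"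
    have fS: "finite ?S" using S by simp
    have ne: "?O \<noteq> {}" by (rule open_minus_finite_nonempty[OF _ n fS]) (intro open_Int open_interior)
    have op: "open ?O" by (intro open_Diff open_Int open_interior finite_imp_closed fS)
    have sub: "?O \<subseteq> lift Z \<inter> (\<lambda>p. p + v) ` lift Z" using interior_subset by blast
    let ?P = "frame_vec -` ?O"
    have oP: "open ?P" using op by (intro open_vimage cont_frame_vec)
    have P1: "?P \<subseteq> Z"
    proof
      fix z assume "z \<in> ?P"
      then have "frame_vec z \<in> lift Z" using sub by blast
      then show "z \<in> Z" unfolding lift_def by (simp add: frame_vec)
    qed
    have P2: "?P \<subseteq> (\<lambda>p. p + ?z) ` Z"
    proof
      fix z assume "z \<in> ?P"
      then obtain p where p: "p \<in> lift Z" "frame_vec z = p + v" using sub by blast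
      have "z = (frame_vec z \<bullet> e1, frame_vec z \<bullet> e2)" by (simp add: frame_vec)
      then have "z = (p \<bullet> e1, p \<bullet> e2) + ?z" unfolding p(2) by (simp add: inner_add_left)
      then show "z \<in> (\<lambda>p. p + ?z) ` Z" using p(1) unfolding lift_def by blast
    qed
    have "?P \<subseteq> interior Z \<inter> interior ((\<lambda>p. p + ?z) ` Z)" using P1 P2 oP by (simp add: interior_maximal)
    moreover have "interior Z \<inter> interior ((\<lambda>p. p + ?z) ` Z) = {}"
    proof -
      have "?z \<noteq> 0" using v(2) frame_eqI[of v 0] by (auto simp: zero_prod_def)
      then show ?thesis using Z v(1) unfolding core_def lat_def by blast
    qed
    ultimately have "?P = {}" by blast
    moreover obtain w where "w \<in> ?O" using ne by blast
    then have "(w \<bullet> e1, w \<bullet> e2) \<in> ?P" by (simp add: frame_vec)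
    ultimately show False by blast
  qed
qed

theorem lat_domain:
  assumes AB: "0 < A" "0 < B" "A \<noteq> B" "A^2 \<noteq> 3 * B^2" "B^2 \<noteq> 3 * A^2"
  shows "\<exists>F. fundamental_domain (lat A B) F \<and> subgroup (point_group (lat A B)) (Sym_group F) \<and>
    card (rcosets\<^bsub>Sym_group F\<^esub> (point_group (lat A B))) = 2 \<and> Sym_group F \<cong> D4"
proof -
  obtain Z where Z: "core A B Z" using core_exists[OF AB(1,2)] by blast
  have "compact (lift Z)" unfolding lift_image
    using Z by (intro compact_continuous_image cont_frame_vec) (simp add: core_def)
  then have "bounded (lift Z)" by (rule compact_imp_bounded)
  then obtain b where b: "\<forall>v\<in>lift Z. norm v \<le> b" unfolding bounded_iff by (elim exE)
  \<comment> \<open>The bound on the lift has to be strict, so that the spikes are the only points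
    of norm \<open>r\<close>.\<close>
  define r where "r = max b 0 + 1"
  have r0: "0 < r" unfolding r_def by linarith
  have r: "norm v < r" if "v \<in> lift Z" for v
    using bspec[OF b that] unfolding r_def by linarith
  have "Symm (lift Z \<union> spikes r) = phi ` dih"
    by (rule Symm_spikes[OF r0 r]) (use Z in \<open>auto simp: core_def\<close>)
  note g = group_structure[OF this point_group_lat[OF AB]]
  have "fundamental_domain (lat A B) (lift Z \<union> spikes r)"
    by (rule lift_fundamental_domain[OF AB(1,2) Z]) simp
  then show ?thesis using g by blast
qed

end

text \<open>Equal length of \<open>a\<close> and \<open>b\<close> means that the diagonals
  \<open>a + b\<close> and \<open>a - b\<close> are orthogonal. The cosine of the angle is
  \<open>(A^2 - B^2) / (A^2 + B^2)\<close>, so the excluded angles are the cases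
  \<open>A = B\<close>, \<open>A^2 = 3 * B^2\<close> and \<open>B^2 = 3 * A^2\<close>.\<close>

lemma rhombic_frame:
  assumes "rhombic_lattice \<Gamma>"
  obtains e1 e2 A B where "frame e1 e2" "0 < A" "0 < B" "A \<noteq> B" "A^2 \<noteq> 3 * B^2" "B^2 \<noteq> 3 * A^2" "\<Gamma> = frame.lat e1 e2 A B"
proof -
  obtain a b where ab: "a \<noteq> b" "independent {a, b}" "\<Gamma> = lattice_span a b" "norm a = norm b"
      "vec_angle a b \<noteq> pi / 2" "vec_angle a b \<noteq> pi / 3" "vec_angle a b \<noteq> 2 * pi / 3"
    using assms unfolding rhombic_lattice_def by blast
  have nz: "a \<noteq> 0" using ab(2) dependent_zero[of "{a, b}"] by auto
  have s0: "a + b \<noteq> 0"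
  proof
    assume "a + b = 0"
    then have "a = - b" by (simp add: eq_neg_iff_add_eq_0)
    then have "a \<in> span {b}" by (simp add: span_neg span_base)
    then show False using ab(1,2) by (simp add: independent_insert)
  qed
  define A where "A = norm (a + b) / 2"
  define B where "B = norm (a - b) / 2"
  have AB: "0 < A" "0 < B" using s0 ab(1) unfolding A_def B_def by simp_all
  define e1 where "e1 = (1 / (2 * A)) *\<^sub>R (a + b)"
  define e2 where "e2 = (1 / (2 * B)) *\<^sub>R (a - b)"
  have aabb: "a \<bullet> a = b \<bullet> b" using ab(4) by (simp add: norm_eq)
  have fr: "frame e1 e2"
  proof
    have "(a + b) \<bullet> (a + b) = (2 * A)^2" "(a - b) \<bullet> (a - b) = (2 * B)^2"
      unfolding A_def B_def by (simp_all add: power2_norm_eq_inner)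
    then show "e1 \<bullet> e1 = 1" "e2 \<bullet> e2 = 1" unfolding e1_def e2_def using AB by (simp_all add: power2_eq_square)
    have "(a + b) \<bullet> (a - b) = 0" using aabb by (simp add: inner_add_left inner_add_right inner_diff_left inner_diff_right inner_commute)
    then show "e1 \<bullet> e2 = 0" unfolding e1_def e2_def by (simp only: inner_scaleR_left inner_scaleR_right mult_zero_right)
  qed
  then interpret frame e1 e2 .
  have ae: "a = A *\<^sub>R e1 + B *\<^sub>R e2" "b = A *\<^sub>R e1 - B *\<^sub>R e2"
  proof -
    have "A *\<^sub>R e1 = (1 / 2) *\<^sub>R (a + b)" "B *\<^sub>R e2 = (1 / 2) *\<^sub>R (a - b)" unfolding e1_def e2_def using AB by simp_all
    then show "a = A *\<^sub>R e1 + B *\<^sub>R e2" "b = A *\<^sub>R e1 - B *\<^sub>R e2"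
      by (simp_all add: scaleR_add_right[symmetric] scaleR_diff_right[symmetric] scaleR_2[symmetric])
  qed
  have L: "\<Gamma> = lat A B"
  proof
    show "\<Gamma> \<subseteq> lat A B"
    proof
      fix v assume "v \<in> \<Gamma>"
      then obtain m n where v: "v = of_int m *\<^sub>R a + of_int n *\<^sub>R b" using ab(3) unfolding lattice_span_def by blast
      have "v \<bullet> e1 = of_int (m + n) * A" "v \<bullet> e2 = of_int (m - n) * B"
        unfolding v ae by (simp_all add: ip inner_add_left inner_diff_left algebra_simps)
      moreover have "even ((m + n) + (m - n))" by simp
      ultimately show "v \<in> lat A B" unfolding lat_mem by blast
    qed
    show "lat A B \<subseteq> \<Gamma>"
    proof
      fix v assume "v \<in> lat A B"
      then obtain i j where ij: "even (i + j)" "v \<bullet> e1 = of_int i * A" "v \<bullet> e2 = of_int j * B" unfolding lat_mem by blast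
      obtain m where m: "i + j = 2 * m" using ij(1) by (elim evenE)
      define n where "n = i - m"
      have i: "i = m + n" "j = m - n" using m unfolding n_def by simp_all
      have "v = of_int m *\<^sub>R a + of_int n *\<^sub>R b"
        unfolding ae by (rule frame_eqI) (simp_all add: ij(2,3) i ip inner_add_left inner_diff_left algebra_simps)
      then show "v \<in> \<Gamma>" unfolding ab(3) lattice_span_def by blast
    qed
  qed
  have ip1: "a \<bullet> b = A^2 - B^2" "a \<bullet> a = A^2 + B^2"
    unfolding ae by (simp_all add: ip inner_add_left inner_add_right inner_diff_right power2_eq_square)
  have va: "vec_angle a b = arccos ((A^2 - B^2) / (A^2 + B^2))"
    unfolding vec_angle_def ab(4)[symmetric] using ip1 by (simp add: norm_eq_sqrt_inner)
  have p: "0 < A^2" "0 < B^2" using AB by simp_all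
  have "A \<noteq> B" using ab(5) unfolding va by auto
  moreover have "A^2 \<noteq> 3 * B^2"
  proof
    assume h: "A^2 = 3 * B^2"
    have "(A^2 - B^2) / (A^2 + B^2) = cos (pi / 3)" unfolding h cos_60 using p by (simp add: field_simps)
    then have "vec_angle a b = pi / 3" unfolding va by (simp add: arccos_cos)
    then show False using ab(6) by simp
  qed
  moreover have "B^2 \<noteq> 3 * A^2"
  proof
    assume h: "B^2 = 3 * A^2"
    have "cos (2 * pi / 3) = - 1 / 2" by (rule cos_120)
    then have "(A^2 - B^2) / (A^2 + B^2) = cos (2 * pi / 3)" unfolding h using p by (simp add: field_simps)
    then have "vec_angle a b = 2 * pi / 3" unfolding va by (simp add: arccos_cos)
    then show False using ab(7) by simp
  qed
  ultimately show thesis using that[OF fr AB] L by blast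
qed

theorem theorem2p1:
  fixes \<Gamma> :: "(real^2) set"
  assumes "rhombic_lattice \<Gamma>"
  shows "\<exists>F. fundamental_domain \<Gamma> F \<and>
             subgroup (point_group \<Gamma>) (Sym_group F) \<and>
             card (rcosets\<^bsub>Sym_group F\<^esub> (point_group \<Gamma>)) = 2 \<and>
             Sym_group F \<cong> D4"
  using rhombic_frame[OF assms] frame.lat_domain by metis

end
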